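(* Let $(A,\operatorname{dom}(A))$ be the string-network operator with constant coefficients described in the context, let $(T(t))_{t\ge0}$ be the contraction semigroup it generates, and let $\Psi_{i\omega,k}$ be the fundamental solutions described in the context. Then the following conditions are equivalent: (i) $(T(t))_{t\ge0}$ is not semi-uniformly stable. (ii) There exists $\omega\in\mathbb R$ with $$|\Psi_{i\omega,\mathrm I}^{12}(b)\Psi_{i\omega,\mathrm{II}}^{11}(b)|+|\Psi_{i\omega,\mathrm I}^{12}(b)\Psi_{i\omega,\mathrm{III}}^{11}(b)|+|\Psi_{i\omega,\mathrm{II}}^{11}(b)\Psi_{i\omega,\mathrm{III}}^{11}(b)|=0.$$ (iii) At least one of the following statements is true: $$\frac{c_{\mathrm I}}{c_{\mathrm{II}}}\in\mathbb E/\mathbb O,\qquad\frac{c_{\mathrm I}}{c_{\mathrm{III}}}\in\mathbb E/\mathbb O,\qquad\frac{c_{\mathrm{II}}}{c_{\mathrm{III}}}\in\mathbb O/\mathbb O,$$ where $c_k=\sqrt{\rho_k/T_k}$, $k\in\{\mathrm I,\mathrm{II},\mathrm{III}\}$. (iv) $A$ has infinitely many eigenvalues on the imaginary axis.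
   Context: String network with constant coefficients. Let $a<b$ be real, $\beta>0$, and let $\rho_k,T_k>0$ be constants for $k\in\{\mathrm I,\mathrm{II},\mathrm{III}\}$. Let $P_1\in\mathbb C^{6\times 6}$ be block-diagonal with three diagonal blocks $\begin{bmatrix}0&1\\1&0\end{bmatrix}$, and $\mathcal H=\operatorname{diag}(\mathcal H_{\mathrm I},\mathcal H_{\mathrm{II}},\mathcal H_{\mathrm{III}})$ with $\mathcal H_k=\begin{bmatrix}1/\rho_k&0\\0&T_k\end{bmatrix}$. The space $X=L_{2,\mathcal H}((a,b);\mathbb C^6)$ is $L_2((a,b);\mathbb C^6)$ with inner product $\langle f,g\rangle_{\mathcal H}=\frac12\int_a^bg^*\mathcal Hf\,d\zeta$. Let $$W_B=\left[\begin{array}{cccccc|cccccc}1&0&-1&0&0&0&0&0&0&0&0&0\\1&0&0&0&-1&0&0&0&0&0&0&0\\ \beta&1&0&1&0&1&0&0&0&0&0&0\\0&0&0&0&0&0&1&0&0&0&0&0\\0&0&0&0&0&0&0&0&0&1&0&0\\0&0&0&0&0&0&0&0&0&0&0&1\end{array}\right].$$ $A=P_1\frac{d}{d\zeta}\mathcal H$ with $\operatorname{dom}(A)=\{x\in X\mid\mathcal Hx\in H^1((a,b);\mathbb C^6),\ W_B\begin{bmatrix}(\mathcal Hx)(b)\\(\mathcal Hx)(a)\end{bmatrix}=0\}$; $A$ generates a contraction semigroup $(T(t))_{t\ge0}$ on $X$. For $\omega\in\mathbb R$ and $k\in\{\mathrm I,\mathrm{II},\mathrm{III}\}$, $\Psi_{i\omega,k}=\begin{bmatrix}\Psi_{i\omega,k}^{11}&\Psi_{i\omega,k}^{12}\\\Psi_{i\omega,k}^{21}&\Psi_{i\omega,k}^{22}\end{bmatrix}\colon[a,b]\to\mathbb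 C^{2\times2}$ is the fundamental solution of $\frac{dv_k}{d\zeta}(\zeta)=i\omega\begin{bmatrix}0&T_k^{-1}\\\rho_k&0\end{bmatrix}v_k(\zeta)$ with $\Psi_{i\omega,k}(a)=I_2$. $\mathbb O/\mathbb O:=\{\frac{1+2k}{1+2\ell};\ k,\ell\in\mathbb Z\}$ and $\mathbb E/\mathbb O:=\{\frac{2k}{1+2\ell};\ k,\ell\in\mathbb Z\}$. Semi-uniformly stable means: there is $f\colon[0,\infty)\to[0,\infty)$ with $f(t)\to0$ as $t\to\infty$ and $\|T(t)x\|_{\mathcal H}\le f(t)\|x\|_{\operatorname{dom}(A)}$ (graph norm) for all $x\in\operatorname{dom}(A)$, $t\ge0$. *)

theory Defs
  imports "HOL-Analysis.Analysis"
begin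

section \<open>Square-integrable functions on an interval\<close>

text \<open>Elements of the function spaces are represented by functions; two functions denote the same
  element of \<open>L\<^sub>2((a,b); \<complex>\<^sup>6)\<close> iff they agree almost everywhere on \<open>(a,b)\<close>.\<close>

definition L2 :: "real \<Rightarrow> real \<Rightarrow> (real \<Rightarrow> complex^6) set" where
  "L2 a b = {f \<in> borel_measurable (lebesgue_on {a<..<b}).
               integrable (lebesgue_on {a<..<b}) (\<lambda>\<zeta>. (norm (f \<zeta>))\<^sup>2)}"

definition eq_L2 :: "real \<Rightarrow> real \<Rightarrow> (real \<Rightarrow> complex^6) \<Rightarrow> (real \<Rightarrow> complex^6) \<Rightarrow> bool" where
  "eq_L2 a b f g \<longleftrightarrow> (AE \<zeta> in lebesgue_on {a<..<b}. f \<zeta> = g \<zeta>)"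

section \<open>The Sobolev space \<open>H\<^sup>1((a,b); \<complex>\<^sup>6)\<close>\<close>

text \<open>\<open>F\<close> is an absolutely continuous representative of \<open>f\<close> on \<open>[a,b]\<close> whose derivative \<open>g\<close>
  is square-integrable. \<open>F\<close> is unique on \<open>[a,b]\<close>, and \<open>g\<close> is unique almost everywhere.\<close>

definition AC_rep ::
    "real \<Rightarrow> real \<Rightarrow> (real \<Rightarrow> complex^6) \<Rightarrow> (real \<Rightarrow> complex^6) \<Rightarrow> (real \<Rightarrow> complex^6) \<Rightarrow> bool" where
  "AC_rep a b f F g \<longleftrightarrow>
     eq_L2 a b f F \<and> g \<in> L2 a b \<and>
     (\<forall>\<zeta>\<in>{a..b}. F \<zeta> = F a + (\<integral>\<xi>. g \<xi> \<partial>lebesgue_on {a<..<\<zeta>}))"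

definition H1 :: "real \<Rightarrow> real \<Rightarrow> (real \<Rightarrow> complex^6) set" where
  "H1 a b = {f \<in> L2 a b. \<exists>F g. AC_rep a b f F g}"

definition H1_rep :: "real \<Rightarrow> real \<Rightarrow> (real \<Rightarrow> complex^6) \<Rightarrow> (real \<Rightarrow> complex^6)" where
  "H1_rep a b f = (SOME F. \<exists>g. AC_rep a b f F g)"

definition H1_deriv :: "real \<Rightarrow> real \<Rightarrow> (real \<Rightarrow> complex^6) \<Rightarrow> (real \<Rightarrow> complex^6)" where
  "H1_deriv a b f = (SOME g. \<exists>F. AC_rep a b f F g)"

section \<open>The string network\<close>

datatype string_id = SI | SII | SIII

text \<open>The function \<open>vector\<close> numbers components from 1; in the index types 6 and 12
  the last index is \<open>6 = 0\<close> and \<open>12 = 0\<close>, respectively.\<close>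

definition P1 :: "complex^6^6" where
  "P1 = vector
    [vector [0, 1, 0, 0, 0, 0],
     vector [1, 0, 0, 0, 0, 0],
     vector [0, 0, 0, 1, 0, 0],
     vector [0, 0, 1, 0, 0, 0],
     vector [0, 0, 0, 0, 0, 1],
     vector [0, 0, 0, 0, 1, 0]]"

definition Ham :: "(string_id \<Rightarrow> real) \<Rightarrow> (string_id \<Rightarrow> real) \<Rightarrow> complex^6^6" where
  "Ham \<rho> \<tau> = vector
    [vector [of_real (1 / \<rho> SI), 0, 0, 0, 0, 0],
     vector [0, of_real (\<tau> SI), 0, 0, 0, 0],
     vector [0, 0, of_real (1 / \<rho> SII), 0, 0, 0],
     vector [0, 0, 0, of_real (\<tau> SII), 0, 0],
     vector [0, 0, 0, 0, of_real (1 / \<rho> SIII), 0],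
     vector [0, 0, 0, 0, 0, of_real (\<tau> SIII)]]"

definition WB :: "real \<Rightarrow> complex^12^6" where
  "WB \<beta> = vector
    [vector [1, 0, -1, 0, 0, 0,         0, 0, 0, 0, 0, 0],
     vector [1, 0, 0, 0, -1, 0,         0, 0, 0, 0, 0, 0],
     vector [of_real \<beta>, 1, 0, 1, 0, 1,  0, 0, 0, 0, 0, 0],
     vector [0, 0, 0, 0, 0, 0,          1, 0, 0, 0, 0, 0],
     vector [0, 0, 0, 0, 0, 0,          0, 0, 0, 1, 0, 0],
     vector [0, 0, 0, 0, 0, 0,          0, 0, 0, 0, 0, 1]]"

definition stack :: "complex^6 \<Rightarrow> complex^6 \<Rightarrow> complex^12" where
  "stack u v = vector [u$1, u$2, u$3, u$4, u$5, u$6, v$1, v$2, v$3, v$4, v$5, v$6]"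

definition inner_H ::
    "real \<Rightarrow> real \<Rightarrow> (string_id \<Rightarrow> real) \<Rightarrow> (string_id \<Rightarrow> real) \<Rightarrow>
     (real \<Rightarrow> complex^6) \<Rightarrow> (real \<Rightarrow> complex^6) \<Rightarrow> complex" where
  "inner_H a b \<rho> \<tau> f g =
     1/2 * (\<integral>\<zeta>. (\<Sum>i\<in>UNIV. cnj (g \<zeta> $ i) * (Ham \<rho> \<tau> *v f \<zeta>) $ i) \<partial>lebesgue_on {a<..<b})"

definition norm_H ::
    "real \<Rightarrow> real \<Rightarrow> (string_id \<Rightarrow> real) \<Rightarrow> (string_id \<Rightarrow> real) \<Rightarrow>
     (real \<Rightarrow> complex^6) \<Rightarrow> real" where
  "norm_H a b \<rho> \<tau> f = sqrt (Re (inner_H a b \<rho> \<tau> f f))"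

text \<open>The boundary values at \<open>b\<close> and \<open>a\<close> are those of the continuous representative.\<close>

definition dom_A ::
    "real \<Rightarrow> real \<Rightarrow> real \<Rightarrow> (string_id \<Rightarrow> real) \<Rightarrow> (string_id \<Rightarrow> real) \<Rightarrow>
     (real \<Rightarrow> complex^6) set" where
  "dom_A a b \<beta> \<rho> \<tau> =
     {x \<in> L2 a b.
        (\<lambda>\<zeta>. Ham \<rho> \<tau> *v x \<zeta>) \<in> H1 a b \<and>
        WB \<beta> *v stack (H1_rep a b (\<lambda>\<zeta>. Ham \<rho> \<tau> *v x \<zeta>) b)
                      (H1_rep a b (\<lambda>\<zeta>. Ham \<rho> \<tau> *v x \<zeta>) a) = 0}"

definition op_A ::
    "real \<Rightarrow> real \<Rightarrow> (string_id \<Rightarrow> real) \<Rightarrow> (string_id \<Rightarrow> real) \<Rightarrow>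
     (real \<Rightarrow> complex^6) \<Rightarrow> (real \<Rightarrow> complex^6)" where
  "op_A a b \<rho> \<tau> x = (\<lambda>\<zeta>. P1 *v H1_deriv a b (\<lambda>\<zeta>. Ham \<rho> \<tau> *v x \<zeta>) \<zeta>)"

section \<open>Semigroups, stability, eigenvalues\<close>

text \<open>Only \<open>t \<ge> 0\<close> matters. That \<open>T t\<close> respects almost-everywhere equality follows from
  linearity together with contractivity.\<close>

definition contraction_semigroup ::
    "real \<Rightarrow> real \<Rightarrow> (string_id \<Rightarrow> real) \<Rightarrow> (string_id \<Rightarrow> real) \<Rightarrow>
     (real \<Rightarrow> (real \<Rightarrow> complex^6) \<Rightarrow> (real \<Rightarrow> complex^6)) \<Rightarrow> bool" where
  "contraction_semigroup a b \<rho> \<tau> T \<longleftrightarrow>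
     (\<forall>t\<ge>0. \<forall>x\<in>L2 a b. T t x \<in> L2 a b) \<and>
     (\<forall>t\<ge>0. \<forall>x\<in>L2 a b. \<forall>y\<in>L2 a b. \<forall>c d.
        eq_L2 a b (T t (\<lambda>\<zeta>. c *s x \<zeta> + d *s y \<zeta>)) (\<lambda>\<zeta>. c *s T t x \<zeta> + d *s T t y \<zeta>)) \<and>
     (\<forall>t\<ge>0. \<forall>x\<in>L2 a b. norm_H a b \<rho> \<tau> (T t x) \<le> norm_H a b \<rho> \<tau> x) \<and>
     (\<forall>x\<in>L2 a b. eq_L2 a b (T 0 x) x) \<and>
     (\<forall>s\<ge>0. \<forall>t\<ge>0. \<forall>x\<in>L2 a b. eq_L2 a b (T (s + t) x) (T s (T t x))) \<and>
     (\<forall>x\<in>L2 a b. ((\<lambda>t. norm_H a b \<rho> \<tau> (\<lambda>\<zeta>. T t x \<zeta> - x \<zeta>)) \<longlongrightarrow> 0) (at_right 0))"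

text \<open>\<open>A\<close> is the infinitesimal generator of \<open>T\<close>: a pair \<open>(x, y)\<close> belongs to the graph of \<open>A\<close>
  iff \<open>(T t x - x) / t\<close> converges to \<open>y\<close> as \<open>t \<down> 0\<close>.\<close>

definition generated_by_A ::
    "real \<Rightarrow> real \<Rightarrow> real \<Rightarrow> (string_id \<Rightarrow> real) \<Rightarrow> (string_id \<Rightarrow> real) \<Rightarrow>
     (real \<Rightarrow> (real \<Rightarrow> complex^6) \<Rightarrow> (real \<Rightarrow> complex^6)) \<Rightarrow> bool" where
  "generated_by_A a b \<beta> \<rho> \<tau> T \<longleftrightarrow>
     (\<forall>x\<in>L2 a b. \<forall>y\<in>L2 a b.
        x \<in> dom_A a b \<beta> \<rho> \<tau> \<and> eq_L2 a b (op_A a b \<rho> \<tau> x) y \<longleftrightarrow>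
        ((\<lambda>t. norm_H a b \<rho> \<tau> (\<lambda>\<zeta>. (1 / t) *\<^sub>R (T t x \<zeta> - x \<zeta>) - y \<zeta>)) \<longlongrightarrow> 0) (at_right 0))"

definition graph_norm_A ::
    "real \<Rightarrow> real \<Rightarrow> (string_id \<Rightarrow> real) \<Rightarrow> (string_id \<Rightarrow> real) \<Rightarrow>
     (real \<Rightarrow> complex^6) \<Rightarrow> real" where
  "graph_norm_A a b \<rho> \<tau> x = norm_H a b \<rho> \<tau> x + norm_H a b \<rho> \<tau> (op_A a b \<rho> \<tau> x)"

definition semi_uniformly_stable ::
    "real \<Rightarrow> real \<Rightarrow> real \<Rightarrow> (string_id \<Rightarrow> real) \<Rightarrow> (string_id \<Rightarrow> real) \<Rightarrow>
     (real \<Rightarrow> (real \<Rightarrow> complex^6) \<Rightarrow> (real \<Rightarrow> complex^6)) \<Rightarrow> bool" where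
  "semi_uniformly_stable a b \<beta> \<rho> \<tau> T \<longleftrightarrow>
     (\<exists>f :: real \<Rightarrow> real.
        (\<forall>t\<ge>0. 0 \<le> f t) \<and> (f \<longlongrightarrow> 0) at_top \<and>
        (\<forall>x\<in>dom_A a b \<beta> \<rho> \<tau>. \<forall>t\<ge>0.
           norm_H a b \<rho> \<tau> (T t x) \<le> f t * graph_norm_A a b \<rho> \<tau> x))"

definition eigenvalue_A ::
    "real \<Rightarrow> real \<Rightarrow> real \<Rightarrow> (string_id \<Rightarrow> real) \<Rightarrow> (string_id \<Rightarrow> real) \<Rightarrow> complex \<Rightarrow> bool" where
  "eigenvalue_A a b \<beta> \<rho> \<tau> \<mu> \<longleftrightarrow>
     (\<exists>x\<in>dom_A a b \<beta> \<rho> \<tau>.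
        \<not> eq_L2 a b x (\<lambda>\<zeta>. 0) \<and> eq_L2 a b (op_A a b \<rho> \<tau> x) (\<lambda>\<zeta>. \<mu> *s x \<zeta>))"

section \<open>Fundamental solutions and the arithmetic condition\<close>

definition string_matrix :: "real \<Rightarrow> real \<Rightarrow> real \<Rightarrow> complex^2^2" where
  "string_matrix \<rho> \<tau> \<omega> =
     vector [vector [0, \<i> * of_real \<omega> * of_real (1 / \<tau>)],
             vector [\<i> * of_real \<omega> * of_real \<rho>, 0]]"

definition fundamental_solution ::
    "real \<Rightarrow> real \<Rightarrow> real \<Rightarrow> real \<Rightarrow> real \<Rightarrow> (real \<Rightarrow> complex^2^2) \<Rightarrow> bool" where
  "fundamental_solution a b \<rho> \<tau> \<omega> \<Psi> \<longleftrightarrow>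
     \<Psi> a = mat 1 \<and>
     (\<forall>\<zeta>\<in>{a..b}. (\<Psi> has_vector_derivative string_matrix \<rho> \<tau> \<omega> ** \<Psi> \<zeta>) (at \<zeta> within {a..b}))"

definition odd_over_odd :: "real set" where
  "odd_over_odd = {of_int (1 + 2 * k) / of_int (1 + 2 * l) | k l :: int. True}"

definition even_over_odd :: "real set" where
  "even_over_odd = {of_int (2 * k) / of_int (1 + 2 * l) | k l :: int. True}"

end

theory Submission
  imports Defs "HOL-Complex_Analysis.Great_Picard"
begin

text \<open>
  The only hard implication is that a semigroup which is not semi-uniformly stable has a generator
  with an imaginary eigenvalue. If \<open>T\<close> is not semi-uniformly stable, there are \<open>\<epsilon> > 0\<close> and, for every
  \<open>t\<close>, some \<open>x\<close> of graph norm at most 1 with \<open>\<parallel>T t x\<parallel> \<ge> \<epsilon>\<close>. Sample such an orbit at the times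
  \<open>0, h, \<dots>, (M - 1) h\<close> with \<open>M h = t\<close> and take the discrete Fourier transform
  \<open>y\<^sub>j = \<Sum>n<M. z\<^sub>j\<^sup>-\<^sup>n T (n h) x\<close>, where \<open>z\<^sub>j = exp (2 \<pi> \<i> j / M)\<close>. The vectors \<open>T h y\<^sub>j - z\<^sub>j y\<^sub>j\<close> are of
  size \<open>O(1)\<close>, while Parseval's identity gives \<open>\<Sum>\<parallel>y\<^sub>j\<parallel>\<^sup>2 \<ge> M\<^sup>2 \<epsilon>\<^sup>2\<close> and \<open>\<Sum>\<parallel>A y\<^sub>j\<parallel>\<^sup>2 \<le> M\<^sup>2\<close>. Hence some
  normalised \<open>y\<^sub>j\<close> has bounded graph norm and satisfies \<open>T h y\<^sub>j = z\<^sub>j y\<^sub>j + O(1 / sqrt M)\<close>. With \<open>h = 1 / k\<close>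
  and \<open>M = k\<^sup>4\<close> the compact embedding of the domain (Arzela--Ascoli) yields, as \<open>k \<rightarrow> \<infinity>\<close>, a limit
  \<open>w \<noteq> 0\<close> with \<open>T t w = exp (\<i> \<omega> t) w\<close> for all \<open>t \<ge> 0\<close>.

  Conversely, along an eigenvector for \<open>\<i> \<omega>\<close> the norm of the orbit is constant. The eigenvalue
  equation is solved by trigonometric functions; \<open>\<beta> > 0\<close> forces the common velocity at \<open>b\<close> to vanish, and a
  nontrivial solution exists iff two of the numbers \<open>\<Psi>\<^sub>I\<^sup>1\<^sup>2(b)\<close>, \<open>\<Psi>\<^sub>I\<^sub>I\<^sup>1\<^sup>1(b)\<close>, \<open>\<Psi>\<^sub>I\<^sub>I\<^sub>I\<^sup>1\<^sup>1(b)\<close> are zero, a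
  property that passes from \<open>\<omega>\<close> to its odd multiples.
\<close>

section \<open>Vectors and matrices of size 6\<close>

lemma exhaust_6: "(x::6) = 1 \<or> x = 2 \<or> x = 3 \<or> x = 4 \<or> x = 5 \<or> x = 6"
proof (induct x)
  case (of_int z)
  then have "z = 0 \<or> z = 1 \<or> z = 2 \<or> z = 3 \<or> z = 4 \<or> z = 5" by fastforce
  then show ?case by auto
qed

lemma exhaust_12: "(x::12) \<in> {1, 2, 3, 4, 5, 6, 7, 8, 9, 10, 11, 12}"
proof (induct x)
  case (of_int z)
  then have "z \<in> {0, 1, 2, 3, 4, 5, 6, 7, 8, 9, 10, 11}"
    by (simp, presburger)
  then show ?case by auto
qed

lemma forall_6: "(\<forall>i::6. P i) \<longleftrightarrow> P 1 \<and> P 2 \<and> P 3 \<and> P 4 \<and> P 5 \<and> P 6"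
  by (metis exhaust_6)

lemma sum_6: "sum f (UNIV::6 set) = f 1 + f 2 + f 3 + f 4 + f 5 + f 6"
proof -
  have "UNIV = {1, 2, 3, 4, 5, 6::6}"
    using exhaust_6 by auto
  then have "sum f UNIV = sum f {1, 2, 3, 4, 5, 6}"
    by (rule arg_cong)
  then show ?thesis
    by (simp add: ac_simps)
qed

lemma sum_12: "sum f (UNIV::12 set) =
    f 1 + f 2 + f 3 + f 4 + f 5 + f 6 + f 7 + f 8 + f 9 + f 10 + f 11 + f 12"
proof -
  have "UNIV = {1, 2, 3, 4, 5, 6, 7, 8, 9, 10, 11, 12::12}"
    using exhaust_12 by blast
  then have "sum f UNIV = sum f {1, 2, 3, 4, 5, 6, 7, 8, 9, 10, 11, 12}"
    by (rule arg_cong)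
  then show ?thesis
    by (simp add: ac_simps)
qed

lemma vector_6:
  fixes x1 :: "'a::zero"
  shows "(vector [x1, x2, x3, x4, x5, x6] :: 'a^6) $ 1 = x1"
    "(vector [x1, x2, x3, x4, x5, x6] :: 'a^6) $ 2 = x2"
    "(vector [x1, x2, x3, x4, x5, x6] :: 'a^6) $ 3 = x3"
    "(vector [x1, x2, x3, x4, x5, x6] :: 'a^6) $ 4 = x4"
    "(vector [x1, x2, x3, x4, x5, x6] :: 'a^6) $ 5 = x5"
    "(vector [x1, x2, x3, x4, x5, x6] :: 'a^6) $ 6 = x6"
  unfolding vector_def by simp_all

lemma vector_12:
  fixes x1 :: "'a::zero"
  shows "(vector [x1, x2, x3, x4, x5, x6, x7, x8, x9, x10, x11, x12] :: 'a^12) $ 1 = x1"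
    "(vector [x1, x2, x3, x4, x5, x6, x7, x8, x9, x10, x11, x12] :: 'a^12) $ 2 = x2"
    "(vector [x1, x2, x3, x4, x5, x6, x7, x8, x9, x10, x11, x12] :: 'a^12) $ 3 = x3"
    "(vector [x1, x2, x3, x4, x5, x6, x7, x8, x9, x10, x11, x12] :: 'a^12) $ 4 = x4"
    "(vector [x1, x2, x3, x4, x5, x6, x7, x8, x9, x10, x11, x12] :: 'a^12) $ 5 = x5"
    "(vector [x1, x2, x3, x4, x5, x6, x7, x8, x9, x10, x11, x12] :: 'a^12) $ 6 = x6"
    "(vector [x1, x2, x3, x4, x5, x6, x7, x8, x9, x10, x11, x12] :: 'a^12) $ 7 = x7"
    "(vector [x1, x2, x3, x4, x5, x6, x7, x8, x9, x10, x11, x12] :: 'a^12) $ 8 = x8"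
    "(vector [x1, x2, x3, x4, x5, x6, x7, x8, x9, x10, x11, x12] :: 'a^12) $ 9 = x9"
    "(vector [x1, x2, x3, x4, x5, x6, x7, x8, x9, x10, x11, x12] :: 'a^12) $ 10 = x10"
    "(vector [x1, x2, x3, x4, x5, x6, x7, x8, x9, x10, x11, x12] :: 'a^12) $ 11 = x11"
    "(vector [x1, x2, x3, x4, x5, x6, x7, x8, x9, x10, x11, x12] :: 'a^12) $ 12 = x12"
  unfolding vector_def by simp_all

section \<open>The coefficient matrices and boundary conditions in coordinates\<close>

definition ham_diag :: "(string_id \<Rightarrow> real) \<Rightarrow> (string_id \<Rightarrow> real) \<Rightarrow> real^6" where
  "ham_diag \<rho> \<tau> = vector [1 / \<rho> SI, \<tau> SI, 1 / \<rho> SII, \<tau> SII, 1 / \<rho> SIII, \<tau> SIII]"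

lemma Ham_mult: "(Ham \<rho> \<tau> *v v) $ i = of_real (ham_diag \<rho> \<tau> $ i) * v $ i"
  using exhaust_6[of i]
  by (auto simp: Ham_def ham_diag_def matrix_vector_mult_def sum_6 vector_6)

lemma P1_mult: "P1 *v v = vector [v$2, v$1, v$4, v$3, v$6, v$5]"
  by (simp add: P1_def matrix_vector_mult_def sum_6 vector_6 vec_eq_iff forall_6)

lemma P1_involution: "P1 *v (P1 *v v) = v"
  by (simp add: P1_mult vector_6 vec_eq_iff forall_6)

lemma norm_vec_6: "(norm (v :: 'a::real_normed_vector^6))\<^sup>2 =
    (norm (v$1))\<^sup>2 + (norm (v$2))\<^sup>2 + (norm (v$3))\<^sup>2 + (norm (v$4))\<^sup>2 + (norm (v$5))\<^sup>2 + (norm (v$6))\<^sup>2"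
  by (simp add: norm_vec_def L2_set_def sum_6 sum_nonneg)

lemma norm_scale_vec: "norm (c *s (v :: complex^6)) = cmod c * norm v"
proof -
  have "(norm (c *s v))\<^sup>2 = (cmod c * norm v)\<^sup>2"
    by (simp add: norm_vec_6 power_mult_distrib norm_mult algebra_simps)
  then show ?thesis by (metis abs_norm_cancel abs_mult norm_ge_zero power2_eq_iff_nonneg zero_le_mult_iff)
qed

lemma scale_measurable [measurable]: "(\<lambda>v::complex^6. c *s v) \<in> borel_measurable borel"
proof (intro borel_measurable_continuous_onI linear_continuous_on)
  show "bounded_linear (\<lambda>v::complex^6. c *s v)"
    by (intro linear_conv_bounded_linear[THEN iffD1] linearI)
      (simp_all add: vec_eq_iff algebra_simps)
qed

lemma bounded_linear_matrix: "bounded_linear (\<lambda>v::complex^6. (A :: complex^6^6) *v v)"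
proof (intro linear_conv_bounded_linear[THEN iffD1] linearI)
  show "A *v (r *\<^sub>R v) = r *\<^sub>R (A *v v)" for r and v :: "complex^6"
    by (simp add: vec_eq_iff matrix_vector_mult_def scaleR_sum_right)
qed (rule matrix_vector_right_distrib)

lemma matrix_measurable [measurable]: "(\<lambda>v::complex^6. (A :: complex^6^6) *v v) \<in> borel_measurable borel"
  by (intro borel_measurable_continuous_onI linear_continuous_on bounded_linear_matrix)

lemma norm_P1: "norm (P1 *v v) = norm v"
proof -
  have "(norm (P1 *v v))\<^sup>2 = (norm v)\<^sup>2"
    by (simp add: norm_vec_6 P1_mult vector_6)
  then show ?thesis by simp
qed

text \<open>Here \<open>u\<close> and \<open>w\<close> stand for the values of \<open>Hx\<close> at
  \<open>b\<close> and \<open>a\<close>; odd components are velocities, even ones forces. The three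
  strings share one velocity at \<open>b\<close>, where their forces balance against the damper
  \<open>\<beta>\<close>; at \<open>a\<close> string I is clamped and strings II and III are
  force-free.\<close>

lemma WB_stack: "WB \<beta> *v stack u w = 0 \<longleftrightarrow>
    u$1 = u$3 \<and> u$1 = u$5 \<and> of_real \<beta> * u$1 + u$2 + u$4 + u$6 = 0 \<and> w$1 = 0 \<and> w$4 = 0 \<and> w$6 = 0"
  unfolding vec_eq_iff forall_6
  by (simp add: WB_def stack_def matrix_vector_mult_def sum_12 vector_6 vector_12)

section \<open>The weighted space of square-integrable functions\<close>

text \<open>The weighted inequality \<open>(p + q)\<^sup>2 \<le> (1 + s) p\<^sup>2 + (1 + 1/s)
  q\<^sup>2\<close> is integrated first and \<open>s\<close> is optimised afterwards, so that no
  inner product of functions enters.\<close>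

lemma Minkowski_L2:
  fixes f g :: "'a \<Rightarrow> 'b::euclidean_space"
  assumes f: "f \<in> borel_measurable M" "integrable M (\<lambda>x. (norm (f x))\<^sup>2)"
    and g: "g \<in> borel_measurable M" "integrable M (\<lambda>x. (norm (g x))\<^sup>2)"
  shows "integrable M (\<lambda>x. (norm (f x + g x))\<^sup>2)"
    and "sqrt (\<integral>x. (norm (f x + g x))\<^sup>2 \<partial>M)
          \<le> sqrt (\<integral>x. (norm (f x))\<^sup>2 \<partial>M) + sqrt (\<integral>x. (norm (g x))\<^sup>2 \<partial>M)"
proof -
  have pw: "(norm (u + v))\<^sup>2 \<le> (1 + s) * (norm u)\<^sup>2 + (1 + 1 / s) * (norm v)\<^sup>2"
    if "s > 0" for s and u v :: 'b
  proof -
    have "norm (u + v) \<le> norm u + norm v"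
      by (rule norm_triangle_ineq)
    then have "(norm (u + v))\<^sup>2 \<le> (norm u + norm v)\<^sup>2"
      by (simp add: power_mono)
    also have "\<dots> = (1 + s) * (norm u)\<^sup>2 + (1 + 1 / s) * (norm v)\<^sup>2 - (s * norm u - norm v)\<^sup>2 / s"
      using that by (simp add: power2_eq_square field_simps)
    also have "\<dots> \<le> (1 + s) * (norm u)\<^sup>2 + (1 + 1 / s) * (norm v)\<^sup>2"
      using that by simp
    finally show ?thesis .
  qed
  show int: "integrable M (\<lambda>x. (norm (f x + g x))\<^sup>2)"
  proof (rule Bochner_Integration.integrable_bound)
    show "integrable M (\<lambda>x. 2 * (norm (f x))\<^sup>2 + 2 * (norm (g x))\<^sup>2)"
      using f g by simp
    show "(\<lambda>x. (norm (f x + g x))\<^sup>2) \<in> borel_measurable M"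
      using f(1) g(1) by measurable
    show "AE x in M. norm ((norm (f x + g x))\<^sup>2) \<le> norm (2 * (norm (f x))\<^sup>2 + 2 * (norm (g x))\<^sup>2)"
      using pw[of 1] by (auto intro!: AE_I2)
  qed
  define F where "F = sqrt (\<integral>x. (norm (f x))\<^sup>2 \<partial>M)"
  define G where "G = sqrt (\<integral>x. (norm (g x))\<^sup>2 \<partial>M)"
  have F: "F \<ge> 0" "F\<^sup>2 = (\<integral>x. (norm (f x))\<^sup>2 \<partial>M)" and G: "G \<ge> 0" "G\<^sup>2 = (\<integral>x. (norm (g x))\<^sup>2 \<partial>M)"
    by (simp_all add: F_def G_def)
  have *: "(\<integral>x. (norm (f x + g x))\<^sup>2 \<partial>M) \<le> (1 + s) * F\<^sup>2 + (1 + 1 / s) * G\<^sup>2" if "s > 0" for s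
  proof -
    have "(\<integral>x. (norm (f x + g x))\<^sup>2 \<partial>M) \<le> (\<integral>x. (1 + s) * (norm (f x))\<^sup>2 + (1 + 1 / s) * (norm (g x))\<^sup>2 \<partial>M)"
      using f g int pw[OF that] by (intro integral_mono) auto
    also have "\<dots> = (1 + s) * F\<^sup>2 + (1 + 1 / s) * G\<^sup>2"
      unfolding F G using f g by (subst Bochner_Integration.integral_add) auto
    finally show ?thesis .
  qed
  have "sqrt (\<integral>x. (norm (f x + g x))\<^sup>2 \<partial>M) \<le> F + G + e" if "e > 0" for e
  proof -
    \<comment> \<open>The optimal \<open>s\<close> is \<open>G / F\<close>. Adding
      \<open>e/2\<close> to both norms keeps \<open>s\<close> positive and defined when a norm
      vanishes, and turns the bound into a perfect square.\<close>
    define s where "s = (G + e/2) / (F + e/2)"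
    have s: "s > 0" using that F(1) G(1) by (simp add: s_def add_nonneg_pos)
    have "F\<^sup>2 \<le> (F + e/2)\<^sup>2" "G\<^sup>2 \<le> (G + e/2)\<^sup>2"
      using F(1) G(1) that by (auto intro!: power_mono)
    then have "(1 + s) * F\<^sup>2 + (1 + 1 / s) * G\<^sup>2 \<le> (1 + s) * (F + e/2)\<^sup>2 + (1 + 1 / s) * (G + e/2)\<^sup>2"
      using s by (intro add_mono mult_left_mono) auto
    also have "\<dots> = (F + G + e)\<^sup>2"
    proof -
      define A B where "A = F + e/2" and "B = G + e/2"
      have "A > 0" "B > 0" using F(1) G(1) that by (auto simp: A_def B_def)
      then have "(1 + s) * A\<^sup>2 + (1 + 1 / s) * B\<^sup>2 = (A + B)\<^sup>2"
        by (simp add: s_def flip: A_def B_def) (simp add: field_simps power2_eq_square)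
      then show ?thesis by (simp add: A_def B_def add_ac)
    qed
    finally have "(\<integral>x. (norm (f x + g x))\<^sup>2 \<partial>M) \<le> (F + G + e)\<^sup>2"
      using *[OF s] by linarith
    then show ?thesis
      using F(1) G(1) that by (intro real_le_lsqrt) auto
  qed
  then show "sqrt (\<integral>x. (norm (f x + g x))\<^sup>2 \<partial>M) \<le> sqrt (\<integral>x. (norm (f x))\<^sup>2 \<partial>M) + sqrt (\<integral>x. (norm (g x))\<^sup>2 \<partial>M)"
    unfolding F_def[symmetric] G_def[symmetric] by (rule field_le_epsilon)
qed

locale string_space =
  fixes a b :: real and \<rho> \<tau> :: "string_id \<Rightarrow> real"
  assumes ab: "a < b" and rho_pos: "\<And>k. \<rho> k > 0" and tau_pos: "\<And>k. \<tau> k > 0"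
begin

abbreviation \<mu> :: "real measure" where "\<mu> \<equiv> lebesgue_on {a<..<b}"
abbreviation X :: "(real \<Rightarrow> complex^6) set" where "X \<equiv> L2 a b"
abbreviation N :: "(real \<Rightarrow> complex^6) \<Rightarrow> real" where "N \<equiv> norm_H a b \<rho> \<tau>"
abbreviation d :: "(real \<Rightarrow> complex^6) \<Rightarrow> (real \<Rightarrow> complex^6) \<Rightarrow> real" where
  "d f g \<equiv> N (\<lambda>\<zeta>. f \<zeta> - g \<zeta>)"

text \<open>The square root of half the Hamiltonian. The energy norm of \<open>f\<close> becomes the
  ordinary L2 norm of \<open>wt\<close> composed with \<open>f\<close>, to which
  \<open>Minkowski_L2\<close> applies.\<close>

definition wt :: "complex^6 \<Rightarrow> complex^6" where
  "wt v = (\<chi> i. of_real (sqrt (ham_diag \<rho> \<tau> $ i / 2)) * v $ i)"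

lemma ham_diag_pos: "ham_diag \<rho> \<tau> $ i > 0"
  using exhaust_6[of i] rho_pos tau_pos by (auto simp: ham_diag_def vector_6)

lemma linear_wt: "linear wt"
  by (rule linearI) (simp_all add: wt_def vec_eq_iff algebra_simps scaleR_conv_of_real)

lemma wt_scale: "wt (c *s v) = c *s wt v"
  by (simp add: wt_def vec_eq_iff)

lemma wt_eq_0: "wt v = 0 \<longleftrightarrow> v = 0"
  using ham_diag_pos by (simp add: wt_def vec_eq_iff less_imp_neq[symmetric])

lemma norm_wt_sq: "(norm (wt v))\<^sup>2 = (\<Sum>i\<in>UNIV. ham_diag \<rho> \<tau> $ i / 2 * (cmod (v $ i))\<^sup>2)"
  using ham_diag_pos
  by (simp add: norm_vec_def L2_set_def sum_nonneg wt_def norm_mult power_mult_distrib less_imp_le)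

lemma bounded_linear_wt: "bounded_linear wt"
  using linear_wt by (rule linear_conv_bounded_linear[THEN iffD1])

lemma wt_measurable [measurable]: "wt \<in> borel_measurable borel"
  by (intro borel_measurable_continuous_onI linear_continuous_on bounded_linear_wt)

lemma wt_bound: obtains C where "C > 0" "\<And>v. norm (wt v) \<le> C * norm v"
proof -
  obtain K where "K > 0" "\<And>v. norm (wt v) \<le> norm v * K"
    using bounded_linear.pos_bounded[OF bounded_linear_wt] by blast
  then show ?thesis using that[of K] by (simp add: mult.commute)
qed

lemma wt_bound_below: obtains c where "c > 0" "\<And>v. norm v \<le> c * norm (wt v)"
proof -
  have "inj wt" using linear_injective_0[OF linear_wt] wt_eq_0 by blast
  then obtain B where "B > 0" "\<And>v. B * norm v \<le> norm (wt v)"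
    using linear_inj_bounded_below_pos[OF linear_wt] by blast
  then have "norm v \<le> (1 / B) * norm (wt v)" for v by (simp add: field_simps)
  then show ?thesis using that \<open>B > 0\<close> by (metis zero_less_divide_1_iff)
qed

lemma norm_H_alt: "N f = sqrt (\<integral>\<zeta>. (norm (wt (f \<zeta>)))\<^sup>2 \<partial>\<mu>)"
proof -
  have "(\<Sum>i\<in>UNIV. cnj (f \<zeta> $ i) * (Ham \<rho> \<tau> *v f \<zeta>) $ i) = of_real (2 * (norm (wt (f \<zeta>)))\<^sup>2)" for \<zeta>
  proof -
    have "cnj z * (of_real h * z) = of_real (h * (cmod z)\<^sup>2)" for h z
      using complex_norm_square[of z] by (simp add: mult_ac)
    then show ?thesis
      by (simp add: norm_wt_sq Ham_mult sum_distrib_left del: of_real_mult of_real_power)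
  qed
  then show ?thesis
    by (simp add: norm_H_def inner_H_def integral_complex_of_real flip: of_real_power)
qed

lemma N_nonneg [simp]: "N f \<ge> 0"
  by (simp add: norm_H_alt)

lemma N_sq: "(N f)\<^sup>2 = (\<integral>\<zeta>. (norm (wt (f \<zeta>)))\<^sup>2 \<partial>\<mu>)"
  by (simp add: norm_H_alt)

lemma L2_measurable: "f \<in> X \<Longrightarrow> f \<in> borel_measurable \<mu>"
  by (simp add: L2_def)

text \<open>\<open>wt\<close> is bounded above and below, so weighted and unweighted square
  integrability coincide.\<close>

lemma L2_wt:
  assumes "f \<in> borel_measurable \<mu>"
  shows "f \<in> X \<longleftrightarrow> integrable \<mu> (\<lambda>\<zeta>. (norm (wt (f \<zeta>)))\<^sup>2)"
proof -
  obtain C where C: "C > 0" "\<And>v. norm (wt v) \<le> C * norm v" using wt_bound by blast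
  obtain c where c: "c > 0" "\<And>v. norm v \<le> c * norm (wt v)" using wt_bound_below by blast
  note [measurable] = assms
  have "integrable \<mu> (\<lambda>\<zeta>. (norm (wt (f \<zeta>)))\<^sup>2)" if "integrable \<mu> (\<lambda>\<zeta>. (norm (f \<zeta>))\<^sup>2)"
  proof (rule Bochner_Integration.integrable_bound)
    show "integrable \<mu> (\<lambda>\<zeta>. C\<^sup>2 * (norm (f \<zeta>))\<^sup>2)" using that by simp
    show "AE x in \<mu>. norm ((norm (wt (f x)))\<^sup>2) \<le> norm (C\<^sup>2 * (norm (f x))\<^sup>2)"
      using C by (auto intro!: AE_I2 power_mono simp flip: power_mult_distrib)
  qed measurable
  moreover have "integrable \<mu> (\<lambda>\<zeta>. (norm (f \<zeta>))\<^sup>2)" if "integrable \<mu> (\<lambda>\<zeta>. (norm (wt (f \<zeta>)))\<^sup>2)"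
  proof (rule Bochner_Integration.integrable_bound)
    show "integrable \<mu> (\<lambda>\<zeta>. c\<^sup>2 * (norm (wt (f \<zeta>)))\<^sup>2)" using that by simp
    show "AE x in \<mu>. norm ((norm (f x))\<^sup>2) \<le> norm (c\<^sup>2 * (norm (wt (f x)))\<^sup>2)"
      using c by (auto intro!: AE_I2 power_mono simp flip: power_mult_distrib)
  qed measurable
  ultimately show ?thesis using assms by (auto simp: L2_def)
qed

section \<open>Linear operations, the triangle inequality and null functions for the energy
  norm\<close>

lemma L2_scale: "f \<in> X \<Longrightarrow> (\<lambda>\<zeta>. c *s f \<zeta>) \<in> X"
  unfolding L2_def
  by (auto simp: norm_scale_vec power_mult_distrib intro: measurable_compose[OF _ scale_measurable])

lemma L2_add: "f \<in> X \<Longrightarrow> g \<in> X \<Longrightarrow> (\<lambda>\<zeta>. f \<zeta> + g \<zeta>) \<in> X"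
  unfolding L2_def by (auto intro: Minkowski_L2)

lemma L2_scaleR: "f \<in> X \<Longrightarrow> (\<lambda>\<zeta>. r *\<^sub>R f \<zeta>) \<in> X"
  unfolding L2_def by (auto simp add: power_mult_distrib)

lemma L2_diff: "f \<in> X \<Longrightarrow> g \<in> X \<Longrightarrow> (\<lambda>\<zeta>. f \<zeta> - g \<zeta>) \<in> X"
  using L2_add[of f "\<lambda>\<zeta>. (-1) *\<^sub>R g \<zeta>"] L2_scaleR[of g "-1"] by simp

lemma L2_zero [simp]: "(\<lambda>\<zeta>. 0) \<in> X"
  by (simp add: L2_def)

lemma L2_sum: "(\<And>n. n \<in> A \<Longrightarrow> f n \<in> X) \<Longrightarrow> (\<lambda>\<zeta>. \<Sum>n\<in>A. f n \<zeta>) \<in> X"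
  by (induction A rule: infinite_finite_induct) (auto intro: L2_add)

lemma N_scale: "N (\<lambda>\<zeta>. c *s f \<zeta>) = cmod c * N f"
  by (simp add: norm_H_alt wt_scale norm_scale_vec power_mult_distrib real_sqrt_mult)

lemma N_scaleR: "N (\<lambda>\<zeta>. r *\<^sub>R f \<zeta>) = \<bar>r\<bar> * N f"
  by (simp add: norm_H_alt linear_cmul[OF linear_wt] power_mult_distrib real_sqrt_mult)

lemma N_add:
  assumes "f \<in> X" "g \<in> X"
  shows "N (\<lambda>\<zeta>. f \<zeta> + g \<zeta>) \<le> N f + N g"
  unfolding norm_H_alt linear_add[OF linear_wt]
proof (rule Minkowski_L2(2))
  show "(\<lambda>\<zeta>. wt (f \<zeta>)) \<in> borel_measurable \<mu>" "(\<lambda>\<zeta>. wt (g \<zeta>)) \<in> borel_measurable \<mu>"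
    using assms[THEN L2_measurable] by measurable
  show "integrable \<mu> (\<lambda>\<zeta>. (norm (wt (f \<zeta>)))\<^sup>2)" "integrable \<mu> (\<lambda>\<zeta>. (norm (wt (g \<zeta>)))\<^sup>2)"
    using assms by (simp_all flip: L2_wt add: L2_measurable)
qed

lemma N_minus: "N (\<lambda>\<zeta>. - f \<zeta>) = N f"
  using N_scaleR[of "-1" f] by simp

lemma d_commute: "d f g = d g f"
  using N_minus[of "\<lambda>\<zeta>. f \<zeta> - g \<zeta>"] by simp

lemma d_triangle: "f \<in> X \<Longrightarrow> g \<in> X \<Longrightarrow> h \<in> X \<Longrightarrow> d f h \<le> d f g + d g h"
  using N_add[of "\<lambda>\<zeta>. f \<zeta> - g \<zeta>" "\<lambda>\<zeta>. g \<zeta> - h \<zeta>"] by (simp add: L2_diff)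

lemma N_diff_le: "f \<in> X \<Longrightarrow> g \<in> X \<Longrightarrow> N f \<le> N g + d f g"
  using N_add[of g "\<lambda>\<zeta>. f \<zeta> - g \<zeta>"] by (simp add: L2_diff)

lemma N_diff: "f \<in> X \<Longrightarrow> g \<in> X \<Longrightarrow> d f g \<le> N f + N g"
  using N_add[of f "\<lambda>\<zeta>. - g \<zeta>"] N_minus[of g] L2_scaleR[of g "-1"] by simp

lemma N_eq_0_iff:
  assumes "f \<in> X"
  shows "N f = 0 \<longleftrightarrow> eq_L2 a b f (\<lambda>\<zeta>. 0)"
proof -
  have "N f = 0 \<longleftrightarrow> (\<integral>\<zeta>. (norm (wt (f \<zeta>)))\<^sup>2 \<partial>\<mu>) = 0"
    by (simp add: norm_H_alt)
  also have "\<dots> \<longleftrightarrow> (AE \<zeta> in \<mu>. (norm (wt (f \<zeta>)))\<^sup>2 = 0)"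
    using assms L2_wt[OF L2_measurable[OF assms]] by (intro integral_nonneg_eq_0_iff_AE) simp_all
  also have "\<dots> \<longleftrightarrow> eq_L2 a b f (\<lambda>\<zeta>. 0)"
    by (simp add: eq_L2_def wt_eq_0)
  finally show ?thesis .
qed

lemma d_eq_0_iff: "f \<in> X \<Longrightarrow> g \<in> X \<Longrightarrow> d f g = 0 \<longleftrightarrow> eq_L2 a b f g"
  using N_eq_0_iff[of "\<lambda>\<zeta>. f \<zeta> - g \<zeta>"] by (simp add: L2_diff eq_L2_def)

lemma N_cong: "f \<in> X \<Longrightarrow> g \<in> X \<Longrightarrow> eq_L2 a b f g \<Longrightarrow> N f = N g"
proof -
  assume *: "f \<in> X" "g \<in> X" "eq_L2 a b f g"
  then have "d f g = 0" by (simp add: d_eq_0_iff)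
  moreover from this have "d g f = 0" by (subst d_commute)
  ultimately show "N f = N g" using N_diff_le[of f g] N_diff_le[of g f] * by linarith
qed

lemma N_bounds:
  obtains c where "c > 0" "\<And>f. f \<in> X \<Longrightarrow> sqrt (\<integral>\<zeta>. (norm (f \<zeta>))\<^sup>2 \<partial>\<mu>) \<le> c * N f"
    "\<And>f. f \<in> X \<Longrightarrow> N f \<le> c * sqrt (\<integral>\<zeta>. (norm (f \<zeta>))\<^sup>2 \<partial>\<mu>)"
proof -
  obtain C where C: "C > 0" "\<And>v. norm (wt v) \<le> C * norm v" using wt_bound by blast
  obtain c where c: "c > 0" "\<And>v. norm v \<le> c * norm (wt v)" using wt_bound_below by blast
  define K where "K = max c C"
  have K: "K > 0" "\<And>v. norm (wt v) \<le> K * norm v" "\<And>v. norm v \<le> K * norm (wt v)"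
    using C(1) order_trans[OF C(2) mult_right_mono[of C K]] order_trans[OF c(2) mult_right_mono[of c K]]
    by (auto simp: K_def)
  have Ksq: "(norm (wt v))\<^sup>2 \<le> K\<^sup>2 * (norm v)\<^sup>2" "(norm v)\<^sup>2 \<le> K\<^sup>2 * (norm (wt v))\<^sup>2" for v
    using K by (simp_all add: power_mono flip: power_mult_distrib)
  have 1: "sqrt (\<integral>\<zeta>. (norm (f \<zeta>))\<^sup>2 \<partial>\<mu>) \<le> K * N f" if "f \<in> X" for f
  proof -
    have "(\<integral>\<zeta>. (norm (f \<zeta>))\<^sup>2 \<partial>\<mu>) \<le> (\<integral>\<zeta>. K\<^sup>2 * (norm (wt (f \<zeta>)))\<^sup>2 \<partial>\<mu>)"
      using that L2_wt[OF L2_measurable[OF that]] Ksq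
      by (intro integral_mono) (simp_all add: L2_def)
    also have "\<dots> = (K * N f)\<^sup>2" by (simp add: N_sq power_mult_distrib)
    finally show ?thesis using K by (intro real_le_lsqrt) auto
  qed
  have 2: "N f \<le> K * sqrt (\<integral>\<zeta>. (norm (f \<zeta>))\<^sup>2 \<partial>\<mu>)" if "f \<in> X" for f
  proof -
    have "(N f)\<^sup>2 \<le> (\<integral>\<zeta>. K\<^sup>2 * (norm (f \<zeta>))\<^sup>2 \<partial>\<mu>)"
      unfolding N_sq using that L2_wt[OF L2_measurable[OF that]] Ksq
      by (intro integral_mono) (simp_all add: L2_def)
    also have "\<dots> = (K * sqrt (\<integral>\<zeta>. (norm (f \<zeta>))\<^sup>2 \<partial>\<mu>))\<^sup>2" by (simp add: power_mult_distrib)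
    finally show ?thesis by (rule power2_le_imp_le) (use K(1) in simp)
  qed
  from that[OF K(1) 1 2] show ?thesis .
qed

end

section \<open>Absolutely continuous representatives\<close>

lemma integrable_lebesgue_on_mono:
  fixes f :: "'a::euclidean_space \<Rightarrow> 'b::euclidean_space"
  assumes "integrable (lebesgue_on S) f" "T \<subseteq> S" "S \<in> sets lebesgue" "T \<in> sets lebesgue"
  shows "integrable (lebesgue_on T) f"
  using set_integrable_subset[of lebesgue S f T] assms
  by (simp add: set_integrable_def integrable_restrict_space)

context string_space
begin

text \<open>On a bounded interval constants are integrable, and
  \<open>|f| \<le> 1 + |f|\<^sup>2\<close>.\<close>

lemma L2_integrable: "f \<in> X \<Longrightarrow> integrable \<mu> f"
proof -
  assume f: "f \<in> X"
  show "integrable \<mu> f"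
  proof (rule Bochner_Integration.integrable_bound)
    have "integrable \<mu> (\<lambda>\<zeta>. 1 :: real)"
      by (intro finite_measure.integrable_const finite_measure_lebesgue_on) simp
    then show "integrable \<mu> (\<lambda>\<zeta>. 1 + (norm (f \<zeta>))\<^sup>2)"
      using f by (auto simp: L2_def)
    have "norm (f \<zeta>) \<le> 1 + (norm (f \<zeta>))\<^sup>2" for \<zeta>
      using sum_power2_ge_zero[of "norm (f \<zeta>) - 1/2" 0] by (simp add: power2_eq_square algebra_simps)
    then show "AE \<zeta> in \<mu>. norm (f \<zeta>) \<le> norm (1 + (norm (f \<zeta>))\<^sup>2)"
      by (intro AE_I2) (simp add: abs_of_nonneg)
  qed (use f L2_measurable in auto)
qed

lemma L2_integrable_on:
  assumes "f \<in> X"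
  shows "f integrable_on {a..b}" "(\<lambda>\<zeta>. (norm (f \<zeta>))\<^sup>2) integrable_on {a..b}"
    "integral {a..b} (\<lambda>\<zeta>. (norm (f \<zeta>))\<^sup>2) = (\<integral>\<zeta>. (norm (f \<zeta>))\<^sup>2 \<partial>\<mu>)"
  using integrable_on_lebesgue_on[OF L2_integrable[OF assms]] assms
    integrable_on_lebesgue_on[of "{a<..<b}" "\<lambda>\<zeta>. (norm (f \<zeta>))\<^sup>2"]
    lebesgue_integral_eq_integral[of "{a<..<b}" "\<lambda>\<zeta>. (norm (f \<zeta>))\<^sup>2"]
  by (auto simp: integrable_on_Icc_iff_Ioo integral_open_interval_real L2_def)

lemma L2_integral:
  assumes "f \<in> X" "\<zeta> \<in> {a..b}"
  shows "(\<integral>\<xi>. f \<xi> \<partial>lebesgue_on {a<..<\<zeta>}) = integral {a..\<zeta>} f"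
proof -
  have "integrable (lebesgue_on {a<..<\<zeta>}) f"
    using assms(2) by (intro integrable_lebesgue_on_mono[OF L2_integrable[OF assms(1)]]) auto
  then show ?thesis
    by (simp add: lebesgue_integral_eq_integral integral_open_interval_real)
qed

text \<open>In terms of the gauge integral over closed intervals, additivity over intervals,
  continuity of the indefinite integral and differentiation almost everywhere are at hand.\<close>

lemma AC_rep_iff:
  "AC_rep a b f F g \<longleftrightarrow> eq_L2 a b f F \<and> g \<in> X \<and> (\<forall>\<zeta>\<in>{a..b}. F \<zeta> = F a + integral {a..\<zeta>} g)"
  using L2_integral by (auto simp: AC_rep_def)

lemma AC_rep_integral: "AC_rep a b f F g \<Longrightarrow> \<zeta> \<in> {a..b} \<Longrightarrow> integral {a..\<zeta>} g = F \<zeta> - F a"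
  unfolding AC_rep_iff by (metis add_diff_cancel_left')

lemma AC_rep_continuous: "AC_rep a b f F g \<Longrightarrow> continuous_on {a..b} F"
proof (rule continuous_on_eq)
  assume *: "AC_rep a b f F g"
  then show "continuous_on {a..b} (\<lambda>\<zeta>. F a + integral {a..\<zeta>} g)"
    by (intro continuous_on_add continuous_on_const indefinite_integral_continuous_1
        L2_integrable_on(1)) (simp add: AC_rep_iff)
  show "F a + integral {a..\<zeta>} g = F \<zeta>" if "\<zeta> \<in> {a..b}" for \<zeta>
    using * that unfolding AC_rep_iff by metis
qed

lemma continuous_L2:
  assumes "continuous_on {a..b} f"
  shows "f \<in> X"
proof -
  have "f \<in> borel_measurable \<mu>"
    by (intro continuous_imp_measurable_on_sets_lebesgue continuous_on_subset[OF assms]) auto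
  moreover have "integrable (lebesgue_on {a..b}) (\<lambda>\<zeta>. (norm (f \<zeta>))\<^sup>2)"
    by (intro continuous_imp_integrable_real continuous_intros assms)
  then have "integrable \<mu> (\<lambda>\<zeta>. (norm (f \<zeta>))\<^sup>2)"
    by (rule integrable_lebesgue_on_mono) auto
  ultimately show ?thesis by (simp add: L2_def)
qed

text \<open>The set of interior points where the two functions differ is open and null, hence empty;
  the endpoints follow by continuity.\<close>

lemma continuous_eq_L2:
  assumes F: "continuous_on {a..b} F" and G: "continuous_on {a..b} G" and "eq_L2 a b F G"
    and "\<zeta> \<in> {a..b}"
  shows "F \<zeta> = G \<zeta>"
proof -
  define U where "U = {x \<in> {a<..<b}. F x - G x \<in> - {0}}"
  have "continuous_on {a<..<b} (\<lambda>x. F x - G x)"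
    by (intro continuous_on_diff continuous_on_subset[OF F] continuous_on_subset[OF G]) auto
  then have "open U"
    unfolding U_def by (intro continuous_open_preimage[unfolded vimage_def Int_def, simplified]) auto
  moreover have "AE x in lebesgue. x \<notin> U"
    using \<open>eq_L2 a b F G\<close> by (auto simp: eq_L2_def AE_restrict_space_iff U_def elim!: AE_mp)
  then have "negligible U"
    using \<open>open U\<close> by (simp add: negligible_iff_null_sets AE_iff_null_sets)
  ultimately have "U = {}"
    using open_not_negligible by blast
  then have "F x = G x" if "x \<in> {a<..<b}" for x
    using that by (auto simp: U_def)
  then show ?thesis
    using continuous_constant_on_closure[of "{a<..<b}" "\<lambda>x. F x - G x" 0 \<zeta>] ab assms(4)
      continuous_on_diff[OF F G] by simp
qed

text \<open>Both representatives are continuous and agree almost everywhere, hence everywhere. The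
  indefinite integral of \<open>g - h\<close> then vanishes identically, and differentiation of the
  integral gives \<open>g = h\<close> almost everywhere.\<close>

lemma AC_rep_unique:
  assumes F: "AC_rep a b f F g" and G: "AC_rep a b f G h"
  shows "\<zeta> \<in> {a..b} \<Longrightarrow> F \<zeta> = G \<zeta>" and "eq_L2 a b g h"
proof -
  have "eq_L2 a b F G"
    using F G by (auto simp: AC_rep_def eq_L2_def)
  then show FG: "F \<zeta> = G \<zeta>" if "\<zeta> \<in> {a..b}" for \<zeta>
    using continuous_eq_L2 AC_rep_continuous[OF F] AC_rep_continuous[OF G] that by blast
  have gh: "g \<in> X" "h \<in> X" using F G by (auto simp: AC_rep_def)
  note int = L2_integrable_on(1)[OF gh(1)] L2_integrable_on(1)[OF gh(2)]
  \<comment> \<open>The difference is set to 0 outside \<open>[a, b]\<close>, because the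
    differentiation theorem asks for integrability over every interval.\<close>
  define k where "k = (\<lambda>x. if x \<in> {a..b} then g x - h x else 0)"
  have k0: "integral {a..\<zeta>} k = 0" if "\<zeta> \<in> {a..b}" for \<zeta>
  proof -
    have "integral {a..\<zeta>} k = integral {a..\<zeta>} (\<lambda>x. g x - h x)"
      using that by (intro Henstock_Kurzweil_Integration.integral_cong) (auto simp: k_def)
    also have "\<dots> = integral {a..\<zeta>} g - integral {a..\<zeta>} h"
      using that by (intro Henstock_Kurzweil_Integration.integral_diff integrable_subinterval_real[OF int(1)]
          integrable_subinterval_real[OF int(2)]) auto
    also have "\<dots> = (F \<zeta> - F a) - (G \<zeta> - G a)"
      using AC_rep_integral[OF F that] AC_rep_integral[OF G that] by simp
    also have "\<dots> = 0"
      using FG[OF that] FG[of a] ab by simp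
    finally show ?thesis .
  qed
  have k_int: "k integrable_on {a..b}"
    using int by (auto simp: k_def intro!: integrable_eq[OF integrable_diff[OF int]])
  have "k integrable_on UNIV"
    unfolding k_def using k_int
    by (subst integrable_restrict_UNIV) (auto intro!: integrable_diff int)
  then have "k integrable_on cbox x y" for x y
    using integrable_on_subcbox by blast
  then obtain S where S: "negligible S"
    "\<And>x e. \<lbrakk>x \<notin> S; 0 < e\<rbrakk> \<Longrightarrow> \<exists>d>0. \<forall>h. 0 < h \<and> h < d \<longrightarrow>
        norm (integral (cbox x (x + h *\<^sub>R One)) k /\<^sub>R h ^ DIM(real) - k x) < e"
    using integrable_ccontinuous_explicit[of k] by blast
  have "k x = 0" if x: "x \<in> {a<..<b}" "x \<notin> S" for x
  proof (rule ccontr)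
    assume "k x \<noteq> 0"
    then obtain r where r: "r > 0" "\<And>s. 0 < s \<and> s < r \<Longrightarrow>
        norm (integral (cbox x (x + s *\<^sub>R One)) k /\<^sub>R s ^ DIM(real) - k x) < norm (k x)"
      using S(2)[OF x(2), of "norm (k x)"] by auto
    \<comment> \<open>The step stays below \<open>r\<close> and inside \<open>[a, b]\<close>. The
      integral of \<open>k\<close> over it is a difference of two vanishing integrals, so the mean
      value is 0, whose distance to \<open>k x\<close> is not below
      \<open>norm (k x)\<close>.\<close>
    define s where "s = min (r / 2) (b - x)"
    have s: "0 < s" "s < r" "x + s \<le> b" using r(1) x by (auto simp: s_def)
    have "integral {a..x} k + integral {x..x + s} k = integral {a..x + s} k"
      using x s
      by (intro Henstock_Kurzweil_Integration.integral_combine integrable_subinterval_real[OF k_int]) auto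
    then have "integral {x..x + s} k = 0"
      using k0[of x] k0[of "x + s"] x s by simp
    then show False
      using r(2)[of s] s by simp
  qed
  then have "AE x in lebesgue. x \<in> {a<..<b} \<longrightarrow> g x = h x"
    using S(1)
    by (intro AE_I'[of S]) (auto simp: negligible_iff_null_sets k_def split: if_splits)
  then show "eq_L2 a b g h"
    by (simp add: eq_L2_def AE_restrict_space_iff)
qed

text \<open>Integrating \<open>|g| \<le> s + |g|\<^sup>2 / s\<close> takes the place of the
  Cauchy-Schwarz inequality. The free parameter \<open>s\<close> makes every family with L2-bounded
  derivatives uniformly equicontinuous.\<close>

lemma AC_rep_Hoelder:
  assumes "AC_rep a b f F g" and xy: "a \<le> x" "x \<le> y" "y \<le> b" and "s > 0"
  shows "norm (F y - F x) \<le> s * (y - x) + (\<integral>\<zeta>. (norm (g \<zeta>))\<^sup>2 \<partial>\<mu>) / s"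
proof -
  have g: "g \<in> X" using assms by (simp add: AC_rep_def)
  note int = L2_integrable_on[OF g]
  have sub: "g integrable_on {x..y}" "(\<lambda>\<zeta>. (norm (g \<zeta>))\<^sup>2) integrable_on {x..y}"
    using xy by (auto intro: integrable_subinterval_real[OF int(1)] integrable_subinterval_real[OF int(2)])
  have "integral {a..x} g + integral {x..y} g = integral {a..y} g"
    using xy
    by (intro Henstock_Kurzweil_Integration.integral_combine integrable_subinterval_real[OF int(1)]) auto
  then have "F y - F x = integral {x..y} g"
    using AC_rep_integral[OF assms(1), of x] AC_rep_integral[OF assms(1), of y] xy by (simp add: algebra_simps)
  also have "norm \<dots> \<le> integral {x..y} (\<lambda>\<zeta>. s + (norm (g \<zeta>))\<^sup>2 / s)"
  proof (intro Henstock_Kurzweil_Integration.integral_norm_bound_integral)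
    show "norm (g \<zeta>) \<le> s + (norm (g \<zeta>))\<^sup>2 / s" for \<zeta>
    proof -
      have "0 \<le> (norm (g \<zeta>) - s / 2)\<^sup>2 / s + 3 * s / 4" using \<open>s > 0\<close> by simp
      also have "\<dots> = s + (norm (g \<zeta>))\<^sup>2 / s - norm (g \<zeta>)"
        using \<open>s > 0\<close> by (simp add: power2_eq_square field_simps)
      finally show ?thesis by simp
    qed
  qed (use sub \<open>s > 0\<close> in \<open>auto intro!: integrable_add\<close>)
  also have "\<dots> = s * (y - x) + integral {x..y} (\<lambda>\<zeta>. (norm (g \<zeta>))\<^sup>2) / s"
    using xy sub \<open>s > 0\<close>
    by (subst Henstock_Kurzweil_Integration.integral_add) auto
  also have "integral {x..y} (\<lambda>\<zeta>. (norm (g \<zeta>))\<^sup>2) \<le> integral {a..b} (\<lambda>\<zeta>. (norm (g \<zeta>))\<^sup>2)"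
    using xy int(2) sub
    by (intro integral_subset_le) auto
  finally show ?thesis
    using int(3) \<open>s > 0\<close> by (simp add: divide_right_mono)
qed

text \<open>\<open>H1_rep\<close> and \<open>H1_deriv\<close> are independent \<open>SOME\<close>
  choices and need not stem from the same pair; uniqueness of the representative reconciles them at
  the endpoints.\<close>

lemma H1_AC_rep:
  assumes "f \<in> H1 a b"
  obtains F where "AC_rep a b f F (H1_deriv a b f)" "H1_rep a b f a = F a" "H1_rep a b f b = F b"
proof -
  have ex: "\<exists>F g. AC_rep a b f F g" using assms by (auto simp: H1_def)
  then have "\<exists>g. AC_rep a b f (H1_rep a b f) g"
    unfolding H1_rep_def by (rule someI_ex)
  moreover have "\<exists>F. AC_rep a b f F (H1_deriv a b f)"
    unfolding H1_deriv_def using ex by (intro someI_ex[of "\<lambda>g. \<exists>F. AC_rep a b f F g"]) blast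
  ultimately obtain F g where "AC_rep a b f (H1_rep a b f) g" "AC_rep a b f F (H1_deriv a b f)"
    by blast
  then show ?thesis
    using that[of F] AC_rep_unique(1)[of f "H1_rep a b f" g F "H1_deriv a b f"] ab by auto
qed

section \<open>The domain of the operator described by arbitrary representatives\<close>

lemma L2_P1:
  assumes "f \<in> X"
  shows "(\<lambda>\<zeta>. P1 *v f \<zeta>) \<in> X"
  using assms by (auto simp: L2_def norm_P1 intro: measurable_compose[OF _ matrix_measurable])

lemma Ham_bound:
  obtains C where "C > 0" "\<And>v. norm (Ham \<rho> \<tau> *v v) \<le> C * norm v"
proof -
obtain C where "C > 0" "\<And>v. norm (Ham \<rho> \<tau> *v v) \<le> norm v * C"
    using bounded_linear.pos_bounded[OF bounded_linear_matrix] by blast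
  then show ?thesis using that[of C] by (simp add: mult.commute)
qed

definition Ham_inv :: "complex^6 \<Rightarrow> complex^6" where
  "Ham_inv v = (\<chi> i. v $ i / of_real (ham_diag \<rho> \<tau> $ i))"

lemma Ham_Ham_inv: "Ham \<rho> \<tau> *v Ham_inv v = v"
  using ham_diag_pos by (simp add: vec_eq_iff Ham_mult Ham_inv_def less_imp_neq[symmetric])

lemma Ham_inv_Ham: "Ham_inv (Ham \<rho> \<tau> *v v) = v"
  using ham_diag_pos by (simp add: vec_eq_iff Ham_mult Ham_inv_def less_imp_neq[symmetric])

lemma bounded_linear_Ham_inv: "bounded_linear Ham_inv"
  by (intro linear_conv_bounded_linear[THEN iffD1] linearI)
    (simp_all add: Ham_inv_def vec_eq_iff add_divide_distrib scaleR_conv_of_real)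

lemma dom_A_X: "x \<in> dom_A a b \<beta> \<rho> \<tau> \<Longrightarrow> x \<in> X"
  by (simp add: dom_A_def)

lemma op_A_X: "x \<in> dom_A a b \<beta> \<rho> \<tau> \<Longrightarrow> op_A a b \<rho> \<tau> x \<in> X"
  unfolding op_A_def
  by (intro L2_P1) (auto simp: dom_A_def AC_rep_def elim: H1_AC_rep)

lemma dom_AE:
  assumes "x \<in> dom_A a b \<beta> \<rho> \<tau>"
  obtains F g where "AC_rep a b (\<lambda>\<zeta>. Ham \<rho> \<tau> *v x \<zeta>) F g" "op_A a b \<rho> \<tau> x = (\<lambda>\<zeta>. P1 *v g \<zeta>)"
    "WB \<beta> *v stack (F b) (F a) = 0"
  using assms H1_AC_rep[of "\<lambda>\<zeta>. Ham \<rho> \<tau> *v x \<zeta>"] by (auto simp: dom_A_def op_A_def) metis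

text \<open>Any representative pair may serve to verify membership: by uniqueness its boundary
  values are those of the chosen representative, and its derivative is the chosen one almost
  everywhere.\<close>

lemma dom_AI:
  assumes "x \<in> X" and rep: "AC_rep a b (\<lambda>\<zeta>. Ham \<rho> \<tau> *v x \<zeta>) F g"
    and "WB \<beta> *v stack (F b) (F a) = 0"
  shows "x \<in> dom_A a b \<beta> \<rho> \<tau>" and "eq_L2 a b (op_A a b \<rho> \<tau> x) (\<lambda>\<zeta>. P1 *v g \<zeta>)"
proof -
  have "(\<lambda>\<zeta>. Ham \<rho> \<tau> *v x \<zeta>) \<in> X"
  proof -
    obtain C where C: "C > 0" "\<And>v. norm (Ham \<rho> \<tau> *v v) \<le> C * norm v" using Ham_bound by blast
    have meas: "(\<lambda>\<zeta>. Ham \<rho> \<tau> *v x \<zeta>) \<in> borel_measurable \<mu>"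
      using L2_measurable[OF \<open>x \<in> X\<close>] by measurable
    moreover have "integrable \<mu> (\<lambda>\<zeta>. (norm (Ham \<rho> \<tau> *v x \<zeta>))\<^sup>2)"
    proof (rule Bochner_Integration.integrable_bound)
      show "integrable \<mu> (\<lambda>\<zeta>. C\<^sup>2 * (norm (x \<zeta>))\<^sup>2)" using \<open>x \<in> X\<close> by (simp add: L2_def)
      show "AE \<zeta> in \<mu>. norm ((norm (Ham \<rho> \<tau> *v x \<zeta>))\<^sup>2) \<le> norm (C\<^sup>2 * (norm (x \<zeta>))\<^sup>2)"
        using C by (auto intro!: AE_I2 power_mono simp flip: power_mult_distrib)
    qed (use meas in measurable)
    ultimately show ?thesis by (simp add: L2_def)
  qed
  then have H1: "(\<lambda>\<zeta>. Ham \<rho> \<tau> *v x \<zeta>) \<in> H1 a b"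
    using rep by (auto simp: H1_def)
  obtain F' where F': "AC_rep a b (\<lambda>\<zeta>. Ham \<rho> \<tau> *v x \<zeta>) F' (H1_deriv a b (\<lambda>\<zeta>. Ham \<rho> \<tau> *v x \<zeta>))"
    "H1_rep a b (\<lambda>\<zeta>. Ham \<rho> \<tau> *v x \<zeta>) a = F' a" "H1_rep a b (\<lambda>\<zeta>. Ham \<rho> \<tau> *v x \<zeta>) b = F' b"
    using H1_AC_rep[OF H1] by blast
  have "F' a = F a" "F' b = F b"
    using AC_rep_unique(1)[OF F'(1) rep] ab by auto
  then show "x \<in> dom_A a b \<beta> \<rho> \<tau>"
    using assms H1 F'(2,3) by (simp add: dom_A_def)
  show "eq_L2 a b (op_A a b \<rho> \<tau> x) (\<lambda>\<zeta>. P1 *v g \<zeta>)"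
    using AC_rep_unique(2)[OF F'(1) rep] unfolding op_A_def eq_L2_def by eventually_elim simp
qed

section \<open>Compactness of the embedding of the domain\<close>

text \<open>A bound on the graph norms bounds the derivatives of the representatives
  \<open>F n\<close> in L2, which makes the \<open>F n\<close> equicontinuous, and together with the
  bound on \<open>y n\<close> also uniformly bounded. Arzela-Ascoli yields a uniform limit of a
  subsequence, and \<open>Ham_inv\<close> carries it back to the limit \<open>w\<close>.\<close>

lemma compact_domain:
  assumes dom: "\<And>n. y n \<in> dom_A a b \<beta> \<rho> \<tau>"
    and Ny: "\<And>n. N (y n) \<le> K" and NAy: "\<And>n. N (op_A a b \<rho> \<tau> (y n)) \<le> K"
  obtains r :: "nat \<Rightarrow> nat" and w where "strict_mono r" "w \<in> X" "(\<lambda>n. d (y (r n)) w) \<longlonglongrightarrow> 0"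
proof -
  have "\<exists>F g. AC_rep a b (\<lambda>\<zeta>. Ham \<rho> \<tau> *v y n \<zeta>) F g \<and> op_A a b \<rho> \<tau> (y n) = (\<lambda>\<zeta>. P1 *v g \<zeta>)" for n
    using dom_AE[OF dom[of n]] by metis
  then obtain F g where rep: "\<And>n. AC_rep a b (\<lambda>\<zeta>. Ham \<rho> \<tau> *v y n \<zeta>) (F n) (g n)"
    and op: "\<And>n. op_A a b \<rho> \<tau> (y n) = (\<lambda>\<zeta>. P1 *v g n \<zeta>)"
    by metis
  have yX: "y n \<in> X" and opX: "op_A a b \<rho> \<tau> (y n) \<in> X" for n
    using dom[of n] dom_A_X op_A_X by auto
  obtain C where C: "C > 0" "\<And>f. f \<in> X \<Longrightarrow> sqrt (\<integral>\<zeta>. (norm (f \<zeta>))\<^sup>2 \<partial>\<mu>) \<le> C * N f"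
    "\<And>f. f \<in> X \<Longrightarrow> N f \<le> C * sqrt (\<integral>\<zeta>. (norm (f \<zeta>))\<^sup>2 \<partial>\<mu>)"
    using N_bounds by blast
  have K: "K \<ge> 0" using Ny[of 0] N_nonneg order_trans by blast
  \<comment> \<open>A common bound for the squared L2 norms of all \<open>y n\<close> and
    \<open>g n\<close>; the summand 1 keeps it positive.\<close>
  define G where "G = (C * K)\<^sup>2 + 1"
  have G: "G > 0" by (simp add: G_def add_nonneg_pos)
  have int_bound: "(\<integral>\<zeta>. (norm (f \<zeta>))\<^sup>2 \<partial>\<mu>) \<le> G" if "f \<in> X" "N f \<le> K" for f
  proof -
    have "sqrt (\<integral>\<zeta>. (norm (f \<zeta>))\<^sup>2 \<partial>\<mu>) \<le> C * K"
      using C(2)[OF that(1)] mult_left_mono[OF that(2), of C] C(1) by linarith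
    then have "(\<integral>\<zeta>. (norm (f \<zeta>))\<^sup>2 \<partial>\<mu>) \<le> (C * K)\<^sup>2"
      by (rule sqrt_le_D)
    then show ?thesis by (simp add: G_def)
  qed
  have gG: "(\<integral>\<zeta>. (norm (g n \<zeta>))\<^sup>2 \<partial>\<mu>) \<le> G" for n
    using int_bound[OF opX NAy] by (simp add: op norm_P1)
  have yG: "(\<integral>\<zeta>. (norm (y n \<zeta>))\<^sup>2 \<partial>\<mu>) \<le> G" for n
    using int_bound[OF yX Ny] .
  have osc: "norm (F n u - F n v) \<le> s * \<bar>u - v\<bar> + G / s"
    if uv: "u \<in> {a..b}" "v \<in> {a..b}" and "s > 0" for n u v s
  proof -
    have *: "norm (F n v - F n u) \<le> s * (v - u) + G / s" if "a \<le> u" "u \<le> v" "v \<le> b" for u v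
      using AC_rep_Hoelder[OF rep[of n] that \<open>s > 0\<close>] divide_right_mono[OF gG, of s n] \<open>s > 0\<close>
      by linarith
    show ?thesis
      using *[of u v] *[of v u] uv by (cases "u \<le> v") (auto simp: norm_minus_commute)
  qed
  obtain CH where CH: "CH > 0" "\<And>v. norm (Ham \<rho> \<tau> *v v) \<le> CH * norm v" using Ham_bound by blast
  \<comment> \<open>The last two summands bound the oscillation of \<open>F n\<close>, from
    \<open>osc\<close> with \<open>s = 1\<close>. If \<open>norm (F n u)\<close> exceeded
    \<open>B\<close> at one point, \<open>norm (y n)\<close> would exceed
    \<open>1 + G / (b - a)\<close> almost everywhere, and the integral of its square would exceed
    \<open>G\<close>.\<close>
  define B where "B = CH * (1 + G / (b - a)) + ((b - a) + G)"
  have bound: "norm (F n u) \<le> B" if u: "u \<in> {a..b}" for n u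
  proof (rule ccontr)
    assume *: "\<not> norm (F n u) \<le> B"
    define B0 where "B0 = 1 + G / (b - a)"
    have "B0 > 1" using G ab by (simp add: B0_def)
    have "AE v in \<mu>. B0 < norm (y n v)"
    proof -
      have "AE v in \<mu>. Ham \<rho> \<tau> *v y n v = F n v"
        using rep[of n] by (simp add: AC_rep_def eq_L2_def)
      then have "AE v in \<mu>. v \<in> {a..b} \<and> Ham \<rho> \<tau> *v y n v = F n v"
        using AE_space by eventually_elim (auto simp: space_restrict_space)
      then show ?thesis
      proof eventually_elim
        case (elim v)
        have "norm (F n u) \<le> norm (F n v) + norm (F n u - F n v)"
          using norm_triangle_sub by blast
        moreover have "norm (F n u - F n v) \<le> (b - a) + G"
          using osc[OF u, of v 1 n] elim u by auto
        moreover have "norm (F n v) \<le> CH * norm (y n v)"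
          using CH(2)[of "y n v"] elim by simp
        ultimately have "CH * B0 < CH * norm (y n v)"
          using * by (simp add: B_def B0_def)
        then show ?case using CH(1) by simp
      qed
    qed
    \<comment> \<open>Since \<open>B0 > 1\<close>, squaring only increases
      \<open>norm (y n v)\<close>, so \<open>B0\<close> itself bounds the square from below.\<close>
    then have "AE v in \<mu>. B0 \<le> (norm (y n v))\<^sup>2"
    proof eventually_elim
      case (elim v)
      then show ?case using \<open>B0 > 1\<close> self_le_power[of "norm (y n v)" 2] by simp
    qed
    then have "(\<integral>v. B0 \<partial>\<mu>) \<le> (\<integral>v. (norm (y n v))\<^sup>2 \<partial>\<mu>)"
      using yX[of n] by (intro integral_mono_AE finite_measure.integrable_const finite_measure_lebesgue_on)
        (auto simp: L2_def)
    moreover have "(\<integral>v. B0 \<partial>\<mu>) = B0 * (b - a)"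
      using ab by (simp add: measure_restrict_space space_restrict_space)
    moreover have "B0 * (b - a) = (b - a) + G" using ab by (simp add: B0_def field_simps)
    ultimately show False using yG[of n] ab by linarith
  qed
  obtain F0 and r :: "nat \<Rightarrow> nat" where F0: "continuous_on {a..b} F0" and r: "strict_mono r"
    and lim: "\<And>e. 0 < e \<Longrightarrow> \<exists>n0. \<forall>n x. n \<ge> n0 \<and> x \<in> {a..b} \<longrightarrow> norm (F (r n) x - F0 x) < e"
  proof (rule Arzela_Ascoli[of "{a..b}" F B])
    show "compact {a..b}" by simp
    show "norm (F n x) \<le> B" if "x \<in> {a..b}" for n x using bound that .
    show "\<exists>d>0. \<forall>n y. y \<in> {a..b} \<and> norm (x - y) < d \<longrightarrow> norm (F n x - F n y) < e"
      if x: "x \<in> {a..b}" and "0 < e" for x e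
    proof (intro exI conjI allI impI)
      \<comment> \<open>Balances the two terms of \<open>osc\<close>: the second becomes
        \<open>e / 4\<close>, and the radius \<open>e / (2 * s)\<close> makes the first less than
        \<open>e / 2\<close>.\<close>
      define s where "s = 4 * G / e"
      have s: "s > 0" using G \<open>e > 0\<close> by (simp add: s_def)
      show "0 < e / (2 * s)" using s \<open>e > 0\<close> by simp
      fix n y assume y: "y \<in> {a..b} \<and> norm (x - y) < e / (2 * s)"
      then have "s * \<bar>x - y\<bar> < e / 2" using s by (simp add: field_simps)
      moreover have "G / s = e / 4" using G \<open>e > 0\<close> by (simp add: s_def)
      ultimately show "norm (F n x - F n y) < e" using osc[OF x _ s, of y n] y \<open>e > 0\<close> by force
    qed
  qed blast
  define w where "w = (\<lambda>\<zeta>. Ham_inv (F0 \<zeta>))"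
  have w: "w \<in> X"
    unfolding w_def
    by (intro continuous_L2 bounded_linear.continuous_on[OF bounded_linear_Ham_inv] F0)
  obtain CI where CI: "CI > 0" "\<And>v. norm (Ham_inv v) \<le> norm v * CI"
    using bounded_linear.pos_bounded[OF bounded_linear_Ham_inv] by blast
  have "(\<lambda>n. d (y (r n)) w) \<longlonglongrightarrow> 0"
  proof (rule LIMSEQ_I)
    fix e :: real assume "e > 0"
    define e' where "e' = e / (2 * CI * C * sqrt (b - a))"
    have e': "e' > 0" using \<open>e > 0\<close> CI(1) C(1) ab by (simp add: e'_def)
    then obtain n0 where n0: "\<And>n x. n \<ge> n0 \<Longrightarrow> x \<in> {a..b} \<Longrightarrow> norm (F (r n) x - F0 x) < e'"
      using lim by blast
    have "norm (d (y (r n)) w - 0) < e" if "n \<ge> n0" for n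
    proof -
      have dX: "(\<lambda>\<zeta>. y (r n) \<zeta> - w \<zeta>) \<in> X" using yX w by (rule L2_diff)
      have "AE v in \<mu>. (norm (y (r n) v - w v))\<^sup>2 \<le> (e' * CI)\<^sup>2"
      proof -
        have "AE v in \<mu>. Ham \<rho> \<tau> *v y (r n) v = F (r n) v"
          using rep[of "r n"] by (simp add: AC_rep_def eq_L2_def)
        then have "AE v in \<mu>. v \<in> {a..b} \<and> Ham \<rho> \<tau> *v y (r n) v = F (r n) v"
          using AE_space by eventually_elim (auto simp: space_restrict_space)
        then show ?thesis
        proof eventually_elim
          case (elim v)
          then have "y (r n) v = Ham_inv (F (r n) v)" using Ham_inv_Ham by metis
          then have "y (r n) v - w v = Ham_inv (F (r n) v - F0 v)"
            by (simp add: w_def linear_diff[OF bounded_linear.linear[OF bounded_linear_Ham_inv]])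
          then have "norm (y (r n) v - w v) \<le> norm (F (r n) v - F0 v) * CI" using CI(2) by simp
          also have "\<dots> \<le> e' * CI" using n0[OF that, of v] elim CI(1) by (intro mult_right_mono) auto
          finally show ?case by (simp add: power_mono)
        qed
      qed
      then have "(\<integral>v. (norm (y (r n) v - w v))\<^sup>2 \<partial>\<mu>) \<le> (\<integral>v. (e' * CI)\<^sup>2 \<partial>\<mu>)"
        using dX by (intro integral_mono_AE finite_measure.integrable_const finite_measure_lebesgue_on)
          (auto simp: L2_def)
      also have "\<dots> = (e' * CI)\<^sup>2 * (b - a)"
        using ab by (simp add: measure_restrict_space space_restrict_space)
      finally have "sqrt (\<integral>v. (norm (y (r n) v - w v))\<^sup>2 \<partial>\<mu>) \<le> sqrt ((e' * CI)\<^sup>2 * (b - a))"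
        by simp
      also have "\<dots> = e' * CI * sqrt (b - a)" using e' CI(1) by (simp add: real_sqrt_mult)
      finally have "d (y (r n)) w \<le> C * (e' * CI * sqrt (b - a))"
        using C(3)[OF dX] C(1) by (meson mult_left_mono less_imp_le order_trans)
      also have "\<dots> = e / 2" using CI(1) C(1) ab by (simp add: e'_def field_simps)
      finally show ?thesis using \<open>e > 0\<close> by simp
    qed
    then show "\<exists>n0. \<forall>n\<ge>n0. norm (d (y (r n)) w - 0) < e" by blast
  qed
  then show ?thesis using that r w by blast
qed

end

section \<open>The discrete Fourier transform\<close>

text \<open>Off the diagonal this is a geometric sum with ratio \<open>r\<close>, where
  \<open>r ^ M = 1\<close>; and \<open>r \<noteq> 1\<close>, because \<open>m - n\<close> is nonzero
  and smaller than \<open>M\<close> in absolute value.\<close>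

lemma sum_roots_of_unity:
  fixes M n m :: nat
  assumes "n < M" "m < M"
  shows "(\<Sum>j<M. cis (2 * pi * j / M * (real m - real n))) = (if n = m then of_nat M else 0)"
proof (cases "n = m")
  case False
  define r where "r = cis (2 * pi / M * (real m - real n))"
  have M: "M > 0" using assms by simp
  have pow: "cis (2 * pi * j / M * (real m - real n)) = r ^ j" for j :: nat
    by (simp add: r_def Complex.DeMoivre mult_ac)
  have rM: "r ^ M = 1"
  proof -
    have "r ^ M = cis (2 * pi * of_int (int m - int n))"
      using M by (simp add: r_def Complex.DeMoivre mult_ac)
    then show ?thesis by (metis cis_multiple_2pi Ints_of_int)
  qed
  have "r \<noteq> 1"
  proof
    assume "r = 1"
    then have "cos (2 * pi / M * (real m - real n)) = 1"
      by (simp add: r_def complex_eq_iff)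
    then obtain k :: int where "2 * pi / M * (real m - real n) = of_int k * 2 * pi"
      unfolding cos_one_2pi_int by blast
    then have "(2 * pi) * ((real m - real n) / M) = (2 * pi) * of_int k"
      by (simp add: mult_ac)
    then have "(real m - real n) / M = of_int k"
      unfolding mult_cancel_left by simp
    then have "real m - real n = k * real M"
      using M by (simp add: field_simps)
    then have k: "int m - int n = k * int M"
      by (metis of_int_diff of_int_eq_iff of_int_mult of_int_of_nat_eq)
    then have "k \<noteq> 0" using False by auto
    then have "\<bar>k * int M\<bar> \<ge> int M"
      using mult_right_mono[of 1 "\<bar>k\<bar>" "int M"] by (simp add: abs_mult)
    moreover have "\<bar>int m - int n\<bar> < int M" using assms by simp
    ultimately show False using k by simp
  qed
  then have "(\<Sum>j<M. r ^ j) = 0"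
    by (simp add: geometric_sum rM)
  then show ?thesis using False pow by simp
qed simp

text \<open>Expand each squared modulus into a double sum and sum over the frequency
  \<open>j\<close> first; orthogonality of the characters leaves the diagonal.\<close>

lemma Parseval_DFT:
  fixes z :: "nat \<Rightarrow> complex" and M :: nat
  shows "(\<Sum>j<M. (cmod (\<Sum>n<M. cis (- (2 * pi * j / M * n)) * z n))\<^sup>2) = M * (\<Sum>n<M. (cmod (z n))\<^sup>2)"
proof -
  have "complex_of_real (\<Sum>j<M. (cmod (\<Sum>n<M. cis (- (2 * pi * j / M * n)) * z n))\<^sup>2) =
      (\<Sum>j<M. (\<Sum>n<M. cis (- (2 * pi * j / M * n)) * z n) * (\<Sum>m<M. cis (2 * pi * j / M * m) * cnj (z m)))"
    unfolding of_real_sum complex_norm_square by (simp add: cis_cnj)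
  also have "\<dots> = (\<Sum>j<M. \<Sum>n<M. \<Sum>m<M. cis (2 * pi * j / M * (real m - real n)) * (z n * cnj (z m)))"
  proof (intro sum.cong refl)
    fix j
    have "(cis (- (2 * pi * j / M * n)) * z n) * (cis (2 * pi * j / M * m) * cnj (z m)) =
        cis (2 * pi * j / M * (real m - real n)) * (z n * cnj (z m))" for n m :: nat
    proof -
      have "cis (2 * pi * j / M * (real m - real n)) =
          cis (- (2 * pi * j / M * n)) * cis (2 * pi * j / M * m)"
        by (simp add: cis_mult right_diff_distrib)
      then show ?thesis by (simp only: mult_ac)
    qed
    then show "(\<Sum>n<M. cis (- (2 * pi * j / M * n)) * z n) * (\<Sum>m<M. cis (2 * pi * j / M * m) * cnj (z m)) =
        (\<Sum>n<M. \<Sum>m<M. cis (2 * pi * j / M * (real m - real n)) * (z n * cnj (z m)))"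
      unfolding sum_product by (intro sum.cong refl)
  qed
  also have "\<dots> = (\<Sum>n<M. \<Sum>m<M. (\<Sum>j<M. cis (2 * pi * j / M * (real m - real n))) * (z n * cnj (z m)))"
    unfolding sum_distrib_right
    by (rule trans[OF sum.swap]) (intro sum.cong refl sum.swap)
  also have "\<dots> = (\<Sum>n<M. \<Sum>m<M. if n = m then of_nat M * (z n * cnj (z m)) else 0)"
    by (intro sum.cong refl, subst sum_roots_of_unity) auto
  also have "\<dots> = complex_of_real (M * (\<Sum>n<M. (cmod (z n))\<^sup>2))"
    by (simp add: sum_distrib_left complex_norm_square[symmetric])
  finally show ?thesis by (simp only: of_real_eq_iff)
qed

text \<open>The chord has length \<open>2 * |sin (\<theta> / 2)|\<close>, and the Taylor bound for
  the sine gives \<open>|x| \<le> 2 * |sin x|\<close> when \<open>x\<^sup>2 \<le> 3\<close>. The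
  estimate later converts a small displacement into a bound on the phase.\<close>

lemma cis_minus_1_ge:
  assumes "\<bar>\<theta>\<bar> \<le> pi"
  shows "\<bar>\<theta>\<bar> / 2 \<le> cmod (cis \<theta> - 1)"
proof -
  define x where "x = \<theta> / 2"
  have "(cmod (cis \<theta> - 1))\<^sup>2 = (2 * sin x)\<^sup>2"
  proof -
    have "(cmod (cis \<theta> - 1))\<^sup>2 = (cos \<theta> - 1)\<^sup>2 + (sin \<theta>)\<^sup>2"
      by (simp add: cmod_power2)
    also have "\<dots> = 2 - 2 * cos \<theta>"
      using sin_cos_squared_add[of \<theta>] by (simp add: power2_eq_square algebra_simps)
    also have "\<dots> = (2 * sin x)\<^sup>2"
      using cos_double_sin[of x] by (simp add: x_def power2_eq_square)
    finally show ?thesis .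
  qed
  then have "cmod (cis \<theta> - 1) = \<bar>2 * sin x\<bar>"
    by (metis abs_norm_cancel power2_eq_iff abs_minus)
  moreover have "\<bar>x\<bar> \<le> 2 * \<bar>sin x\<bar>"
  proof -
    have "\<bar>sin x - x\<bar> \<le> \<bar>x\<bar> ^ 3 / 6"
      using Maclaurin_sin_bound[of x 3] by (simp add: numeral_3_eq_3 sin_coeff_def fact_numeral field_simps)
    moreover have "x\<^sup>2 \<le> 3"
    proof -
      \<comment> \<open>\<open>17/10\<close> is a rational number above \<open>pi / 2\<close> whose
        square is still below 3.\<close>
      have "\<bar>x\<bar> \<le> 17 / 10" using assms pi_less_4 pi_approx by (simp add: x_def)
      then have "\<bar>x\<bar>\<^sup>2 \<le> (17 / 10)\<^sup>2" by (intro power_mono) auto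
      then show ?thesis by (simp add: power2_eq_square)
    qed
    then have "\<bar>x\<bar> * x\<^sup>2 \<le> \<bar>x\<bar> * 3" by (intro mult_left_mono) auto
    then have "\<bar>x\<bar> ^ 3 / 6 \<le> \<bar>x\<bar> / 2" by (simp add: power3_eq_cube power2_eq_square)
    ultimately show ?thesis by linarith
  qed
  ultimately show ?thesis by (simp add: x_def)
qed

section \<open>Orbits of the semigroup\<close>

text \<open>Splitting \<open>t\<close> into \<open>n\<close> equal pieces gives
  \<open>\<psi> t \<le> n * \<psi> (t / n) \<le> t * \<phi> (t / n)\<close>, and \<open>n\<close>
  tends to infinity. This stands in for differentiating orbits: only their behaviour at time 0 has
  to be known.\<close>

lemma subadditive_bound:
  fixes \<psi> \<phi> :: "real \<Rightarrow> real"
  assumes sub: "\<And>s t. s > 0 \<Longrightarrow> t > 0 \<Longrightarrow> \<psi> (s + t) \<le> \<psi> s + \<psi> t"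
    and le: "\<And>s. s > 0 \<Longrightarrow> \<psi> s \<le> s * \<phi> s" and lim: "(\<phi> \<longlongrightarrow> L) (at_right 0)" and "t > 0"
  shows "\<psi> t \<le> t * L"
proof -
  have mult: "\<psi> (real (Suc n) * s) \<le> real (Suc n) * \<psi> s" if "s > 0" for n s
  proof (induction n)
    case (Suc n)
    have "real (Suc (Suc n)) * s = real (Suc n) * s + s" by (simp add: algebra_simps)
    then have "\<psi> (real (Suc (Suc n)) * s) \<le> \<psi> (real (Suc n) * s) + \<psi> s"
      using sub[of "real (Suc n) * s" s] that by simp
    then show ?case using Suc by (simp add: algebra_simps)
  qed simp
  have "\<psi> t \<le> t * \<phi> (t / real (Suc n))" for n
  proof -
    have "\<psi> t \<le> real (Suc n) * \<psi> (t / real (Suc n))"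
      using mult[of "t / real (Suc n)" n] \<open>t > 0\<close> by simp
    also have "\<dots> \<le> real (Suc n) * (t / real (Suc n) * \<phi> (t / real (Suc n)))"
      using le[of "t / real (Suc n)"] \<open>t > 0\<close> by (intro mult_left_mono) auto
    finally show ?thesis by simp
  qed
  moreover have "(\<lambda>n. t * \<phi> (t / real (Suc n))) \<longlonglongrightarrow> t * L"
  proof (intro tendsto_intros filterlim_compose[OF lim])
    have "(\<lambda>n. t / real (Suc n)) \<longlonglongrightarrow> 0"
      by (intro LIMSEQ_Suc lim_const_over_n)
    then show "filterlim (\<lambda>n. t / real (Suc n)) (at_right 0) sequentially"
      using \<open>t > 0\<close> by (auto simp: filterlim_at intro!: always_eventually)
  qed
  ultimately show ?thesis by (intro LIMSEQ_le_const) auto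
qed

lemma cis_quotient: "((\<lambda>s. cmod ((cis (\<omega> * s) - 1) / of_real s - \<i> * of_real \<omega>)) \<longlongrightarrow> 0) (at_right 0)"
proof (cases "\<omega> = 0")
  case False
  have "((\<lambda>s. \<i> * of_real (\<omega> * s)) \<longlongrightarrow> \<i> * of_real (\<omega> * 0)) (at_right 0)"
    by (intro tendsto_intros)
  then have "filterlim (\<lambda>s. \<i> * of_real (\<omega> * s)) (at 0) (at_right 0)"
    using False by (auto simp: filterlim_at eventually_at_right_field intro!: exI[of _ 1])
  then have "((\<lambda>s. (exp (\<i> * of_real (\<omega> * s)) - 1) / (\<i> * of_real (\<omega> * s))) \<longlongrightarrow> 1) (at_right 0)"
    by (rule filterlim_compose[OF lim_exp_minus_1])
  then have "((\<lambda>s. cmod ((exp (\<i> * of_real (\<omega> * s)) - 1) / (\<i> * of_real (\<omega> * s)) * (\<i> * of_real \<omega>)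
      - \<i> * of_real \<omega>)) \<longlongrightarrow> cmod (1 * (\<i> * of_real \<omega>) - \<i> * of_real \<omega>)) (at_right 0)"
    by (intro tendsto_intros)
  moreover have "(exp (\<i> * of_real (\<omega> * s)) - 1) / (\<i> * of_real (\<omega> * s)) * (\<i> * of_real \<omega>)
      = (cis (\<omega> * s) - 1) / of_real s" for s
    using False by (simp add: cis_conv_exp)
  ultimately show ?thesis by simp
qed simp

lemma eq_L2_sym: "eq_L2 a b f g \<Longrightarrow> eq_L2 a b g f"
  by (simp add: eq_L2_def eq_commute)

lemma eq_L2_trans:
  assumes "eq_L2 a b f g" "eq_L2 a b g h"
  shows "eq_L2 a b f h"
  using assms unfolding eq_L2_def by eventually_elim simp

locale string_semigroup = string_space +
  fixes \<beta> :: real and T :: "real \<Rightarrow> (real \<Rightarrow> complex^6) \<Rightarrow> (real \<Rightarrow> complex^6)"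
  assumes semigroup: "contraction_semigroup a b \<rho> \<tau> T"
    and generated: "generated_by_A a b \<beta> \<rho> \<tau> T"
begin

abbreviation "DA \<equiv> dom_A a b \<beta> \<rho> \<tau>"
abbreviation "A \<equiv> op_A a b \<rho> \<tau>"

section \<open>The semigroup axioms and their direct consequences\<close>

lemma T_X: "t \<ge> 0 \<Longrightarrow> x \<in> X \<Longrightarrow> T t x \<in> X"
  using semigroup unfolding contraction_semigroup_def by blast

lemma T_linear: "t \<ge> 0 \<Longrightarrow> x \<in> X \<Longrightarrow> y \<in> X \<Longrightarrow>
    eq_L2 a b (T t (\<lambda>\<zeta>. c *s x \<zeta> + e *s y \<zeta>)) (\<lambda>\<zeta>. c *s T t x \<zeta> + e *s T t y \<zeta>)"
  using semigroup unfolding contraction_semigroup_def by blast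

lemma T_contraction: "t \<ge> 0 \<Longrightarrow> x \<in> X \<Longrightarrow> N (T t x) \<le> N x"
  using semigroup unfolding contraction_semigroup_def by blast

lemma T_0: "x \<in> X \<Longrightarrow> eq_L2 a b (T 0 x) x"
  using semigroup unfolding contraction_semigroup_def by blast

lemma T_add: "s \<ge> 0 \<Longrightarrow> t \<ge> 0 \<Longrightarrow> x \<in> X \<Longrightarrow> eq_L2 a b (T (s + t) x) (T s (T t x))"
  using semigroup unfolding contraction_semigroup_def by blast

lemma T_scale: "t \<ge> 0 \<Longrightarrow> x \<in> X \<Longrightarrow> eq_L2 a b (T t (\<lambda>\<zeta>. c *s x \<zeta>)) (\<lambda>\<zeta>. c *s T t x \<zeta>)"
  using T_linear[of t x x c 0] by simp

lemma T_diff: "t \<ge> 0 \<Longrightarrow> x \<in> X \<Longrightarrow> y \<in> X \<Longrightarrow>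
    eq_L2 a b (T t (\<lambda>\<zeta>. x \<zeta> - y \<zeta>)) (\<lambda>\<zeta>. T t x \<zeta> - T t y \<zeta>)"
  using T_linear[of t x y 1 "-1"] by simp

lemma T_dist:
  assumes "t \<ge> 0" "x \<in> X" "y \<in> X"
  shows "d (T t x) (T t y) \<le> d x y"
proof -
  have "d (T t x) (T t y) = N (T t (\<lambda>\<zeta>. x \<zeta> - y \<zeta>))"
    using assms by (intro N_cong L2_diff T_X eq_L2_sym[OF T_diff])
  also have "\<dots> \<le> d x y" using assms by (intro T_contraction L2_diff)
  finally show ?thesis .
qed

lemma T_sum:
  assumes "t \<ge> 0" "finite I" "\<And>n. n \<in> I \<Longrightarrow> u n \<in> X"
  shows "eq_L2 a b (T t (\<lambda>\<zeta>. \<Sum>n\<in>I. c n *s u n \<zeta>)) (\<lambda>\<zeta>. \<Sum>n\<in>I. c n *s T t (u n) \<zeta>)"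
  using assms(2,3)
proof (induction I)
  case empty
  show ?case using T_scale[OF assms(1), of "\<lambda>_. 0" 0] by simp
next
  case (insert k I)
  have "(\<lambda>\<zeta>. \<Sum>n\<in>I. c n *s u n \<zeta>) \<in> X" using insert by (intro L2_sum L2_scale) auto
  then have "eq_L2 a b (T t (\<lambda>\<zeta>. c k *s u k \<zeta> + 1 *s (\<Sum>n\<in>I. c n *s u n \<zeta>)))
      (\<lambda>\<zeta>. c k *s T t (u k) \<zeta> + 1 *s T t (\<lambda>\<zeta>. \<Sum>n\<in>I. c n *s u n \<zeta>) \<zeta>)"
    using insert by (intro T_linear assms(1)) auto
  moreover have "eq_L2 a b (T t (\<lambda>\<zeta>. \<Sum>n\<in>I. c n *s u n \<zeta>)) (\<lambda>\<zeta>. \<Sum>n\<in>I. c n *s T t (u n) \<zeta>)"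
    using insert by auto
  ultimately have "AE \<zeta> in \<mu>. T t (\<lambda>\<zeta>. c k *s u k \<zeta> + 1 *s (\<Sum>n\<in>I. c n *s u n \<zeta>)) \<zeta>
      = c k *s T t (u k) \<zeta> + (\<Sum>n\<in>I. c n *s T t (u n) \<zeta>)"
    unfolding eq_L2_def by eventually_elim simp
  then show ?case
    using insert(1,2) by (simp add: eq_L2_def)
qed

text \<open>The generator as a relation between functions, stated by difference quotients alone.
  Semigroup arguments use this form; \<open>graph_iff\<close> translates it to \<open>A\<close>,
  with its boundary conditions and almost everywhere equalities.\<close>

definition graph :: "(real \<Rightarrow> complex^6) \<Rightarrow> (real \<Rightarrow> complex^6) \<Rightarrow> bool" where
  "graph x y \<longleftrightarrow> x \<in> X \<and> y \<in> X \<and>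
     ((\<lambda>t. N (\<lambda>\<zeta>. (1 / t) *\<^sub>R (T t x \<zeta> - x \<zeta>) - y \<zeta>)) \<longlongrightarrow> 0) (at_right 0)"

lemma graph_iff: "graph x y \<longleftrightarrow> x \<in> DA \<and> y \<in> X \<and> eq_L2 a b (A x) y"
  using generated dom_A_X unfolding generated_by_A_def graph_def by blast

lemma graph_A: "x \<in> DA \<Longrightarrow> graph x (A x)"
  by (simp add: graph_iff op_A_X eq_L2_def)

lemma quotient_X: "t \<ge> 0 \<Longrightarrow> x \<in> X \<Longrightarrow> y \<in> X \<Longrightarrow> (\<lambda>\<zeta>. (1 / t) *\<^sub>R (T t x \<zeta> - x \<zeta>) - y \<zeta>) \<in> X"
  by (intro L2_diff L2_scaleR T_X)

lemma graph_linear: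
  assumes "graph x y" "graph x' y'"
  shows "graph (\<lambda>\<zeta>. c *s x \<zeta> + c' *s x' \<zeta>) (\<lambda>\<zeta>. c *s y \<zeta> + c' *s y' \<zeta>)"
  unfolding graph_def
proof (intro conjI)
  have X: "x \<in> X" "y \<in> X" "x' \<in> X" "y' \<in> X" using assms by (auto simp: graph_def)
  show X1: "(\<lambda>\<zeta>. c *s x \<zeta> + c' *s x' \<zeta>) \<in> X" and X2: "(\<lambda>\<zeta>. c *s y \<zeta> + c' *s y' \<zeta>) \<in> X"
    using X by (auto intro!: L2_add L2_scale)
  define q where "q t x y = (\<lambda>\<zeta>. (1 / t) *\<^sub>R (T t x \<zeta> - x \<zeta>) - y \<zeta>)" for t x y
  show "((\<lambda>t. N (\<lambda>\<zeta>. (1 / t) *\<^sub>R (T t (\<lambda>\<zeta>. c *s x \<zeta> + c' *s x' \<zeta>) \<zeta> - (c *s x \<zeta> + c' *s x' \<zeta>))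
      - (c *s y \<zeta> + c' *s y' \<zeta>))) \<longlongrightarrow> 0) (at_right 0)"
  proof (rule Lim_null_comparison)
    have "((\<lambda>t. cmod c * N (q t x y) + cmod c' * N (q t x' y')) \<longlongrightarrow> cmod c * 0 + cmod c' * 0) (at_right 0)"
      using assms by (intro tendsto_intros) (auto simp: graph_def q_def)
    then show "((\<lambda>t. cmod c * N (q t x y) + cmod c' * N (q t x' y')) \<longlongrightarrow> 0) (at_right 0)" by simp
    have "N (\<lambda>\<zeta>. (1 / t) *\<^sub>R (T t (\<lambda>\<zeta>. c *s x \<zeta> + c' *s x' \<zeta>) \<zeta> - (c *s x \<zeta> + c' *s x' \<zeta>))
      - (c *s y \<zeta> + c' *s y' \<zeta>)) \<le> cmod c * N (q t x y) + cmod c' * N (q t x' y')" if "t > 0" for t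
    proof -
      have qX: "q t x y \<in> X" "q t x' y' \<in> X" unfolding q_def using that X by (auto intro: quotient_X)
      have scal: "k *s (r *\<^sub>R v) = r *\<^sub>R (k *s v)" for k r and v :: "complex^6"
        by (simp add: vec_eq_iff scaleR_conv_of_real[where 'a = complex])
      have "N (\<lambda>\<zeta>. (1 / t) *\<^sub>R (T t (\<lambda>\<zeta>. c *s x \<zeta> + c' *s x' \<zeta>) \<zeta> - (c *s x \<zeta> + c' *s x' \<zeta>))
          - (c *s y \<zeta> + c' *s y' \<zeta>)) = N (\<lambda>\<zeta>. c *s q t x y \<zeta> + c' *s q t x' y' \<zeta>)"
      proof (rule N_cong)
        show "eq_L2 a b (\<lambda>\<zeta>. (1 / t) *\<^sub>R (T t (\<lambda>\<zeta>. c *s x \<zeta> + c' *s x' \<zeta>) \<zeta> - (c *s x \<zeta> + c' *s x' \<zeta>))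
          - (c *s y \<zeta> + c' *s y' \<zeta>)) (\<lambda>\<zeta>. c *s q t x y \<zeta> + c' *s q t x' y' \<zeta>)"
          using T_linear[of t x x' c c'] that X unfolding eq_L2_def
          by (auto elim!: eventually_mono simp: q_def scal vector_ssub_ldistrib scaleR_diff_right
              scaleR_add_right)
      qed (use qX X that X1 X2 in \<open>auto intro!: L2_add L2_scale quotient_X\<close>)
      also have "\<dots> \<le> N (\<lambda>\<zeta>. c *s q t x y \<zeta>) + N (\<lambda>\<zeta>. c' *s q t x' y' \<zeta>)"
        using qX by (intro N_add L2_scale)
      finally show ?thesis by (simp add: N_scale)
    qed
    then show "\<forall>\<^sub>F t in at_right 0. norm (N (\<lambda>\<zeta>. (1 / t) *\<^sub>R (T t (\<lambda>\<zeta>. c *s x \<zeta> + c' *s x' \<zeta>) \<zeta>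
        - (c *s x \<zeta> + c' *s x' \<zeta>)) - (c *s y \<zeta> + c' *s y' \<zeta>)))
        \<le> cmod c * N (q t x y) + cmod c' * N (q t x' y')"
      by (auto simp: eventually_at_right_field intro!: exI[of _ 1])
  qed
qed

text \<open>\<open>T t\<close> commutes with \<open>T s\<close>, so the error of the difference
  quotient at \<open>T t x\<close> is the image under \<open>T t\<close> of the error at
  \<open>x\<close>, and a contraction does not enlarge it.\<close>

lemma graph_T:
  assumes "graph x y" "t \<ge> 0"
  shows "graph (T t x) (T t y)"
  unfolding graph_def
proof (intro conjI)
  have X: "x \<in> X" "y \<in> X" using assms by (auto simp: graph_def)
  show TX: "T t x \<in> X" "T t y \<in> X" using X assms T_X by auto
  define q where "q s = (\<lambda>\<zeta>. (1 / s) *\<^sub>R (T s x \<zeta> - x \<zeta>) - y \<zeta>)" for s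
  show "((\<lambda>s. N (\<lambda>\<zeta>. (1 / s) *\<^sub>R (T s (T t x) \<zeta> - T t x \<zeta>) - T t y \<zeta>)) \<longlongrightarrow> 0) (at_right 0)"
  proof (rule Lim_null_comparison)
    show "((\<lambda>s. N (q s)) \<longlongrightarrow> 0) (at_right 0)" using assms(1) by (simp add: graph_def q_def)
    have "N (\<lambda>\<zeta>. (1 / s) *\<^sub>R (T s (T t x) \<zeta> - T t x \<zeta>) - T t y \<zeta>) \<le> N (q s)" if "s > 0" for s
    proof -
      have s: "s \<ge> 0" using that by simp
      have qX: "q s \<in> X" unfolding q_def using s X by (rule quotient_X)
      have TsX: "T s x \<in> X" using s X(1) by (rule T_X)
      \<comment> \<open>The difference quotient as a combination with complex coefficients, the form
        to which \<open>T_linear\<close> applies.\<close>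
      define z where "z = (\<lambda>\<zeta>. of_real (1 / s) *s T s x \<zeta> + (- of_real (1 / s)) *s x \<zeta>)"
      have zX: "z \<in> X" unfolding z_def using TsX X by (intro L2_add L2_scale)
      have q: "q s = (\<lambda>\<zeta>. 1 *s z \<zeta> + (-1) *s y \<zeta>)"
        by (simp add: q_def z_def vec_eq_iff fun_eq_iff scaleR_conv_of_real[where 'a = complex] algebra_simps)
      have e: "eq_L2 a b (T t (q s)) (\<lambda>\<zeta>. 1 *s T t z \<zeta> + (-1) *s T t y \<zeta>)"
        unfolding q using assms(2) zX X by (intro T_linear)
      have e2: "eq_L2 a b (T t z) (\<lambda>\<zeta>. of_real (1 / s) *s T t (T s x) \<zeta> + (- of_real (1 / s)) *s T t x \<zeta>)"
        unfolding z_def using assms(2) TsX X by (intro T_linear)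
      have e3: "eq_L2 a b (T s (T t x)) (T t (T s x))"
        using T_add[of s t x] T_add[of t s x] s assms(2) X(1)
        by (metis add.commute eq_L2_sym eq_L2_trans)
      have "N (\<lambda>\<zeta>. (1 / s) *\<^sub>R (T s (T t x) \<zeta> - T t x \<zeta>) - T t y \<zeta>) = N (T t (q s))"
      proof (rule N_cong)
        show "eq_L2 a b (\<lambda>\<zeta>. (1 / s) *\<^sub>R (T s (T t x) \<zeta> - T t x \<zeta>) - T t y \<zeta>) (T t (q s))"
          using e e2 e3 unfolding eq_L2_def
          by eventually_elim (simp add: vec_eq_iff scaleR_conv_of_real[where 'a = complex] algebra_simps)
      qed (use s TX qX assms(2) in \<open>auto intro!: quotient_X T_X\<close>)
      also have "\<dots> \<le> N (q s)" using assms(2) qX by (rule T_contraction)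
      finally show ?thesis .
    qed
    then show "\<forall>\<^sub>F s in at_right 0. norm (N (\<lambda>\<zeta>. (1 / s) *\<^sub>R (T s (T t x) \<zeta> - T t x \<zeta>) - T t y \<zeta>)) \<le> N (q s)"
      by (auto simp: eventually_at_right_field intro!: exI[of _ 1])
  qed
qed

lemma graph_sum:
  assumes "finite I" "\<And>n. n \<in> I \<Longrightarrow> graph (u n) (v n)"
  shows "graph (\<lambda>\<zeta>. \<Sum>n\<in>I. c n *s u n \<zeta>) (\<lambda>\<zeta>. \<Sum>n\<in>I. c n *s v n \<zeta>)"
  using assms
proof (induction I)
  case empty
  have "graph (\<lambda>\<zeta>. 0) (\<lambda>\<zeta>. 0)"
  proof -
    have "eq_L2 a b (T t (\<lambda>\<zeta>. 0)) (\<lambda>\<zeta>. 0)" if "t \<ge> 0" for t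
      using T_scale[OF that, of "\<lambda>_. 0" 0] by simp
    then have "N (\<lambda>\<zeta>. (1 / t) *\<^sub>R (T t (\<lambda>\<zeta>. 0) \<zeta> - 0) - 0) = 0" if "t > 0" for t
      using that N_scaleR[of "1 / t" "T t (\<lambda>\<zeta>. 0)"] N_eq_0_iff[of "T t (\<lambda>\<zeta>. 0)"] by (simp add: T_X)
    then show ?thesis
      by (auto simp: graph_def eventually_at_right_field intro!: tendsto_eventually exI[of _ 1])
  qed
  then show ?case by simp
next
  case (insert k I)
  then show ?case
    using graph_linear[of "u k" "v k" "\<lambda>\<zeta>. \<Sum>n\<in>I. c n *s u n \<zeta>" "\<lambda>\<zeta>. \<Sum>n\<in>I. c n *s v n \<zeta>" "c k" 1]
    by simp
qed

text \<open>The displacement \<open>d (T t y) y\<close> is subadditive in \<open>t\<close>, because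
  \<open>T s\<close> does not increase distances, and its rate at time 0 is at most
  \<open>N v\<close>; \<open>subadditive_bound\<close> does the rest.\<close>

lemma orbit_Lipschitz:
  assumes "graph y v" "t \<ge> 0"
  shows "d (T t y) y \<le> t * N v"
proof (cases "t = 0")
  case True
  have "y \<in> X" using assms by (simp add: graph_def)
  then show ?thesis using d_eq_0_iff[of "T 0 y" y] T_0 T_X[of 0 y] True by simp
next
  case False
  have X: "y \<in> X" "v \<in> X" using assms by (auto simp: graph_def)
  define q where "q s = (\<lambda>\<zeta>. (1 / s) *\<^sub>R (T s y \<zeta> - y \<zeta>) - v \<zeta>)" for s
  show ?thesis
  proof (rule subadditive_bound[where \<psi> = "\<lambda>t. d (T t y) y" and \<phi> = "\<lambda>s. N (q s) + N v"])
    show "d (T (s + t) y) y \<le> d (T s y) y + d (T t y) y" if st: "s > 0" "t > 0" for s t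
    proof -
      have "d (T (s + t) y) y = d (T s (T t y)) y"
        using T_add[of s t y] st X unfolding eq_L2_def
        by (intro N_cong L2_diff T_X) (auto simp: eq_L2_def elim!: eventually_mono)
      also have "\<dots> \<le> d (T s (T t y)) (T s y) + d (T s y) y"
        using st X by (intro d_triangle T_X) auto
      also have "\<dots> \<le> d (T t y) y + d (T s y) y"
        using st X by (intro add_right_mono T_dist T_X) auto
      finally show ?thesis by simp
    qed
    show "d (T s y) y \<le> s * (N (q s) + N v)" if "s > 0" for s
    proof -
      have "N (\<lambda>\<zeta>. (1 / s) *\<^sub>R (T s y \<zeta> - y \<zeta>)) \<le> N v + N (q s)"
        unfolding q_def using that X by (intro N_diff_le L2_scaleR L2_diff T_X) auto
      then show ?thesis using that unfolding N_scaleR by (simp add: field_simps)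
    qed
    have "((\<lambda>s. N (q s) + N v) \<longlongrightarrow> 0 + N v) (at_right 0)"
      using assms(1) by (intro tendsto_intros) (auto simp: graph_def q_def)
    then show "((\<lambda>s. N (q s) + N v) \<longlongrightarrow> N v) (at_right 0)" by simp
  qed (use False assms in auto)
qed

text \<open>The distance between \<open>T t w\<close> and \<open>cis (\<omega> * t) *s w\<close> is
  subadditive in \<open>t\<close> and has rate 0 at time 0, hence vanishes. The orbit is thus a
  rotation of \<open>w\<close>.\<close>

lemma eigenvector_orbit:
  assumes "graph w (\<lambda>\<zeta>. (\<i> * of_real \<omega>) *s w \<zeta>)" "t \<ge> 0"
  shows "N (T t w) = N w"
proof (cases "t = 0")
  case True
  have "w \<in> X" using assms by (simp add: graph_def)
  then show ?thesis using True T_0 T_X[of 0 w] by (simp add: N_cong)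
next
  case False
  have X: "w \<in> X" using assms by (auto simp: graph_def)
  define q where "q s = (\<lambda>\<zeta>. (1 / s) *\<^sub>R (T s w \<zeta> - w \<zeta>) - (\<i> * of_real \<omega>) *s w \<zeta>)" for s
  \<comment> \<open>The error of the difference quotient of the scalar exponential at 0, as
    \<open>q s\<close> is the error for the orbit.\<close>
  define r where "r s = (cis (\<omega> * s) - 1) / of_real s - \<i> * of_real \<omega>" for s
  have "d (T t w) (\<lambda>\<zeta>. cis (\<omega> * t) *s w \<zeta>) \<le> t * 0"
  proof (rule subadditive_bound[where \<psi> = "\<lambda>t. d (T t w) (\<lambda>\<zeta>. cis (\<omega> * t) *s w \<zeta>)"
          and \<phi> = "\<lambda>s. N (q s) + cmod (r s) * N w"])
    show "d (T (s + t) w) (\<lambda>\<zeta>. cis (\<omega> * (s + t)) *s w \<zeta>) \<le>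
        d (T s w) (\<lambda>\<zeta>. cis (\<omega> * s) *s w \<zeta>) + d (T t w) (\<lambda>\<zeta>. cis (\<omega> * t) *s w \<zeta>)"
      if st: "s > 0" "t > 0" for s t
    proof -
      have cX: "(\<lambda>\<zeta>. c *s w \<zeta>) \<in> X" for c using X by (rule L2_scale)
      have "d (T (s + t) w) (\<lambda>\<zeta>. cis (\<omega> * (s + t)) *s w \<zeta>) = d (T s (T t w)) (\<lambda>\<zeta>. cis (\<omega> * (s + t)) *s w \<zeta>)"
        using T_add[of s t w] st X cX
        by (intro N_cong L2_diff T_X) (auto simp: eq_L2_def elim!: eventually_mono)
      also have "\<dots> \<le> d (T s (T t w)) (T s (\<lambda>\<zeta>. cis (\<omega> * t) *s w \<zeta>))
          + d (T s (\<lambda>\<zeta>. cis (\<omega> * t) *s w \<zeta>)) (\<lambda>\<zeta>. cis (\<omega> * (s + t)) *s w \<zeta>)"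
        using st X cX by (intro d_triangle T_X) auto
      also have "d (T s (T t w)) (T s (\<lambda>\<zeta>. cis (\<omega> * t) *s w \<zeta>)) \<le> d (T t w) (\<lambda>\<zeta>. cis (\<omega> * t) *s w \<zeta>)"
        using st X cX by (intro T_dist T_X) auto
      also have "d (T s (\<lambda>\<zeta>. cis (\<omega> * t) *s w \<zeta>)) (\<lambda>\<zeta>. cis (\<omega> * (s + t)) *s w \<zeta>) =
          N (\<lambda>\<zeta>. cis (\<omega> * t) *s (T s w \<zeta> - cis (\<omega> * s) *s w \<zeta>))"
      proof (rule N_cong)
        have "cis (\<omega> * (s + t)) = cis (\<omega> * t) * cis (\<omega> * s)" by (simp add: cis_mult algebra_simps)
        then show "eq_L2 a b (\<lambda>\<zeta>. T s (\<lambda>\<zeta>. cis (\<omega> * t) *s w \<zeta>) \<zeta> - cis (\<omega> * (s + t)) *s w \<zeta>)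
            (\<lambda>\<zeta>. cis (\<omega> * t) *s (T s w \<zeta> - cis (\<omega> * s) *s w \<zeta>))"
          using T_scale[of s w "cis (\<omega> * t)"] st X unfolding eq_L2_def
          by (auto elim!: eventually_mono simp: vec_eq_iff algebra_simps)
      qed (use st X cX in \<open>auto intro!: L2_diff L2_scale T_X\<close>)
      finally show ?thesis
        using N_scale[of "cis (\<omega> * t)" "\<lambda>\<zeta>. T s w \<zeta> - cis (\<omega> * s) *s w \<zeta>"] by simp
    qed
    show "d (T s w) (\<lambda>\<zeta>. cis (\<omega> * s) *s w \<zeta>) \<le> s * (N (q s) + cmod (r s) * N w)" if "s > 0" for s
    proof -
      \<comment> \<open>The term \<open>\<i> * \<omega>\<close> is subtracted in both errors and
        cancels, as do the terms \<open>w\<close> of the two quotients.\<close>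
      have "(\<lambda>\<zeta>. T s w \<zeta> - cis (\<omega> * s) *s w \<zeta>) = (\<lambda>\<zeta>. s *\<^sub>R (q s \<zeta> - r s *s w \<zeta>))"
        using that by (simp add: fun_eq_iff q_def r_def vec_eq_iff scaleR_conv_of_real[where 'a = complex] field_simps)
      then have "d (T s w) (\<lambda>\<zeta>. cis (\<omega> * s) *s w \<zeta>) = s * N (\<lambda>\<zeta>. q s \<zeta> - r s *s w \<zeta>)"
        using that by (simp add: N_scaleR)
      also have "\<dots> \<le> s * (N (q s) + N (\<lambda>\<zeta>. r s *s w \<zeta>))"
        using that X unfolding q_def by (intro mult_left_mono N_diff L2_scale quotient_X) auto
      finally show ?thesis by (simp add: N_scale)
    qed
    have "((\<lambda>s. N (q s) + cmod (r s) * N w) \<longlongrightarrow> 0 + 0 * N w) (at_right 0)"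
      using assms(1) cis_quotient by (intro tendsto_intros) (auto simp: graph_def q_def r_def)
    then show "((\<lambda>s. N (q s) + cmod (r s) * N w) \<longlongrightarrow> 0) (at_right 0)" by simp
  qed (use False assms in auto)
  then have "d (T t w) (\<lambda>\<zeta>. cis (\<omega> * t) *s w \<zeta>) = 0" by (simp add: order_antisym)
  then have "eq_L2 a b (T t w) (\<lambda>\<zeta>. cis (\<omega> * t) *s w \<zeta>)"
    using d_eq_0_iff X T_X assms(2) L2_scale by blast
  then have "N (T t w) = N (\<lambda>\<zeta>. cis (\<omega> * t) *s w \<zeta>)"
    using X T_X assms(2) L2_scale by (intro N_cong) auto
  then show ?thesis by (simp add: N_scale)
qed

text \<open>On such an orbit the error of the difference quotient is a scalar multiple of
  \<open>w\<close>, with the scalar tending to 0 by \<open>cis_quotient\<close>.\<close>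

lemma eigenvector_if_orbit:
  assumes X: "w \<in> X" and orbit: "\<And>t. t \<ge> 0 \<Longrightarrow> eq_L2 a b (T t w) (\<lambda>\<zeta>. cis (\<omega> * t) *s w \<zeta>)"
  shows "graph w (\<lambda>\<zeta>. (\<i> * of_real \<omega>) *s w \<zeta>)"
  unfolding graph_def
proof (intro conjI)
  show "(\<lambda>\<zeta>. (\<i> * of_real \<omega>) *s w \<zeta>) \<in> X" using X by (rule L2_scale)
  define r where "r s = (cis (\<omega> * s) - 1) / of_real s - \<i> * of_real \<omega>" for s
  have "N (\<lambda>\<zeta>. (1 / s) *\<^sub>R (T s w \<zeta> - w \<zeta>) - (\<i> * of_real \<omega>) *s w \<zeta>) = cmod (r s) * N w" if "s > 0" for s
  proof -
    have "N (\<lambda>\<zeta>. (1 / s) *\<^sub>R (T s w \<zeta> - w \<zeta>) - (\<i> * of_real \<omega>) *s w \<zeta>) = N (\<lambda>\<zeta>. r s *s w \<zeta>)"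
    proof (rule N_cong)
      show "eq_L2 a b (\<lambda>\<zeta>. (1 / s) *\<^sub>R (T s w \<zeta> - w \<zeta>) - (\<i> * of_real \<omega>) *s w \<zeta>) (\<lambda>\<zeta>. r s *s w \<zeta>)"
        using orbit[of s] that unfolding eq_L2_def
        by (auto elim!: eventually_mono simp: r_def vec_eq_iff scaleR_conv_of_real[where 'a = complex] field_simps)
    qed (use that X in \<open>auto intro!: quotient_X L2_scale\<close>)
    then show ?thesis by (simp add: N_scale)
  qed
  moreover have "((\<lambda>s. cmod (r s) * N w) \<longlongrightarrow> 0 * N w) (at_right 0)"
    unfolding r_def by (intro tendsto_intros cis_quotient)
  ultimately show "((\<lambda>s. N (\<lambda>\<zeta>. (1 / s) *\<^sub>R (T s w \<zeta> - w \<zeta>) - (\<i> * of_real \<omega>) *s w \<zeta>)) \<longlongrightarrow> 0) (at_right 0)"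
    by (simp, subst tendsto_cong) (auto simp: eventually_at_right_field intro!: exI[of _ 1])
qed (rule X)

end

section \<open>Approximate eigenvectors of an orbit that does not decay\<close>

context string_semigroup
begin

text \<open>The scalar identity holds at every point for each of the six components; weighting the
  components by the Hamiltonian and integrating gives the identity for the energy norm.\<close>

lemma Parseval_N:
  fixes M :: nat and u :: "nat \<Rightarrow> real \<Rightarrow> complex^6"
  assumes u: "\<And>n. n < M \<Longrightarrow> u n \<in> X"
  shows "(\<Sum>j<M. (N (\<lambda>\<zeta>. \<Sum>n<M. cis (- (2 * pi * real j / M * real n)) *s u n \<zeta>))\<^sup>2) = real M * (\<Sum>n<M. (N (u n))\<^sup>2)"
proof -
  define Y where "Y j = (\<lambda>\<zeta>. \<Sum>n<M. cis (- (2 * pi * real j / M * n)) *s u n \<zeta>)" for j :: nat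
  have YX: "Y j \<in> X" for j
    unfolding Y_def using u by (intro L2_sum L2_scale) auto
  have int: "integrable \<mu> (\<lambda>\<zeta>. (norm (wt (f \<zeta>)))\<^sup>2)" if "f \<in> X" for f
    using L2_wt[OF L2_measurable[OF that]] that by simp
  have pw: "(\<Sum>j<M. (norm (wt (Y j \<zeta>)))\<^sup>2) = real M * (\<Sum>n<M. (norm (wt (u n \<zeta>)))\<^sup>2)" for \<zeta>
  proof -
    have "(\<Sum>j<M. (norm (wt (Y j \<zeta>)))\<^sup>2) =
        (\<Sum>i\<in>UNIV. ham_diag \<rho> \<tau> $ i / 2 * (\<Sum>j<M. (cmod (Y j \<zeta> $ i))\<^sup>2))"
      unfolding norm_wt_sq sum_distrib_left by (rule sum.swap)
    also have "\<dots> = (\<Sum>i\<in>UNIV. ham_diag \<rho> \<tau> $ i / 2 * (M * (\<Sum>n<M. (cmod (u n \<zeta> $ i))\<^sup>2)))"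
      using Parseval_DFT by (simp add: Y_def)
    also have "\<dots> = M * (\<Sum>i\<in>UNIV. \<Sum>n<M. ham_diag \<rho> \<tau> $ i / 2 * (cmod (u n \<zeta> $ i))\<^sup>2)"
      by (simp add: sum_distrib_left mult_ac)
    also have "\<dots> = M * (\<Sum>n<M. (norm (wt (u n \<zeta>)))\<^sup>2)"
      unfolding norm_wt_sq by (subst sum.swap) simp
    finally show ?thesis .
  qed
  have "(\<Sum>j<M. (N (Y j))\<^sup>2) = (\<integral>\<zeta>. (\<Sum>j<M. (norm (wt (Y j \<zeta>)))\<^sup>2) \<partial>\<mu>)"
    unfolding N_sq using int[OF YX] by (subst Bochner_Integration.integral_sum) auto
  also have "\<dots> = real M * (\<Sum>n<M. (N (u n))\<^sup>2)"
    unfolding pw N_sq using int[OF u]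
    by (subst Bochner_Integration.integral_mult_right_zero, subst Bochner_Integration.integral_sum) auto
  finally show ?thesis by (simp add: Y_def)
qed

text \<open>\<open>Y j\<close> is a Fourier mode of the sampled orbit and \<open>V j\<close> its
  image under the generator. Averaging over the modes finds one that is large compared with both
  \<open>V j\<close> and its eigenvector defect \<open>D j\<close>; normalising it gives
  \<open>y\<close>.\<close>

lemma approximate_eigenvector:
  fixes M :: nat and h \<epsilon> :: real
  assumes "h > 0" "M > 0" and x: "x \<in> DA" "N x \<le> 1" "N (A x) \<le> 1"
    and "\<epsilon> > 0" and large: "N (T (M * h) x) \<ge> \<epsilon>"
  obtains y \<theta> where "y \<in> DA" "N y = 1" "N (A y) \<le> 2 / \<epsilon>" "\<bar>\<theta>\<bar> \<le> pi"
    "d (T h y) (\<lambda>\<zeta>. cis \<theta> *s y \<zeta>) \<le> 3 / (\<epsilon> * sqrt M)"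
proof -
  define u where "u n = T (real n * h) x" for n :: nat
  define v where "v n = T (real n * h) (A x)" for n :: nat
  define c where "c j n = cis (- (2 * pi * real j / M * real n))" for j n :: nat
  define Y where "Y j = (\<lambda>\<zeta>. \<Sum>n<M. c j n *s u n \<zeta>)" for j
  define V where "V j = (\<lambda>\<zeta>. \<Sum>n<M. c j n *s v n \<zeta>)" for j
  define D where "D j = d (T h (Y j)) (\<lambda>\<zeta>. cis (2 * pi * real j / M) *s Y j \<zeta>)" for j
  have xX: "x \<in> X" "A x \<in> X" using x dom_A_X op_A_X by auto
  have uX: "u n \<in> X" and vX: "v n \<in> X" for n
    using \<open>h > 0\<close> xX by (auto simp: u_def v_def intro!: T_X)
  have gr: "graph (u n) (v n)" for n
    unfolding u_def v_def using \<open>h > 0\<close> x by (intro graph_T graph_A) auto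
  have YV: "graph (Y j) (V j)" for j
    unfolding Y_def V_def using gr by (intro graph_sum) auto
  then have YX: "Y j \<in> X" and VX: "V j \<in> X" and YD: "Y j \<in> DA" and AY: "N (A (Y j)) = N (V j)" for j
    using graph_iff[of "Y j" "V j"] op_A_X by (auto simp: graph_def intro!: N_cong)
  have u1: "N (u n) \<le> 1" and v1: "N (v n) \<le> 1" for n
    using T_contraction[of "real n * h" x] T_contraction[of "real n * h" "A x"] \<open>h > 0\<close> x xX
    by (auto simp: u_def v_def)
  \<comment> \<open>Norms decrease along the orbit, so the lower bound at the final time holds at
    all earlier sampling times.\<close>
  have u_large: "N (u n) \<ge> \<epsilon>" if "n < M" for n
  proof -
    have "N (T (M * h) x) = N (T (real (M - n) * h) (u n))"
    proof (rule N_cong)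
      have "M * h = real (M - n) * h + real n * h" using that by (simp add: of_nat_diff algebra_simps)
      then show "eq_L2 a b (T (M * h) x) (T (real (M - n) * h) (u n))"
        using T_add[of "real (M - n) * h" "real n * h" x] \<open>h > 0\<close> xX by (simp add: u_def)
    qed (use \<open>h > 0\<close> xX uX in \<open>auto intro!: T_X\<close>)
    also have "\<dots> \<le> N (u n)" using \<open>h > 0\<close> uX by (intro T_contraction) auto
    finally show ?thesis using large by simp
  qed
  have sumY: "(\<Sum>j<M. (N (Y j))\<^sup>2) \<ge> (real M)\<^sup>2 * \<epsilon>\<^sup>2"
  proof -
    have "(\<Sum>n<M. (N (u n))\<^sup>2) \<ge> (\<Sum>n<M. \<epsilon>\<^sup>2)"
      using u_large \<open>\<epsilon> > 0\<close> by (intro sum_mono power_mono) auto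
    then show ?thesis
      using Parseval_N[of M u] uX mult_left_mono[of "real M * \<epsilon>\<^sup>2" _ "real M"]
      by (simp add: Y_def c_def power2_eq_square mult.assoc)
  qed
  have sumV: "(\<Sum>j<M. (N (V j))\<^sup>2) \<le> (real M)\<^sup>2"
  proof -
    have "(\<Sum>n<M. (N (v n))\<^sup>2) \<le> (\<Sum>n<M. 1)"
      using v1 by (intro sum_mono power_le_one) auto
    then show ?thesis
      using Parseval_N[of M v] vX mult_left_mono[of _ "real M" "real M"]
      by (simp add: V_def c_def power2_eq_square)
  qed
  \<comment> \<open>Applying \<open>T h\<close> shifts the samples by one, which costs the factor
    \<open>z\<close> up to boundary terms. The weights have period \<open>M\<close>, so only
    \<open>u M - u 0\<close> remains, and its norm is at most 2 whatever \<open>M\<close>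
    is.\<close>
  have D2: "D j \<le> 2" for j
  proof -
    define z where "z = cis (2 * pi * real j / M)"
    have step: "c j n = z * c j (Suc n)" for n
    proof -
      have "- (\<alpha> * real n) = \<alpha> + - (\<alpha> * real (Suc n))" for \<alpha> by (simp add: algebra_simps)
      then show ?thesis unfolding c_def z_def cis_mult by metis
    qed
    have "c j M = cis (- (2 * pi * of_int (int j)))" using \<open>M > 0\<close> by (simp add: c_def)
    also have "\<dots> = 1" using cis_multiple_2pi[of "- of_int (int j)"] by simp
    finally have cM: "c j M = 1" .
    have c0: "c j 0 = 1" by (simp add: c_def)
    \<comment> \<open>Shifting the weight index extracts \<open>z\<close>; the remaining difference
      of sums telescopes, with weight 1 at both ends.\<close>
    have tel: "(\<Sum>n<M. c j n *s w (Suc n)) - z *s (\<Sum>n<M. c j n *s w n) = z *s (w M - w 0)"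
      for w :: "nat \<Rightarrow> complex^6"
    proof -
      have "(\<Sum>n<M. c j n *s w (Suc n)) = z *s (\<Sum>n<M. c j (Suc n) *s w (Suc n))"
        by (subst step) (simp add: vec_eq_iff sum_distrib_left mult.assoc)
      moreover have "(\<Sum>n<M. c j (Suc n) *s w (Suc n)) - (\<Sum>n<M. c j n *s w n) = c j M *s w M - c j 0 *s w 0"
        unfolding sum_subtractf[symmetric] by (rule sum_lessThan_telescope)
      ultimately show ?thesis
        using cM c0 by (simp flip: vector_ssub_ldistrib)
    qed
    have e1: "eq_L2 a b (T h (Y j)) (\<lambda>\<zeta>. \<Sum>n<M. c j n *s T h (u n) \<zeta>)"
      unfolding Y_def using \<open>h > 0\<close> uX by (intro T_sum) auto
    have "eq_L2 a b (T h (u n)) (u (Suc n))" for n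
      using T_add[of h "real n * h" x] \<open>h > 0\<close> xX unfolding u_def
      by (simp add: algebra_simps eq_L2_sym)
    then have "AE \<zeta> in \<mu>. \<forall>n\<in>{..<M}. T h (u n) \<zeta> = u (Suc n) \<zeta>"
      by (intro AE_ball_countable[THEN iffD2]) (auto simp: eq_L2_def)
    then have e2: "eq_L2 a b (\<lambda>\<zeta>. T h (Y j) \<zeta> - z *s Y j \<zeta>) (\<lambda>\<zeta>. z *s (u M \<zeta> - u 0 \<zeta>))"
      using e1 unfolding eq_L2_def
    proof eventually_elim
      case (elim \<zeta>)
      have "T h (Y j) \<zeta> = (\<Sum>n<M. c j n *s u (Suc n) \<zeta>)" using elim by simp
      then show ?case using tel[of "\<lambda>n. u n \<zeta>"] by (simp add: Y_def)
    qed
    have "D j = N (\<lambda>\<zeta>. z *s (u M \<zeta> - u 0 \<zeta>))"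
      unfolding D_def z_def[symmetric] using e2 \<open>h > 0\<close> YX uX
      by (intro N_cong L2_diff L2_scale T_X) auto
    also have "\<dots> = N (\<lambda>\<zeta>. u M \<zeta> - u 0 \<zeta>)"
      using N_scale[of z "\<lambda>\<zeta>. u M \<zeta> - u 0 \<zeta>"] by (simp add: z_def)
    also have "\<dots> \<le> N (u M) + N (u 0)" using uX by (intro N_diff)
    finally show ?thesis using u1[of M] u1[of 0] by simp
  qed
  \<comment> \<open>The weights are such that, summed over \<open>j\<close>, the two terms on the
    left contribute at most \<open>M\<^sup>2\<close> each, while the right side is at least
    \<open>2 * M\<^sup>2\<close>.\<close>
  have "\<exists>j<M. N (Y j) \<noteq> 0 \<and> (N (V j))\<^sup>2 + M / 4 * (D j)\<^sup>2 \<le> 2 / \<epsilon>\<^sup>2 * (N (Y j))\<^sup>2"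
  proof (rule ccontr)
    assume no: "\<not> ?thesis"
    define f where "f j = (N (V j))\<^sup>2 + M / 4 * (D j)\<^sup>2 - 2 / \<epsilon>\<^sup>2 * (N (Y j))\<^sup>2" for j
    have f0: "f j \<ge> 0" and f1: "N (Y j) \<noteq> 0 \<Longrightarrow> f j > 0" if "j < M" for j
      using no that by (cases "N (Y j) = 0"; force simp: f_def)+
    have "(\<Sum>j<M. f j) \<le> 0"
    proof -
      have "(\<Sum>j<M. (D j)\<^sup>2) \<le> (\<Sum>j<M. 2\<^sup>2)"
        using D2 by (intro sum_mono power_mono) (auto simp: D_def)
      then have "M / 4 * (\<Sum>j<M. (D j)\<^sup>2) \<le> M / 4 * (real M * 4)"
        by (intro mult_left_mono) auto
      moreover have sum_f: "(\<Sum>j<M. f j) = (\<Sum>j<M. (N (V j))\<^sup>2) + M / 4 * (\<Sum>j<M. (D j)\<^sup>2)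
          - 2 / \<epsilon>\<^sup>2 * (\<Sum>j<M. (N (Y j))\<^sup>2)"
        by (simp add: f_def sum.distrib sum_subtractf sum_distrib_left)
      moreover have M2: "2 / \<epsilon>\<^sup>2 * ((real M)\<^sup>2 * \<epsilon>\<^sup>2) = 2 * (real M)\<^sup>2"
        using \<open>\<epsilon> > 0\<close> by simp
      moreover have "2 / \<epsilon>\<^sup>2 * (\<Sum>j<M. (N (Y j))\<^sup>2) \<ge> 2 / \<epsilon>\<^sup>2 * ((real M)\<^sup>2 * \<epsilon>\<^sup>2)"
        using sumY by (intro mult_left_mono) auto
      ultimately show ?thesis
        using sumV sum_f M2 by (simp add: power2_eq_square)
    qed
    \<comment> \<open>Nonnegative terms with a sum at most 0 all vanish. This excludes any mode with
      \<open>N (Y j) \<noteq> 0\<close>, against the positive lower bound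
      \<open>sumY\<close>.\<close>
    then have "f j = 0" if "j < M" for j
      using f0 that sum_nonneg_eq_0_iff[of "{..<M}" f] sum_nonneg[of "{..<M}" f] by force
    then have "N (Y j) = 0" if "j < M" for j using f1 that by force
    then have "(\<Sum>j<M. (N (Y j))\<^sup>2) = 0" by simp
    moreover have "(real M)\<^sup>2 * \<epsilon>\<^sup>2 > 0" using \<open>M > 0\<close> \<open>\<epsilon> > 0\<close> by simp
    ultimately show False using sumY by linarith
  qed
  then obtain j where j: "N (Y j) \<noteq> 0" "(N (V j))\<^sup>2 + M / 4 * (D j)\<^sup>2 \<le> 2 / \<epsilon>\<^sup>2 * (N (Y j))\<^sup>2"
    by blast
  define n where "n = N (Y j)"
  have n: "n > 0" using j(1) N_nonneg[of "Y j"] unfolding n_def by linarith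
  have Vn: "N (V j) \<le> 2 / \<epsilon> * n"
  proof (rule power2_le_imp_le)
    have "(N (V j))\<^sup>2 \<le> 2 / \<epsilon>\<^sup>2 * n\<^sup>2"
    proof -
      have "0 \<le> M / 4 * (D j)\<^sup>2" by simp
      then show ?thesis using j(2) unfolding n_def by linarith
    qed
    \<comment> \<open>The constant is rounded up to a square, and likewise from 8 to 9 in the bound
      for \<open>D j\<close>, to give clean factors after taking roots.\<close>
    also have "\<dots> \<le> 4 / \<epsilon>\<^sup>2 * n\<^sup>2" by (intro mult_right_mono divide_right_mono) auto
    finally show "(N (V j))\<^sup>2 \<le> (2 / \<epsilon> * n)\<^sup>2" by (simp add: power_mult_distrib power_divide)
  qed (use n \<open>\<epsilon> > 0\<close> in simp)
  have Dn: "D j \<le> 3 / (\<epsilon> * sqrt M) * n"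
  proof (rule power2_le_imp_le)
    have "M / 4 * (D j)\<^sup>2 \<le> 2 / \<epsilon>\<^sup>2 * n\<^sup>2"
      using j(2) zero_le_power2[of "N (V j)"] unfolding n_def by linarith
    then have "(D j)\<^sup>2 \<le> 8 / (\<epsilon>\<^sup>2 * M) * n\<^sup>2"
      using \<open>M > 0\<close> \<open>\<epsilon> > 0\<close> by (simp add: field_simps)
    also have "\<dots> \<le> 9 / (\<epsilon>\<^sup>2 * M) * n\<^sup>2" by (intro mult_right_mono divide_right_mono) auto
    finally show "(D j)\<^sup>2 \<le> (3 / (\<epsilon> * sqrt M) * n)\<^sup>2"
      by (simp add: power_mult_distrib power_divide)
  qed (use n \<open>\<epsilon> > 0\<close> in simp)
  define y where "y = (\<lambda>\<zeta>. of_real (1 / n) *s Y j \<zeta>)"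
  \<comment> \<open>The principal argument puts the phase into the range required by
    \<open>cis_minus_1_ge\<close>.\<close>
  define \<theta> where "\<theta> = Arg (cis (2 * pi * real j / M))"
  have \<theta>: "\<bar>\<theta>\<bar> \<le> pi" "cis \<theta> = cis (2 * pi * real j / M)"
    using Arg_bounded[of "cis (2 * pi * real j / M)"] cis_Arg[of "cis (2 * pi * real j / M)"]
    by (auto simp: \<theta>_def sgn_div_norm)
  have "graph (\<lambda>\<zeta>. of_real (1 / n) *s Y j \<zeta> + 0 *s Y j \<zeta>) (\<lambda>\<zeta>. of_real (1 / n) *s V j \<zeta> + 0 *s V j \<zeta>)"
    using YV by (intro graph_linear)
  then have gy: "graph y (\<lambda>\<zeta>. of_real (1 / n) *s V j \<zeta>)" by (simp add: y_def)
  have yD: "y \<in> DA" using gy by (simp add: graph_iff)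
  have "N (A y) = N (\<lambda>\<zeta>. of_real (1 / n) *s V j \<zeta>)"
    using gy VX yD by (intro N_cong op_A_X L2_scale) (auto simp: graph_iff)
  then have "N (A y) = N (V j) / n" using n by (simp add: N_scale norm_divide)
  then have Ay: "N (A y) \<le> 2 / \<epsilon>" using Vn n by (simp add: divide_le_eq)
  have y1: "N y = 1" using n by (simp add: y_def N_scale norm_divide n_def[symmetric])
  have "d (T h y) (\<lambda>\<zeta>. cis \<theta> *s y \<zeta>) = N (\<lambda>\<zeta>. of_real (1 / n) *s (T h (Y j) \<zeta> - cis \<theta> *s Y j \<zeta>))"
  proof (rule N_cong)
    show "eq_L2 a b (\<lambda>\<zeta>. T h y \<zeta> - cis \<theta> *s y \<zeta>) (\<lambda>\<zeta>. of_real (1 / n) *s (T h (Y j) \<zeta> - cis \<theta> *s Y j \<zeta>))"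
      using T_scale[of h "Y j" "of_real (1 / n)"] \<open>h > 0\<close> YX unfolding eq_L2_def y_def
      by (auto elim!: eventually_mono simp: vec_eq_iff algebra_simps)
  qed (use \<open>h > 0\<close> YX in \<open>auto simp: y_def intro!: L2_diff L2_scale T_X\<close>)
  also have "\<dots> = D j / n"
    using n N_scale[of "of_real (1 / n)" "\<lambda>\<zeta>. T h (Y j) \<zeta> - cis \<theta> *s Y j \<zeta>"]
    by (simp add: D_def \<theta>(2) norm_divide)
  finally have "d (T h y) (\<lambda>\<zeta>. cis \<theta> *s y \<zeta>) \<le> 3 / (\<epsilon> * sqrt M)"
    using Dn n by (simp add: divide_le_eq)
  then show ?thesis using that yD y1 Ay \<theta>(1) by blast
qed

text \<open>As decay function take the best constant at each time. Contractivity makes the orbit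
  norms nonincreasing, so smallness reached at a single time \<open>t0\<close> persists for all
  \<open>t \<ge> t0\<close>.\<close>

lemma stable_if_uniformly_small:
  assumes small: "\<And>\<epsilon>. \<epsilon> > 0 \<Longrightarrow> \<exists>t\<ge>0. \<forall>x\<in>DA. N (T t x) \<le> \<epsilon> * graph_norm_A a b \<rho> \<tau> x"
  shows "semi_uniformly_stable a b \<beta> \<rho> \<tau> T"
proof -
  define G where "G = graph_norm_A a b \<rho> \<tau>"
  have G0: "G x \<ge> 0" for x by (simp add: G_def graph_norm_A_def)
  define E where "E t = {e. e \<ge> 0 \<and> (\<forall>x\<in>DA. N (T t x) \<le> e * G x)}" for t
  have bdd: "bdd_below (E t)" for t by (rule bdd_belowI[of _ 0]) (simp add: E_def)
  have E1: "1 \<in> E t" if "t \<ge> 0" for t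
    unfolding E_def G_def graph_norm_A_def
    using T_contraction[OF that dom_A_X] by (auto intro: add_increasing2)
  define f where "f t = Inf (E t)" for t
  have f0: "f t \<ge> 0" if "t \<ge> 0" for t
    unfolding f_def
  proof (rule cInf_greatest)
    show "E t \<noteq> {}" using E1[OF that] by blast
  qed (simp add: E_def)
  have bound: "N (T t x) \<le> f t * G x" if "t \<ge> 0" "x \<in> DA" for t x
  proof (cases "G x = 0")
    \<comment> \<open>Division by \<open>G x\<close> is impossible here; the admissible constant 1
      already gives \<open>N (T t x) \<le> 0\<close>.\<close>
    case True
    then show ?thesis using E1[OF that(1)] that(2) by (auto simp: E_def)
  next
    case False
    then have G: "G x > 0" using G0[of x] by simp
    have "N (T t x) / G x \<le> f t"
      unfolding f_def
    proof (rule cInf_greatest)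
      show "E t \<noteq> {}" using E1[OF that(1)] by blast
    qed (use that(2) G in \<open>auto simp: E_def divide_le_eq\<close>)
    then show ?thesis using G by (simp add: divide_le_eq)
  qed
  have "(f \<longlongrightarrow> 0) at_top"
  proof (rule tendstoI)
    fix e :: real assume "e > 0"
    then obtain t0 where t0: "t0 \<ge> 0" "\<And>x. x \<in> DA \<Longrightarrow> N (T t0 x) \<le> e / 2 * G x"
      using small[of "e / 2"] unfolding G_def by auto
    have "dist (f t) 0 < e" if "t \<ge> t0" for t
    proof -
      have "N (T t x) \<le> e / 2 * G x" if x: "x \<in> DA" for x
      proof -
        have X: "x \<in> X" using x by (rule dom_A_X)
        have "N (T t x) = N (T (t - t0) (T t0 x))"
          using T_add[of "t - t0" t0 x] X t0(1) \<open>t \<ge> t0\<close> by (intro N_cong T_X) auto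
        also have "\<dots> \<le> N (T t0 x)" using X t0(1) \<open>t \<ge> t0\<close> by (intro T_contraction T_X) auto
        finally show ?thesis using t0(2)[OF x] by linarith
      qed
      then have "e / 2 \<in> E t" using \<open>e > 0\<close> by (simp add: E_def)
      then have "f t \<le> e / 2" unfolding f_def using bdd by (rule cInf_lower)
      then show ?thesis using f0[of t] that t0(1) \<open>e > 0\<close> by simp
    qed
    then show "\<forall>\<^sub>F t in at_top. dist (f t) 0 < e" using eventually_at_top_linorder by blast
  qed
  then show ?thesis
    using f0 bound unfolding semi_uniformly_stable_def G_def by blast
qed

text \<open>Approximate eigenvectors for steps \<open>1 / k\<close> have bounded graph norms and
  bounded frequencies, so a subsequence converges in both. The errors accumulated over any fixed
  time tend to 0, and the limit has an exactly rotating orbit.\<close>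

lemma eigenvector_if_not_stable:
  assumes "\<not> semi_uniformly_stable a b \<beta> \<rho> \<tau> T"
  obtains w \<omega> where "graph w (\<lambda>\<zeta>. (\<i> * of_real \<omega>) *s w \<zeta>)" "N w = 1"
proof -
  obtain \<epsilon> where "\<epsilon> > 0" and
    large: "\<And>t. t \<ge> 0 \<Longrightarrow> \<exists>x\<in>DA. N (T t x) > \<epsilon> * graph_norm_A a b \<rho> \<tau> x"
    using stable_if_uniformly_small assms by (meson not_le)
  \<comment> \<open>Normalisation by the graph norm, which is positive: a vector with
    \<open>N x = 0\<close> cannot satisfy the strict inequality of \<open>large\<close>.\<close>
  have unit: "\<exists>x\<in>DA. N x \<le> 1 \<and> N (A x) \<le> 1 \<and> N (T t x) \<ge> \<epsilon>" if t: "t \<ge> 0" for t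
  proof -
    obtain x where x: "x \<in> DA" "N (T t x) > \<epsilon> * graph_norm_A a b \<rho> \<tau> x" using large[OF t] by blast
    define g where "g = graph_norm_A a b \<rho> \<tau> x"
    have X: "x \<in> X" "A x \<in> X" using x dom_A_X op_A_X by auto
    have "N x \<noteq> 0"
    proof
      assume "N x = 0"
      then have "N (T t x) \<le> 0" using T_contraction[OF t X(1)] by simp
      moreover have "\<epsilon> * graph_norm_A a b \<rho> \<tau> x \<ge> 0"
        using \<open>\<epsilon> > 0\<close> by (simp add: graph_norm_A_def)
      ultimately show False using x(2) by linarith
    qed
    then have "N x > 0" using N_nonneg[of x] by linarith
    then have g: "g > 0" "N x \<le> g" "N (A x) \<le> g"
      by (auto simp: g_def graph_norm_A_def add_pos_nonneg)
    define y where "y = (\<lambda>\<zeta>. of_real (1 / g) *s x \<zeta>)"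
    have "graph (\<lambda>\<zeta>. of_real (1 / g) *s x \<zeta> + 0 *s x \<zeta>) (\<lambda>\<zeta>. of_real (1 / g) *s A x \<zeta> + 0 *s A x \<zeta>)"
      using x graph_A by (intro graph_linear) auto
    then have gy: "graph y (\<lambda>\<zeta>. of_real (1 / g) *s A x \<zeta>)" by (simp add: y_def)
    then have "N (A y) = N (\<lambda>\<zeta>. of_real (1 / g) *s A x \<zeta>)"
      by (intro N_cong op_A_X) (auto simp: graph_iff)
    then have "N (A y) \<le> 1" using g by (simp add: N_scale norm_divide)
    moreover have "N y \<le> 1" using g by (simp add: y_def N_scale norm_divide)
    moreover have "N (T t y) = N (\<lambda>\<zeta>. of_real (1 / g) *s T t x \<zeta>)"
      unfolding y_def using t X by (intro N_cong T_X L2_scale T_scale)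
    then have "N (T t y) \<ge> \<epsilon>" using g x(2) by (simp add: N_scale norm_divide le_divide_eq g_def)
    ultimately show ?thesis using gy by (auto simp: graph_iff)
  qed
  define k where "k m = real (Suc m)" for m
  have k: "k m > 0" "k m \<ge> 1" for m by (simp_all add: k_def)
  define K where "K = 2 / \<epsilon>"
  have K: "K > 0" using \<open>\<epsilon> > 0\<close> by (simp add: K_def)
  define P where "P m y \<theta> \<longleftrightarrow> y \<in> DA \<and> N y = 1 \<and> N (A y) \<le> K \<and> \<bar>\<theta>\<bar> \<le> pi \<and>
      d (T (1 / k m) y) (\<lambda>\<zeta>. cis \<theta> *s y \<zeta>) \<le> 2 * K / (k m)\<^sup>2" for m y \<theta>
  have "\<exists>y \<theta>. P m y \<theta>" for m
  proof -
    \<comment> \<open>The fourth power makes \<open>sqrt M = (k m)\<^sup>2\<close>. A single step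
      \<open>1 / k m\<close> then has a defect of order \<open>1 / (k m)\<^sup>2\<close>, so that
      about \<open>t * k m\<close> steps accumulate only an error of order
      \<open>t / k m\<close>.\<close>
    define M where "M = Suc m ^ 4"
    have M: "real M = (k m) ^ 4" "M > 0" by (simp_all add: M_def k_def)
    have sq: "sqrt M = (k m)\<^sup>2"
      unfolding M by (rule real_sqrt_unique) (simp_all flip: power_mult)
    obtain x where x: "x \<in> DA" "N x \<le> 1" "N (A x) \<le> 1" "N (T (real M * (1 / k m)) x) \<ge> \<epsilon>"
      using unit[of "real M * (1 / k m)"] k(1)[of m] by auto
    obtain y \<theta> where y: "y \<in> DA" "N y = 1" "N (A y) \<le> K" "\<bar>\<theta>\<bar> \<le> pi"
      "d (T (1 / k m) y) (\<lambda>\<zeta>. cis \<theta> *s y \<zeta>) \<le> 3 / (\<epsilon> * sqrt M)"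
      using approximate_eigenvector[of "1 / k m" M x \<epsilon>] x k(1)[of m] M(2) \<open>\<epsilon> > 0\<close>
      unfolding K_def by auto
    \<comment> \<open>Indeed \<open>2 * K = 4 / \<epsilon>\<close>, which leaves room for the
      constant 3.\<close>
    moreover have "3 / (\<epsilon> * sqrt M) \<le> 2 * K / (k m)\<^sup>2"
      using \<open>\<epsilon> > 0\<close> k(1)[of m] unfolding sq K_def by (simp add: field_simps)
    ultimately show ?thesis unfolding P_def by (meson order_trans)
  qed
  then obtain y \<theta> where "\<And>m. P m (y m) (\<theta> m)" by metis
  then have y: "\<And>m. y m \<in> DA" "\<And>m. N (y m) = 1" "\<And>m. N (A (y m)) \<le> K"
    and \<theta>: "\<And>m. \<bar>\<theta> m\<bar> \<le> pi"
    and defect: "\<And>m. d (T (1 / k m) (y m)) (\<lambda>\<zeta>. cis (\<theta> m) *s y m \<zeta>) \<le> 2 * K / (k m)\<^sup>2"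
    by (simp_all add: P_def)
  have yX: "y m \<in> X" for m using y(1) by (rule dom_A_X)
  have cX: "(\<lambda>\<zeta>. c *s y m \<zeta>) \<in> X" for c m using yX by (rule L2_scale)
  have Lip: "d (T t (y m)) (y m) \<le> t * K" if "t \<ge> 0" for t m
    using orbit_Lipschitz[OF graph_A[OF y(1)] that, of m] mult_left_mono[OF y(3) that, of m] by linarith
  \<comment> \<open>\<open>\<theta> m\<close> is the phase gained in one step of length
    \<open>1 / k m\<close>, so this is the frequency per unit time.\<close>
  define \<omega> where "\<omega> m = \<theta> m * k m" for m
  \<comment> \<open>In one step the vector moves by at most \<open>K / k m\<close>. Together with
    the defect this bounds the rotation \<open>cis (\<theta> m) - 1\<close> by
    \<open>3 * K / k m\<close>, and \<open>cis_minus_1_ge\<close> passes to the phase.\<close>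
  have "\<bar>\<omega> m\<bar> \<le> 6 * K" for m
  proof -
    have "\<bar>\<theta> m\<bar> / 2 \<le> cmod (cis (\<theta> m) - 1)" using \<theta> by (rule cis_minus_1_ge)
    also have "\<dots> = d (\<lambda>\<zeta>. cis (\<theta> m) *s y m \<zeta>) (y m)"
      using N_scale[of "cis (\<theta> m) - 1" "y m"] y(2)[of m] by (simp add: vector_sub_rdistrib)
    also have "\<dots> \<le> d (\<lambda>\<zeta>. cis (\<theta> m) *s y m \<zeta>) (T (1 / k m) (y m)) + d (T (1 / k m) (y m)) (y m)"
      using yX cX k(1)[of m] by (intro d_triangle T_X) auto
    also have "\<dots> \<le> 2 * K / (k m)\<^sup>2 + 1 / k m * K"
      using defect[of m] Lip[of "1 / k m" m] k(1)[of m]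
        d_commute[of "\<lambda>\<zeta>. cis (\<theta> m) *s y m \<zeta>" "T (1 / k m) (y m)"] by simp
    also have "\<dots> \<le> 2 * K / k m + 1 / k m * K"
      using K k[of m] by (intro add_right_mono divide_left_mono) (auto simp: power2_eq_square)
    finally show ?thesis
      using k(1)[of m] by (simp add: \<omega>_def abs_mult field_simps)
  qed
  then have "bounded (range \<omega>)" by (auto simp: bounded_iff)
  obtain r w where r: "strict_mono (r :: nat \<Rightarrow> nat)" and w: "w \<in> X" and lim: "(\<lambda>n. d (y (r n)) w) \<longlonglongrightarrow> 0"
  proof (rule compact_domain[of y \<beta> "max 1 K"])
    show "N (y n) \<le> max 1 K" "N (A (y n)) \<le> max 1 K" for n
      using y(2)[of n] y(3)[of n] by auto
  qed (use y(1) in auto)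
  have "bounded (range (\<omega> \<circ> r))"
    using \<open>bounded (range \<omega>)\<close> by (rule bounded_subset) auto
  then obtain \<omega>0 q where q: "strict_mono (q :: nat \<Rightarrow> nat)" and lim_\<omega>: "(\<omega> \<circ> r \<circ> q) \<longlonglongrightarrow> \<omega>0"
    using bounded_imp_convergent_subsequence by blast
  define p where "p = r \<circ> q"
  have p: "strict_mono p" unfolding p_def using r q by (rule strict_mono_o)
  have lim_w: "(\<lambda>n. d (y (p n)) w) \<longlonglongrightarrow> 0"
    using LIMSEQ_subseq_LIMSEQ[OF lim q] by (simp add: p_def o_def)
  have lim_\<omega>p: "(\<lambda>n. \<omega> (p n)) \<longlonglongrightarrow> \<omega>0" using lim_\<omega> by (simp add: p_def o_def)
  have lim_k: "(\<lambda>n. C / k (p n)) \<longlonglongrightarrow> 0" for C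
    using LIMSEQ_subseq_LIMSEQ[OF LIMSEQ_Suc[OF lim_const_over_n[of C]] p] by (simp add: k_def o_def)
  \<comment> \<open>Convergence in norm preserves the normalisation, so the limit is not a null
    function.\<close>
  have Nw: "N w = 1"
  proof -
    have "\<bar>N w - 1\<bar> \<le> d (y (p n)) w" for n
      using N_diff_le[OF yX[of "p n"] w] N_diff_le[OF w yX[of "p n"]] y(2)[of "p n"]
        d_commute[of w "y (p n)"] by simp
    then have "\<bar>N w - 1\<bar> \<le> 0" using lim_w by (intro LIMSEQ_le_const[OF lim_w]) auto
    then show ?thesis by simp
  qed
  have "eq_L2 a b (T t w) (\<lambda>\<zeta>. cis (\<omega>0 * t) *s w \<zeta>)" if "t \<ge> 0" for t
  proof -
    have cwX: "(\<lambda>\<zeta>. c *s w \<zeta>) \<in> X" for c using w by (rule L2_scale)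
    \<comment> \<open>\<open>Q n\<close> is the number of whole steps that fit into
      \<open>[0, t]\<close>, and \<open>s n\<close> is the last grid time not after
      \<open>t\<close>.\<close>
    define Q where "Q n = nat \<lfloor>t * k (p n)\<rfloor>" for n
    define s where "s n = real (Q n) / k (p n)" for n
    have Q: "real (Q n) \<le> t * k (p n)" "t * k (p n) \<le> real (Q n) + 1" for n
      using that k(1)[of "p n"] by (simp_all add: Q_def of_nat_nat)
    have s: "0 \<le> s n" "s n \<le> t" "t - s n \<le> 1 / k (p n)" for n
    proof -
      have "t - s n = (t * k (p n) - real (Q n)) / k (p n)"
        using k(1)[of "p n"] by (simp add: s_def diff_divide_distrib)
      also have "\<dots> \<le> 1 / k (p n)"
        using Q(2)[of n] k(1)[of "p n"] by (intro divide_right_mono) auto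
      finally show "t - s n \<le> 1 / k (p n)" .
    qed (use Q(1)[of n] k(1)[of "p n"] in \<open>simp_all add: s_def divide_le_eq\<close>)
    \<comment> \<open>Neither \<open>T ?h\<close> nor a unimodular factor enlarges distances, so the
      defects of the single steps add up.\<close>
    have iter: "d (T (real j / k m) (y m)) (\<lambda>\<zeta>. cis (\<theta> m * j) *s y m \<zeta>) \<le> real j * (2 * K / (k m)\<^sup>2)" for j m
    proof (induction j)
      case 0
      then show ?case using T_0[OF yX, of m] d_eq_0_iff[OF T_X[OF _ yX] yX, of 0 m m] by simp
    next
      case (Suc j)
      let ?h = "1 / k m" and ?j = "real j / k m"
      have h: "?h \<ge> 0" "?j \<ge> 0" using k(1)[of m] by auto
      have "d (T (real (Suc j) / k m) (y m)) (\<lambda>\<zeta>. cis (\<theta> m * Suc j) *s y m \<zeta>) =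
          d (T ?h (T ?j (y m))) (\<lambda>\<zeta>. cis (\<theta> m * Suc j) *s y m \<zeta>)"
      proof (rule N_cong)
        have "real (Suc j) / k m = ?h + ?j" by (simp add: add_divide_distrib)
        then show "eq_L2 a b (\<lambda>\<zeta>. T (real (Suc j) / k m) (y m) \<zeta> - cis (\<theta> m * Suc j) *s y m \<zeta>)
            (\<lambda>\<zeta>. T ?h (T ?j (y m)) \<zeta> - cis (\<theta> m * Suc j) *s y m \<zeta>)"
          using T_add[OF h yX, of m] unfolding eq_L2_def by (auto elim!: eventually_mono)
        show "(\<lambda>\<zeta>. T (real (Suc j) / k m) (y m) \<zeta> - cis (\<theta> m * Suc j) *s y m \<zeta>) \<in> X"
          using k(1)[of m] by (intro L2_diff T_X yX cX) simp
        show "(\<lambda>\<zeta>. T ?h (T ?j (y m)) \<zeta> - cis (\<theta> m * Suc j) *s y m \<zeta>) \<in> X"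
          using h by (intro L2_diff T_X yX cX)
      qed
      also have "\<dots> \<le> d (T ?h (T ?j (y m))) (T ?h (\<lambda>\<zeta>. cis (\<theta> m * j) *s y m \<zeta>))
          + d (T ?h (\<lambda>\<zeta>. cis (\<theta> m * j) *s y m \<zeta>)) (\<lambda>\<zeta>. cis (\<theta> m * Suc j) *s y m \<zeta>)"
        using h by (intro d_triangle T_X yX cX)
      also have "d (T ?h (T ?j (y m))) (T ?h (\<lambda>\<zeta>. cis (\<theta> m * j) *s y m \<zeta>))
          \<le> d (T ?j (y m)) (\<lambda>\<zeta>. cis (\<theta> m * j) *s y m \<zeta>)"
        using h by (intro T_dist T_X yX cX)
      also have "d (T ?h (\<lambda>\<zeta>. cis (\<theta> m * j) *s y m \<zeta>)) (\<lambda>\<zeta>. cis (\<theta> m * Suc j) *s y m \<zeta>) =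
          N (\<lambda>\<zeta>. cis (\<theta> m * j) *s (T ?h (y m) \<zeta> - cis (\<theta> m) *s y m \<zeta>))"
      proof (rule N_cong)
        have "cis (\<theta> m * Suc j) = cis (\<theta> m * j) * cis (\<theta> m)" by (simp add: cis_mult algebra_simps)
        then show "eq_L2 a b (\<lambda>\<zeta>. T ?h (\<lambda>\<zeta>. cis (\<theta> m * j) *s y m \<zeta>) \<zeta> - cis (\<theta> m * Suc j) *s y m \<zeta>)
            (\<lambda>\<zeta>. cis (\<theta> m * j) *s (T ?h (y m) \<zeta> - cis (\<theta> m) *s y m \<zeta>))"
          using T_scale[OF h(1) yX, of "cis (\<theta> m * j)" m] unfolding eq_L2_def
          by (auto elim!: eventually_mono simp: vec_eq_iff algebra_simps)
      qed (use h in \<open>intro L2_diff L2_scale T_X yX cX; simp\<close>)+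
      also have "\<dots> = d (T ?h (y m)) (\<lambda>\<zeta>. cis (\<theta> m) *s y m \<zeta>)"
        using N_scale[of "cis (\<theta> m * j)" "\<lambda>\<zeta>. T ?h (y m) \<zeta> - cis (\<theta> m) *s y m \<zeta>"] by simp
      finally have "d (T (real (Suc j) / k m) (y m)) (\<lambda>\<zeta>. cis (\<theta> m * Suc j) *s y m \<zeta>)
          \<le> real j * (2 * K / (k m)\<^sup>2) + 2 * K / (k m)\<^sup>2"
        using Suc defect[of m] by linarith
      then show ?case by (simp only: of_nat_Suc distrib_right mult_1 add.commute)
    qed
    \<comment> \<open>In order: replace \<open>w\<close> by \<open>y (p n)\<close>; move from
      \<open>t\<close> to the grid time; turn the steps into a rotation; return from
      \<open>y (p n)\<close> to \<open>w\<close>; replace the approximate phase by its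
      limit.\<close>
    define R where "R n = d (y (p n)) w + (1 / k (p n) * K + (2 * t * K / k (p n)
      + (d (y (p n)) w + cmod (cis (\<omega> (p n) * s n) - cis (\<omega>0 * t)))))" for n
    have "d (T t w) (\<lambda>\<zeta>. cis (\<omega>0 * t) *s w \<zeta>) \<le> R n" for n
    proof -
      let ?y = "y (p n)" and ?c = "cis (\<omega> (p n) * s n)"
      have "d (T t w) (\<lambda>\<zeta>. cis (\<omega>0 * t) *s w \<zeta>) \<le> d (T t w) (T t ?y) + d (T t ?y) (\<lambda>\<zeta>. cis (\<omega>0 * t) *s w \<zeta>)"
        using that s[of n] by (intro d_triangle T_X yX cX cwX w)
      also have "d (T t w) (T t ?y) \<le> d ?y w"
        using T_dist[OF that w yX[of "p n"]] d_commute[of w ?y] by linarith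
      also have "d (T t ?y) (\<lambda>\<zeta>. cis (\<omega>0 * t) *s w \<zeta>) \<le> d (T t ?y) (T (s n) ?y) + d (T (s n) ?y) (\<lambda>\<zeta>. cis (\<omega>0 * t) *s w \<zeta>)"
        using that s[of n] by (intro d_triangle T_X yX cX cwX w)
      also have "d (T t ?y) (T (s n) ?y) \<le> 1 / k (p n) * K"
      proof -
        have "d (T t ?y) (T (s n) ?y) = d (T (s n) (T (t - s n) ?y)) (T (s n) ?y)"
          using T_add[of "s n" "t - s n" ?y] that s[of n] yX
          by (intro N_cong L2_diff T_X) (auto simp: eq_L2_def elim!: eventually_mono)
        also have "\<dots> \<le> d (T (t - s n) ?y) ?y"
          using that s[of n] by (intro T_dist T_X yX) auto
        also have "\<dots> \<le> (t - s n) * K" using s[of n] by (intro Lip) auto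
        also have "\<dots> \<le> 1 / k (p n) * K" using s(3)[of n] K by (intro mult_right_mono) auto
        finally show ?thesis .
      qed
      also have "d (T (s n) ?y) (\<lambda>\<zeta>. cis (\<omega>0 * t) *s w \<zeta>) \<le> d (T (s n) ?y) (\<lambda>\<zeta>. ?c *s ?y \<zeta>) + d (\<lambda>\<zeta>. ?c *s ?y \<zeta>) (\<lambda>\<zeta>. cis (\<omega>0 * t) *s w \<zeta>)"
        using that s[of n] by (intro d_triangle T_X yX cX cwX w)
      also have "d (T (s n) ?y) (\<lambda>\<zeta>. ?c *s ?y \<zeta>) \<le> 2 * t * K / k (p n)"
      proof -
        have "\<omega> (p n) * s n = \<theta> (p n) * real (Q n)"
          using k(1)[of "p n"] by (simp add: \<omega>_def s_def)
        then have "d (T (s n) ?y) (\<lambda>\<zeta>. ?c *s ?y \<zeta>) \<le> real (Q n) * (2 * K / (k (p n))\<^sup>2)"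
          using iter[of "Q n" "p n"] by (simp add: s_def)
        also have "\<dots> \<le> t * k (p n) * (2 * K / (k (p n))\<^sup>2)"
          using Q(1)[of n] K by (intro mult_right_mono) auto
        also have "\<dots> = 2 * t * K / k (p n)"
          using k(1)[of "p n"] by (simp add: power2_eq_square)
        finally show ?thesis .
      qed
      also have "d (\<lambda>\<zeta>. ?c *s ?y \<zeta>) (\<lambda>\<zeta>. cis (\<omega>0 * t) *s w \<zeta>) \<le> d (\<lambda>\<zeta>. ?c *s ?y \<zeta>) (\<lambda>\<zeta>. ?c *s w \<zeta>) + d (\<lambda>\<zeta>. ?c *s w \<zeta>) (\<lambda>\<zeta>. cis (\<omega>0 * t) *s w \<zeta>)"
        by (intro d_triangle cX cwX)
      also have "d (\<lambda>\<zeta>. ?c *s ?y \<zeta>) (\<lambda>\<zeta>. ?c *s w \<zeta>) = d ?y w"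
        using N_scale[of ?c "\<lambda>\<zeta>. ?y \<zeta> - w \<zeta>"] by (simp add: vector_ssub_ldistrib)
      also have "d (\<lambda>\<zeta>. ?c *s w \<zeta>) (\<lambda>\<zeta>. cis (\<omega>0 * t) *s w \<zeta>) = cmod (?c - cis (\<omega>0 * t))"
        using N_scale[of "?c - cis (\<omega>0 * t)" w] Nw by (simp add: vector_sub_rdistrib)
      finally show ?thesis by (simp add: R_def)
    qed
    moreover have "R \<longlonglongrightarrow> 0"
    proof -
      have "s \<longlonglongrightarrow> t"
      proof (rule real_tendsto_sandwich)
        show "(\<lambda>n. t - 1 / k (p n)) \<longlonglongrightarrow> t" using tendsto_diff[OF tendsto_const lim_k[of 1], of t] by simp
        show "(\<lambda>n. t) \<longlonglongrightarrow> t" by simp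
        show "\<forall>\<^sub>F n in sequentially. t - 1 / k (p n) \<le> s n" "\<forall>\<^sub>F n in sequentially. s n \<le> t"
          using s by (auto simp: algebra_simps intro!: always_eventually)
      qed
      then have "(\<lambda>n. cis (\<omega> (p n) * s n)) \<longlonglongrightarrow> cis (\<omega>0 * t)"
        using lim_\<omega>p by (intro tendsto_intros)
      then have "(\<lambda>n. cmod (cis (\<omega> (p n) * s n) - cis (\<omega>0 * t))) \<longlonglongrightarrow> 0"
        by (simp add: LIM_zero tendsto_norm_zero)
      moreover have "(\<lambda>n. 1 / k (p n) * K) \<longlonglongrightarrow> 0" using lim_k[of K] by simp
      ultimately have "R \<longlonglongrightarrow> 0 + (0 + (0 + (0 + 0)))"
        unfolding R_def using lim_w lim_k by (intro tendsto_add)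
      then show ?thesis by simp
    qed
    ultimately have "d (T t w) (\<lambda>\<zeta>. cis (\<omega>0 * t) *s w \<zeta>) \<le> 0"
      by (intro LIMSEQ_le_const) auto
    then have "d (T t w) (\<lambda>\<zeta>. cis (\<omega>0 * t) *s w \<zeta>) = 0" by (simp add: order_antisym)
    then show ?thesis using d_eq_0_iff T_X[OF that w] cwX by blast
  qed
  then show ?thesis using that[of w \<omega>0] eigenvector_if_orbit[OF w, of \<omega>0] Nw by blast
qed

end

section \<open>Eigenvalues on the imaginary axis\<close>

lemma sqrt_mult_div:
  fixes r t :: real
  assumes "r > 0" "t > 0"
  shows "sqrt (r * t) * sqrt (r / t) = r" "sqrt (r / t) / sqrt (r * t) = 1 / t"
proof -
  have r: "sqrt r * sqrt r = r" "sqrt r > 0" and t: "sqrt t * sqrt t = t" "sqrt t > 0"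
    using assms by simp_all
  show "sqrt (r * t) * sqrt (r / t) = r" "sqrt (r / t) / sqrt (r * t) = 1 / t"
    using r t by (simp_all add: real_sqrt_mult real_sqrt_divide field_simps)
qed

text \<open>With trigonometric factors of the remaining length \<open>y - \<zeta>\<close>, the
  combinations \<open>C * p + (\<i> / z) * S * q\<close> and \<open>\<i> * z * S * p + C * q\<close>
  have derivative 0. Their values at \<open>\<zeta> = y\<close>, where \<open>C = 1\<close> and
  \<open>S = 0\<close>, and at \<open>\<zeta> = a\<close> give the formulas, for any
  solution.\<close>

lemma string_ode_solution:
  fixes p q :: "real \<Rightarrow> complex" and r t \<omega> a b y :: real
  defines "c \<equiv> sqrt (r / t)" and "z \<equiv> sqrt (r * t)"
  assumes "r > 0" "t > 0" and y: "y \<in> {a..b}"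
    and p: "\<And>\<zeta>. \<zeta> \<in> {a..b} \<Longrightarrow> (p has_vector_derivative \<i> * of_real \<omega> * (q \<zeta> / of_real t)) (at \<zeta> within {a..b})"
    and q: "\<And>\<zeta>. \<zeta> \<in> {a..b} \<Longrightarrow> (q has_vector_derivative \<i> * of_real \<omega> * (of_real r * p \<zeta>)) (at \<zeta> within {a..b})"
  shows "p y = of_real (cos (\<omega> * c * (y - a))) * p a + \<i> / of_real z * of_real (sin (\<omega> * c * (y - a))) * q a"
    and "q y = \<i> * of_real z * of_real (sin (\<omega> * c * (y - a))) * p a + of_real (cos (\<omega> * c * (y - a))) * q a"
proof -
  have z: "z > 0" using assms by (simp add: z_def)
  have rt: "of_real r = (of_real z * of_real c :: complex)" "1 / of_real t = (of_real c / of_real z :: complex)"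
    using sqrt_mult_div[OF assms(3,4), THEN arg_cong[where f = complex_of_real]] by (simp_all add: c_def z_def)
  have p': "(p has_vector_derivative \<i> * of_real \<omega> * (of_real c / of_real z) * q \<zeta>) (at \<zeta> within {a..y})"
    if "\<zeta> \<in> {a..y}" for \<zeta>
    using has_vector_derivative_within_subset[OF p[of \<zeta>], of "{a..y}"] that y
    by (simp flip: rt(2))
  have q': "(q has_vector_derivative \<i> * of_real \<omega> * (of_real z * of_real c) * p \<zeta>) (at \<zeta> within {a..y})"
    if "\<zeta> \<in> {a..y}" for \<zeta>
    using has_vector_derivative_within_subset[OF q[of \<zeta>], of "{a..y}"] that y
    by (simp flip: rt(1) add: mult.assoc)
  define C S where "C \<zeta> = complex_of_real (cos (\<omega> * c * (y - \<zeta>)))"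
    and "S \<zeta> = complex_of_real (sin (\<omega> * c * (y - \<zeta>)))" for \<zeta>
  have C: "(C has_vector_derivative of_real (\<omega> * c) * S \<zeta>) (at \<zeta> within {a..y})" for \<zeta>
    unfolding C_def S_def by (rule has_vector_derivative_eq_rhs, rule has_vector_derivative_of_real)
     (auto intro!: derivative_eq_intros simp flip: has_real_derivative_iff_has_vector_derivative)
  have S: "(S has_vector_derivative - of_real (\<omega> * c) * C \<zeta>) (at \<zeta> within {a..y})" for \<zeta>
    unfolding C_def S_def by (rule has_vector_derivative_eq_rhs, rule has_vector_derivative_of_real)
     (auto intro!: derivative_eq_intros simp flip: has_real_derivative_iff_has_vector_derivative)
  have const: "f y = f a" if "\<And>\<zeta>. \<zeta> \<in> {a..y} \<Longrightarrow> (f has_vector_derivative 0) (at \<zeta> within {a..y})"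
    for f :: "real \<Rightarrow> complex"
    using has_vector_derivative_zero_constant[of "{a..y}" f] that y
    by (metis atLeastAtMost_iff convex_real_interval(5) order_refl)
  have "C y * p y + \<i> / of_real z * S y * q y = C a * p a + \<i> / of_real z * S a * q a"
  proof (rule const)
    show "((\<lambda>\<zeta>. C \<zeta> * p \<zeta> + \<i> / of_real z * S \<zeta> * q \<zeta>) has_vector_derivative 0) (at \<zeta> within {a..y})"
      if "\<zeta> \<in> {a..y}" for \<zeta>
      by (rule has_vector_derivative_eq_rhs[OF has_vector_derivative_add[OF
            has_vector_derivative_mult[OF C p'[OF that]]
            has_vector_derivative_mult[OF has_vector_derivative_mult[OF has_vector_derivative_const S]
              q'[OF that]]]])
        (use z in \<open>simp add: field_simps\<close>)
  qed
  then show "p y = of_real (cos (\<omega> * c * (y - a))) * p a + \<i> / of_real z * of_real (sin (\<omega> * c * (y - a))) * q a"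
    by (simp add: C_def S_def)
  have "\<i> * of_real z * S y * p y + C y * q y = \<i> * of_real z * S a * p a + C a * q a"
  proof (rule const)
    show "((\<lambda>\<zeta>. \<i> * of_real z * S \<zeta> * p \<zeta> + C \<zeta> * q \<zeta>) has_vector_derivative 0) (at \<zeta> within {a..y})"
      if "\<zeta> \<in> {a..y}" for \<zeta>
      by (rule has_vector_derivative_eq_rhs[OF has_vector_derivative_add[OF
            has_vector_derivative_mult[OF has_vector_derivative_mult[OF has_vector_derivative_const S]
              p'[OF that]]
            has_vector_derivative_mult[OF C q'[OF that]]]])
        (use z in \<open>simp add: field_simps\<close>)
  qed
  then show "q y = \<i> * of_real z * of_real (sin (\<omega> * c * (y - a))) * p a + of_real (cos (\<omega> * c * (y - a))) * q a"
    by (simp add: C_def S_def)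
qed

text \<open>Each column of \<open>\<Psi>\<close> solves the system of
  \<open>string_ode_solution\<close>, with a unit vector as initial value.\<close>

lemma fundamental_solution_first_row:
  assumes "a < b" "r > 0" "t > 0" and fs: "fundamental_solution a b r t \<omega> \<Psi>"
  shows "\<Psi> b $ 1 $ 1 = of_real (cos (\<omega> * sqrt (r / t) * (b - a)))"
    and "\<Psi> b $ 1 $ 2 = \<i> / of_real (sqrt (r * t)) * of_real (sin (\<omega> * sqrt (r / t) * (b - a)))"
proof -
  have lin: "bounded_linear (\<lambda>A::complex^2^2. A $ i $ j)" for i j
    using bounded_linear_compose[OF bounded_linear_vec_nth bounded_linear_vec_nth, of i j] .
  have der: "((\<lambda>\<zeta>. \<Psi> \<zeta> $ i $ j) has_vector_derivative (string_matrix r t \<omega> ** \<Psi> \<zeta>) $ i $ j) (at \<zeta> within {a..b})"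
    if "\<zeta> \<in> {a..b}" for \<zeta> i j
    using fs that unfolding fundamental_solution_def
    by (intro bounded_linear.has_vector_derivative[OF lin]) auto
  have row1: "(string_matrix r t \<omega> ** \<Psi> \<zeta>) $ 1 $ j = \<i> * of_real \<omega> * (\<Psi> \<zeta> $ 2 $ j / of_real t)"
    and row2: "(string_matrix r t \<omega> ** \<Psi> \<zeta>) $ 2 $ j = \<i> * of_real \<omega> * (of_real r * \<Psi> \<zeta> $ 1 $ j)" for \<zeta> j
    by (simp_all add: string_matrix_def matrix_matrix_mult_def sum_2)
  have init: "\<Psi> a = mat 1" using fs by (simp add: fundamental_solution_def)
  have "\<Psi> b $ 1 $ j = of_real (cos (\<omega> * sqrt (r / t) * (b - a))) * \<Psi> a $ 1 $ j
      + \<i> / of_real (sqrt (r * t)) * of_real (sin (\<omega> * sqrt (r / t) * (b - a))) * \<Psi> a $ 2 $ j" for j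
    using assms(1-3) der row1 row2
    by (intro string_ode_solution(1)[where b = b]) (metis atLeastAtMost_iff less_imp_le order_refl)+
  then show "\<Psi> b $ 1 $ 1 = of_real (cos (\<omega> * sqrt (r / t) * (b - a)))"
    and "\<Psi> b $ 1 $ 2 = \<i> / of_real (sqrt (r * t)) * of_real (sin (\<omega> * sqrt (r / t) * (b - a)))"
    by (simp_all add: init mat_def)
qed

section \<open>Resonant frequencies, boundary conditions and eigenvectors\<close>

context string_space
begin

text \<open>These are the numbers \<open>c\<close> of the theorem. With the impedance, the product
  is \<open>\<rho> k\<close> and the quotient \<open>wave_speed_inv k / impedance k\<close> is
  \<open>1 / \<tau> k\<close>.\<close>

definition wave_speed_inv :: "string_id \<Rightarrow> real" where
  "wave_speed_inv k = sqrt (\<rho> k / \<tau> k)"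

definition impedance :: "string_id \<Rightarrow> real" where
  "impedance k = sqrt (\<rho> k * \<tau> k)"

abbreviation "Sn \<omega> k y \<equiv> sin (\<omega> * wave_speed_inv k * (y - a))"
abbreviation "Cs \<omega> k y \<equiv> cos (\<omega> * wave_speed_inv k * (y - a))"

text \<open>Up to nonzero factors the three numbers are the entries of \<open>\<Psi>\<close> in the
  theorem, and vanishing of all pairwise products means that two of them are zero.\<close>

definition resonant :: "real \<Rightarrow> bool" where
  "resonant \<omega> \<longleftrightarrow> Sn \<omega> SI b = 0 \<and> Cs \<omega> SII b = 0 \<or> Sn \<omega> SI b = 0 \<and> Cs \<omega> SIII b = 0 \<or>
     Cs \<omega> SII b = 0 \<and> Cs \<omega> SIII b = 0"

lemma impedance_pos: "impedance k > 0"
  using rho_pos tau_pos by (simp add: impedance_def)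

lemma wave_speed_inv_pos: "wave_speed_inv k > 0"
  using rho_pos tau_pos by (simp add: wave_speed_inv_def)

text \<open>For \<open>v = Hx\<close> the equation \<open>A x = \<i> \<omega> x\<close> becomes
  \<open>v' = rhs \<omega> v\<close>, because \<open>P1\<close> is its own inverse.\<close>

definition rhs :: "real \<Rightarrow> complex^6 \<Rightarrow> complex^6" where
  "rhs \<omega> v = (\<i> * of_real \<omega>) *s (P1 *v Ham_inv v)"

lemma rhs_components:
  "rhs \<omega> v $ 1 = \<i> * of_real \<omega> * (v $ 2 / of_real (\<tau> SI))"
  "rhs \<omega> v $ 2 = \<i> * of_real \<omega> * (of_real (\<rho> SI) * v $ 1)"
  "rhs \<omega> v $ 3 = \<i> * of_real \<omega> * (v $ 4 / of_real (\<tau> SII))"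
  "rhs \<omega> v $ 4 = \<i> * of_real \<omega> * (of_real (\<rho> SII) * v $ 3)"
  "rhs \<omega> v $ 5 = \<i> * of_real \<omega> * (v $ 6 / of_real (\<tau> SIII))"
  "rhs \<omega> v $ 6 = \<i> * of_real \<omega> * (of_real (\<rho> SIII) * v $ 5)"
  by (simp_all add: rhs_def P1_mult Ham_inv_def ham_diag_def vector_6)

lemma bounded_linear_rhs: "bounded_linear (rhs \<omega>)"
proof -
  have "linear (rhs \<omega>)"
    by (intro linearI) (simp_all add: vec_eq_iff forall_6 rhs_components add_divide_distrib
        distrib_left scaleR_conv_of_real[where 'a = complex])
  then show ?thesis by (rule linear_conv_bounded_linear[THEN iffD1])
qed

lemma P1_rhs: "P1 *v rhs \<omega> v = (\<i> * of_real \<omega>) *s Ham_inv v"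
  by (simp add: rhs_def vec_eq_iff forall_6 P1_mult vector_6)

text \<open>The amplitudes are the values at \<open>a\<close> that the boundary conditions leave
  free, and \<open>v\<close> is the common velocity at \<open>b\<close>. An energy balance gives
  \<open>v = 0\<close>; without resonance two amplitudes then vanish, and the force balance removes
  the third, since sine and cosine have no common zero.\<close>

lemma boundary_conditions_trivial:
  fixes \<alpha>1 \<alpha>2 \<alpha>3 v :: complex
  assumes "\<beta> > 0"
    and 1: "\<i> / of_real (impedance SI) * of_real (Sn \<omega> SI b) * \<alpha>1 = v"
    and 2: "of_real (Cs \<omega> SII b) * \<alpha>2 = v" and 3: "of_real (Cs \<omega> SIII b) * \<alpha>3 = v"
    and balance: "of_real \<beta> * v + of_real (Cs \<omega> SI b) * \<alpha>1 + \<i> * of_real (impedance SII) * of_real (Sn \<omega> SII b) * \<alpha>2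
      + \<i> * of_real (impedance SIII) * of_real (Sn \<omega> SIII b) * \<alpha>3 = 0"
    and "\<not> resonant \<omega>"
  shows "\<alpha>1 = 0 \<and> \<alpha>2 = 0 \<and> \<alpha>3 = 0"
proof -
  define s1 c1 s2 c2 s3 c3 where "s1 = Sn \<omega> SI b" and "c1 = Cs \<omega> SI b" and "s2 = Sn \<omega> SII b"
    and "c2 = Cs \<omega> SII b" and "s3 = Sn \<omega> SIII b" and "c3 = Cs \<omega> SIII b"
  note defs = this
  have pyth: "s1\<^sup>2 + c1\<^sup>2 = 1" "s2\<^sup>2 + c2\<^sup>2 = 1" "s3\<^sup>2 + c3\<^sup>2 = 1"
    by (simp_all add: defs)
  note fold_defs = defs[symmetric]
  \<comment> \<open>Multiplied by \<open>cnj v\<close>, each string force is purely imaginary, so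
    only the damper contributes to the real part.\<close>
  have Re: "Re (cnj v * (of_real \<beta> * v + of_real c1 * \<alpha>1 + \<i> * of_real (impedance SII) * of_real s2 * \<alpha>2
      + \<i> * of_real (impedance SIII) * of_real s3 * \<alpha>3)) = \<beta> * (cmod v)\<^sup>2"
  proof -
    have "Re (cnj v * (of_real c1 * \<alpha>1)) = 0"
      unfolding 1[symmetric] fold_defs by (simp add: algebra_simps)
    moreover have "Re (cnj v * (\<i> * of_real (impedance SII) * of_real s2 * \<alpha>2)) = 0"
      unfolding 2[symmetric] fold_defs by (simp add: algebra_simps)
    moreover have "Re (cnj v * (\<i> * of_real (impedance SIII) * of_real s3 * \<alpha>3)) = 0"
      unfolding 3[symmetric] fold_defs by (simp add: algebra_simps)
    moreover have "Re (cnj v * (of_real \<beta> * v)) = \<beta> * (cmod v)\<^sup>2"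
      unfolding cmod_power2 by (simp add: algebra_simps power2_eq_square)
    ultimately show ?thesis by (simp only: distrib_left plus_complex.sel)
  qed
  then have "v = 0" using \<open>\<beta> > 0\<close> unfolding balance[folded defs] by simp
  then have zero: "s1 = 0 \<or> \<alpha>1 = 0" "c2 = 0 \<or> \<alpha>2 = 0" "c3 = 0 \<or> \<alpha>3 = 0"
    using 1 2 3 impedance_pos[of SI] by (auto simp: fold_defs)
  have bal: "of_real c1 * \<alpha>1 + \<i> * of_real (impedance SII) * of_real s2 * \<alpha>2
      + \<i> * of_real (impedance SIII) * of_real s3 * \<alpha>3 = 0"
    using balance \<open>v = 0\<close> by (simp add: fold_defs)
  have nr: "\<not> (s1 = 0 \<and> c2 = 0)" "\<not> (s1 = 0 \<and> c3 = 0)" "\<not> (c2 = 0 \<and> c3 = 0)"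
    using \<open>\<not> resonant \<omega>\<close> unfolding resonant_def defs by auto
  consider "\<alpha>1 = 0" "\<alpha>2 = 0" | "\<alpha>1 = 0" "\<alpha>3 = 0" | "\<alpha>2 = 0" "\<alpha>3 = 0"
    using zero nr by blast
  then show ?thesis
  proof cases
    case 1
    then have "s3 = 0 \<or> \<alpha>3 = 0" using bal impedance_pos[of SIII] by auto
    then show ?thesis using 1 zero(3) pyth(3) by auto
  next
    case 2
    then have "s2 = 0 \<or> \<alpha>2 = 0" using bal impedance_pos[of SII] by auto
    then show ?thesis using 2 zero(2) pyth(2) by auto
  next
    case 3
    then have "c1 = 0 \<or> \<alpha>1 = 0" using bal by auto
    then show ?thesis using 3 zero(1) pyth(1) by auto
  qed
qed

text \<open>Resonance frees two amplitudes under the conditions of zero velocity at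
  \<open>b\<close>. They are chosen so that their forces cancel, and the third is 0; the choice is
  nontrivial because a sine and its cosine do not vanish together.\<close>

lemma boundary_conditions_nontrivial:
  assumes "resonant \<omega>"
  obtains \<alpha>1 \<alpha>2 \<alpha>3 :: complex where "\<not> (\<alpha>1 = 0 \<and> \<alpha>2 = 0 \<and> \<alpha>3 = 0)"
    "of_real (Sn \<omega> SI b) * \<alpha>1 = 0" "of_real (Cs \<omega> SII b) * \<alpha>2 = 0" "of_real (Cs \<omega> SIII b) * \<alpha>3 = 0"
    "of_real (Cs \<omega> SI b) * \<alpha>1 + \<i> * of_real (impedance SII) * of_real (Sn \<omega> SII b) * \<alpha>2
      + \<i> * of_real (impedance SIII) * of_real (Sn \<omega> SIII b) * \<alpha>3 = 0"
proof -
  define s1 c1 s2 c2 s3 c3 where "s1 = Sn \<omega> SI b" and "c1 = Cs \<omega> SI b" and "s2 = Sn \<omega> SII b"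
    and "c2 = Cs \<omega> SII b" and "s3 = Sn \<omega> SIII b" and "c3 = Cs \<omega> SIII b"
  note defs = this
  have pyth: "s1\<^sup>2 + c1\<^sup>2 = 1" "s2\<^sup>2 + c2\<^sup>2 = 1" "s3\<^sup>2 + c3\<^sup>2 = 1"
    by (simp_all add: defs)
  note fold_defs = defs[symmetric]
  consider "s1 = 0" "c2 = 0" | "s1 = 0" "c3 = 0" | "c2 = 0" "c3 = 0"
    using assms unfolding resonant_def defs by blast
  then show ?thesis
  proof cases
    case 1
    then have "c1 \<noteq> 0" using pyth by auto
    then show ?thesis
      using that[of "\<i> * of_real (impedance SII) * of_real s2" "- of_real c1" 0, folded defs] 1
      by (simp add: mult_ac)
  next
    case 2
    then have "c1 \<noteq> 0" using pyth by auto
    then show ?thesis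
      using that[of "\<i> * of_real (impedance SIII) * of_real s3" 0 "- of_real c1", folded defs] 2
      by (simp add: mult_ac)
  next
    case 3
    then have "s2 \<noteq> 0" using pyth by auto
    then show ?thesis
      using that[of 0 "of_real (impedance SIII) * of_real s3" "- (of_real (impedance SII) * of_real s2)", folded defs] 3
        impedance_pos[of SII]
      by (simp add: mult_ac)
  qed
qed

text \<open>The weak derivative agrees almost everywhere with the continuous function
  \<open>rhs \<omega> (F \<zeta>)\<close>. Thus \<open>F\<close> is the integral of a continuous
  function and satisfies the equation at every point of \<open>[a, b]\<close>.\<close>

lemma eigenvector_ode:
  assumes "x \<in> dom_A a b \<beta> \<rho> \<tau>" and eig: "eq_L2 a b (op_A a b \<rho> \<tau> x) (\<lambda>\<zeta>. (\<i> * of_real \<omega>) *s x \<zeta>)"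
  obtains F where "eq_L2 a b (\<lambda>\<zeta>. Ham \<rho> \<tau> *v x \<zeta>) F" "WB \<beta> *v stack (F b) (F a) = 0"
    "\<And>\<zeta>. \<zeta> \<in> {a..b} \<Longrightarrow> (F has_vector_derivative rhs \<omega> (F \<zeta>)) (at \<zeta> within {a..b})"
proof -
  obtain F g where rep: "AC_rep a b (\<lambda>\<zeta>. Ham \<rho> \<tau> *v x \<zeta>) F g" and op: "op_A a b \<rho> \<tau> x = (\<lambda>\<zeta>. P1 *v g \<zeta>)"
    and WB: "WB \<beta> *v stack (F b) (F a) = 0"
    using dom_AE[OF assms(1)] by blast
  have HF: "eq_L2 a b (\<lambda>\<zeta>. Ham \<rho> \<tau> *v x \<zeta>) F" using rep by (simp add: AC_rep_def)
  have "AE \<zeta> in \<mu>. g \<zeta> = rhs \<omega> (F \<zeta>)"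
    using eig HF unfolding eq_L2_def op
  proof eventually_elim
    case (elim \<zeta>)
    have "x \<zeta> = Ham_inv (F \<zeta>)" using elim(2) Ham_inv_Ham by metis
    then have "P1 *v g \<zeta> = P1 *v rhs \<omega> (F \<zeta>)" using elim(1) by (simp add: P1_rhs)
    then show ?case using P1_involution by metis
  qed
  then have "AE \<zeta> in lebesgue. \<zeta> \<in> {a<..<b} \<longrightarrow> g \<zeta> = rhs \<omega> (F \<zeta>)"
    by (simp add: AE_restrict_space_iff)
  then obtain S where S: "S \<in> null_sets lebesgue" "\<And>\<zeta>. \<zeta> \<in> {a<..<b} \<Longrightarrow> \<zeta> \<notin> S \<Longrightarrow> g \<zeta> = rhs \<omega> (F \<zeta>)"
    by (auto elim!: AE_E3 simp: subset_eq)
  have F: "continuous_on {a..b} F" using rep by (rule AC_rep_continuous)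
  have cont: "continuous_on {a..b} (\<lambda>\<zeta>. rhs \<omega> (F \<zeta>))"
    by (rule bounded_linear.continuous_on[OF bounded_linear_rhs F])
  have F_int: "F \<zeta> = F a + integral {a..\<zeta>} (\<lambda>\<zeta>. rhs \<omega> (F \<zeta>))" if "\<zeta> \<in> {a..b}" for \<zeta>
  proof -
    have "integral {a..\<zeta>} g = integral {a..\<zeta>} (\<lambda>\<zeta>. rhs \<omega> (F \<zeta>))"
      using S that
      \<comment> \<open>The almost everywhere equality concerns the open interval, so both endpoints
        join the exceptional set.\<close>
      by (intro integral_spike[of "S \<union> {a, b}"]) (auto simp: negligible_iff_null_sets[symmetric])
    then show ?thesis using AC_rep_integral[OF rep that] by (metis add.commute diff_add_cancel)
  qed
  have "(F has_vector_derivative rhs \<omega> (F \<zeta>)) (at \<zeta> within {a..b})" if "\<zeta> \<in> {a..b}" for \<zeta>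
  proof -
    have "((\<lambda>\<zeta>. F a + integral {a..\<zeta>} (\<lambda>\<zeta>. rhs \<omega> (F \<zeta>))) has_vector_derivative 0 + rhs \<omega> (F \<zeta>)) (at \<zeta> within {a..b})"
      using integral_has_vector_derivative[OF cont that]
      by (intro has_vector_derivative_add has_vector_derivative_const)
    then have "((\<lambda>\<zeta>. F a + integral {a..\<zeta>} (\<lambda>\<zeta>. rhs \<omega> (F \<zeta>))) has_vector_derivative rhs \<omega> (F \<zeta>)) (at \<zeta> within {a..b})"
      by simp
    then show ?thesis
      by (rule has_vector_derivative_transform[OF that F_int, rotated])
  qed
  then show ?thesis using that HF WB by blast
qed

text \<open>Without resonance the boundary conditions force all six values at \<open>a\<close> to be
  0, and the solution formulas propagate this to \<open>[a, b]\<close>.\<close>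

lemma resonant_if_eigenvalue:
  assumes "\<beta> > 0" and "eigenvalue_A a b \<beta> \<rho> \<tau> (\<i> * of_real \<omega>)"
  shows "resonant \<omega>"
proof (rule ccontr)
  assume nres: "\<not> resonant \<omega>"
  obtain x where x: "x \<in> dom_A a b \<beta> \<rho> \<tau>" "\<not> eq_L2 a b x (\<lambda>\<zeta>. 0)"
    "eq_L2 a b (op_A a b \<rho> \<tau> x) (\<lambda>\<zeta>. (\<i> * of_real \<omega>) *s x \<zeta>)"
    using assms(2) by (auto simp: eigenvalue_A_def)
  obtain F where HF: "eq_L2 a b (\<lambda>\<zeta>. Ham \<rho> \<tau> *v x \<zeta>) F" and WB: "WB \<beta> *v stack (F b) (F a) = 0"
    and der: "\<And>\<zeta>. \<zeta> \<in> {a..b} \<Longrightarrow> (F has_vector_derivative rhs \<omega> (F \<zeta>)) (at \<zeta> within {a..b})"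
    using eigenvector_ode[OF x(1,3)] by blast
  have comp: "((\<lambda>\<zeta>. F \<zeta> $ i) has_vector_derivative rhs \<omega> (F \<zeta>) $ i) (at \<zeta> within {a..b})" if "\<zeta> \<in> {a..b}" for \<zeta> i
    using bounded_linear.has_vector_derivative[OF bounded_linear_vec_nth der[OF that]] .
  note comps = comp[of _ 1, unfolded rhs_components] comp[of _ 2, unfolded rhs_components]
    comp[of _ 3, unfolded rhs_components] comp[of _ 4, unfolded rhs_components]
    comp[of _ 5, unfolded rhs_components] comp[of _ 6, unfolded rhs_components]
  note sol1 = string_ode_solution[OF rho_pos[of SI] tau_pos[of SI] _ comps(1,2),
      folded wave_speed_inv_def impedance_def]
  note sol2 = string_ode_solution[OF rho_pos[of SII] tau_pos[of SII] _ comps(3,4),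
      folded wave_speed_inv_def impedance_def]
  note sol3 = string_ode_solution[OF rho_pos[of SIII] tau_pos[of SIII] _ comps(5,6),
      folded wave_speed_inv_def impedance_def]
  have bc: "F b $ 1 = F b $ 3" "F b $ 1 = F b $ 5"
    "of_real \<beta> * F b $ 1 + F b $ 2 + F b $ 4 + F b $ 6 = 0" "F a $ 1 = 0" "F a $ 4 = 0" "F a $ 6 = 0"
    using WB unfolding WB_stack by blast+
  have b: "b \<in> {a..b}" using ab by simp
  \<comment> \<open>The three components not fixed by the conditions at \<open>a\<close> are the
    amplitudes of \<open>boundary_conditions_trivial\<close>.\<close>
  have Fa: "F a $ 2 = 0 \<and> F a $ 3 = 0 \<and> F a $ 5 = 0"
    using bc sol1[OF b] sol2[OF b] sol3[OF b] nres \<open>\<beta> > 0\<close>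
    by (intro boundary_conditions_trivial[where v = "F b $ 1"]) (simp_all add: add.assoc)
  have "F \<zeta> = 0" if "\<zeta> \<in> {a..b}" for \<zeta>
    using sol1[OF that] sol2[OF that] sol3[OF that] Fa bc by (simp add: vec_eq_iff forall_6)
  then have "AE \<zeta> in \<mu>. F \<zeta> = 0"
    by (intro AE_I2) (auto simp: space_restrict_space)
  then have "eq_L2 a b x (\<lambda>\<zeta>. 0)"
    using HF unfolding eq_L2_def
  proof eventually_elim
    case (elim \<zeta>)
    then show ?case using Ham_inv_Ham[of "x \<zeta>"] linear_0[OF bounded_linear.linear[OF bounded_linear_Ham_inv]] by simp
  qed
  then show False using x(2) by simp
qed

text \<open>The amplitudes of \<open>boundary_conditions_nontrivial\<close> are propagated from
  \<open>a\<close> by the explicit solution formulas, and \<open>Ham_inv\<close> turns the result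
  into an eigenvector.\<close>

lemma eigenvalue_if_resonant:
  assumes "resonant \<omega>"
  shows "eigenvalue_A a b \<beta> \<rho> \<tau> (\<i> * of_real \<omega>)"
proof -
  obtain \<alpha>1 \<alpha>2 \<alpha>3 :: complex where nz: "\<not> (\<alpha>1 = 0 \<and> \<alpha>2 = 0 \<and> \<alpha>3 = 0)" and
    \<alpha>: "of_real (Sn \<omega> SI b) * \<alpha>1 = 0" "of_real (Cs \<omega> SII b) * \<alpha>2 = 0" "of_real (Cs \<omega> SIII b) * \<alpha>3 = 0"
    "of_real (Cs \<omega> SI b) * \<alpha>1 + \<i> * of_real (impedance SII) * of_real (Sn \<omega> SII b) * \<alpha>2
      + \<i> * of_real (impedance SIII) * of_real (Sn \<omega> SIII b) * \<alpha>3 = 0"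
    using boundary_conditions_nontrivial[OF assms] by blast
  \<comment> \<open>At \<open>y = a\<close> components 2, 3 and 5 are the amplitudes and the others
    vanish, so the conditions at \<open>a\<close> hold by construction.\<close>
  define F :: "real \<Rightarrow> complex^6" where "F y = vector
    [\<i> / of_real (impedance SI) * of_real (Sn \<omega> SI y) * \<alpha>1, of_real (Cs \<omega> SI y) * \<alpha>1,
     of_real (Cs \<omega> SII y) * \<alpha>2, \<i> * of_real (impedance SII) * of_real (Sn \<omega> SII y) * \<alpha>2,
     of_real (Cs \<omega> SIII y) * \<alpha>3, \<i> * of_real (impedance SIII) * of_real (Sn \<omega> SIII y) * \<alpha>3]" for y
  have F: "F y $ 1 = \<i> / of_real (impedance SI) * of_real (Sn \<omega> SI y) * \<alpha>1" "F y $ 2 = of_real (Cs \<omega> SI y) * \<alpha>1"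
    "F y $ 3 = of_real (Cs \<omega> SII y) * \<alpha>2" "F y $ 4 = \<i> * of_real (impedance SII) * of_real (Sn \<omega> SII y) * \<alpha>2"
    "F y $ 5 = of_real (Cs \<omega> SIII y) * \<alpha>3" "F y $ 6 = \<i> * of_real (impedance SIII) * of_real (Sn \<omega> SIII y) * \<alpha>3" for y
    by (simp_all add: F_def vector_6)
  have contF: "continuous_on {a..b} F"
  proof -
    have "\<forall>i. continuous_on {a..b} (\<lambda>y. F y $ i)"
      unfolding forall_6 F by (intro conjI continuous_intros)
    then have "continuous_on {a..b} (\<lambda>y. \<chi> i. F y $ i)"
      by (intro continuous_on_vec_lambda) blast
    then show ?thesis by simp
  qed
  have cont: "continuous_on {a..b} (\<lambda>\<zeta>. rhs \<omega> (F \<zeta>))"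
    by (rule bounded_linear.continuous_on[OF bounded_linear_rhs contF])
  have Sn_der: "((\<lambda>y. complex_of_real (Sn \<omega> k y)) has_vector_derivative of_real (\<omega> * wave_speed_inv k) * of_real (Cs \<omega> k y)) (at y within {a..b})"
    and Cs_der: "((\<lambda>y. complex_of_real (Cs \<omega> k y)) has_vector_derivative - of_real (\<omega> * wave_speed_inv k) * of_real (Sn \<omega> k y)) (at y within {a..b})" for k y
    by (rule has_vector_derivative_eq_rhs, rule has_vector_derivative_of_real,
     (auto intro!: derivative_eq_intros simp flip: has_real_derivative_iff_has_vector_derivative))+
  have zc: "complex_of_real (\<rho> k) = of_real (impedance k) * of_real (wave_speed_inv k)"
    "1 / complex_of_real (\<tau> k) = of_real (wave_speed_inv k) / of_real (impedance k)" for k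
    using sqrt_mult_div[OF rho_pos tau_pos, of k k, THEN arg_cong[where f = complex_of_real]]
    by (simp_all add: impedance_def wave_speed_inv_def)
  have der: "((\<lambda>y. F y $ i) has_vector_derivative rhs \<omega> (F y) $ i) (at y within {a..b})" for i y
  proof -
    have \<tau>: "v / complex_of_real (\<tau> k) = v * (of_real (wave_speed_inv k) / of_real (impedance k))" for v k
      using zc(2)[of k] by (metis times_divide_eq_right mult.right_neutral)
    note imp = impedance_pos[THEN less_imp_neq, symmetric]
    note rules = has_vector_derivative_mult[OF has_vector_derivative_mult[OF has_vector_derivative_const Sn_der]
        has_vector_derivative_const] has_vector_derivative_mult[OF Cs_der has_vector_derivative_const]
    have "\<forall>i. ((\<lambda>y. F y $ i) has_vector_derivative rhs \<omega> (F y) $ i) (at y within {a..b})"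
      unfolding forall_6 rhs_components F \<tau> zc(1)
      by (intro conjI; rule has_vector_derivative_eq_rhs, rule rules)
        (use imp in \<open>simp_all add: field_simps\<close>)
    then show ?thesis by blast
  qed
  have int: "F \<zeta> = F a + integral {a..\<zeta>} (\<lambda>\<zeta>. rhs \<omega> (F \<zeta>))" if "\<zeta> \<in> {a..b}" for \<zeta>
    unfolding vec_eq_iff
  proof
    fix i
    have io: "(\<lambda>\<zeta>. rhs \<omega> (F \<zeta>)) integrable_on {a..\<zeta>}"
      using that by (intro integrable_continuous_real continuous_on_subset[OF cont]) auto
    have "((\<lambda>\<zeta>. rhs \<omega> (F \<zeta>) $ i) has_integral (F \<zeta> $ i - F a $ i)) {a..\<zeta>}"
      using that by (intro fundamental_theorem_of_calculus has_vector_derivative_within_subset[OF der]) auto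
    then have "integral {a..\<zeta>} (\<lambda>\<zeta>. rhs \<omega> (F \<zeta>) $ i) = F \<zeta> $ i - F a $ i" by (rule integral_unique)
    moreover have "integral {a..\<zeta>} (\<lambda>\<zeta>. rhs \<omega> (F \<zeta>) $ i) = integral {a..\<zeta>} (\<lambda>\<zeta>. rhs \<omega> (F \<zeta>)) $ i"
      using integral_linear[OF io bounded_linear_vec_nth, of i] by (simp add: o_def)
    ultimately show "F \<zeta> $ i = (F a + integral {a..\<zeta>} (\<lambda>\<zeta>. rhs \<omega> (F \<zeta>))) $ i" by simp
  qed
  define x where "x = (\<lambda>\<zeta>. Ham_inv (F \<zeta>))"
  have x: "x \<in> X"
    unfolding x_def by (intro continuous_L2 bounded_linear.continuous_on[OF bounded_linear_Ham_inv] contF)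
  have rep: "AC_rep a b (\<lambda>\<zeta>. Ham \<rho> \<tau> *v x \<zeta>) F (\<lambda>\<zeta>. rhs \<omega> (F \<zeta>))"
    unfolding AC_rep_iff
  proof (intro conjI ballI)
    show "eq_L2 a b (\<lambda>\<zeta>. Ham \<rho> \<tau> *v x \<zeta>) F" by (simp add: x_def Ham_Ham_inv eq_L2_def)
  qed (use int continuous_L2[OF cont] in blast)+
  have WB: "WB \<beta> *v stack (F b) (F a) = 0"
    unfolding WB_stack F using \<alpha> by (auto simp: add.assoc)
  have "eq_L2 a b (op_A a b \<rho> \<tau> x) (\<lambda>\<zeta>. (\<i> * of_real \<omega>) *s x \<zeta>)"
    using dom_AI(2)[OF x rep WB] by (simp add: P1_rhs x_def)
  moreover have "\<not> eq_L2 a b x (\<lambda>\<zeta>. 0)"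
  proof
    assume "eq_L2 a b x (\<lambda>\<zeta>. 0)"
    then have "eq_L2 a b F (\<lambda>\<zeta>. 0)"
      unfolding eq_L2_def
    proof eventually_elim
      case (elim \<zeta>)
      then show ?case using Ham_Ham_inv[of "F \<zeta>"] by (simp add: x_def)
    qed
    \<comment> \<open>The continuous representative vanishes at \<open>a\<close> as well, where its
      components include the amplitudes.\<close>
    then have "F a = 0"
      using ab by (intro continuous_eq_L2[OF contF]) auto
    then have "F a $ 2 = 0" "F a $ 3 = 0" "F a $ 5 = 0" by simp_all
    then show False using nz by (simp add: F)
  qed
  ultimately show ?thesis
    using dom_AI(1)[OF x rep WB] unfolding eigenvalue_A_def by blast
qed

end

section \<open>The arithmetic condition\<close>

text \<open>The zeros of the sine are the even multiples of \<open>pi / 2\<close>, those of the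
  cosine the odd ones. Dividing the two equations eliminates \<open>\<omega>\<close>.\<close>

lemma sin_cos_common_zero_iff:
  assumes "u > 0" "v > 0"
  shows "(\<exists>\<omega>. sin (\<omega> * u) = 0 \<and> cos (\<omega> * v) = 0) \<longleftrightarrow> u / v \<in> even_over_odd"
proof
  assume "\<exists>\<omega>. sin (\<omega> * u) = 0 \<and> cos (\<omega> * v) = 0"
  then obtain \<omega> and k l :: int where k: "\<omega> * u = of_int k * pi" and l: "\<omega> * v = of_int l * pi + pi / 2"
    unfolding sin_zero_iff_int2 cos_zero_iff_int2 by blast
  have l0: "of_int (1 + 2 * l) \<noteq> (0 :: real)" unfolding of_int_eq_0_iff by presburger
  have "cos (\<omega> * v) = 0" unfolding cos_zero_iff_int2 using l by blast
  \<comment> \<open>\<open>cos 0 = 1\<close> excludes the zero frequency, so \<open>\<omega>\<close>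
    can be cancelled.\<close>
  then have "\<omega> \<noteq> 0" by auto
  then have "u / v = (\<omega> * u) / (\<omega> * v)" by simp
  also have "\<dots> = of_int (2 * k) * (pi / 2) / (of_int (1 + 2 * l) * (pi / 2))"
    unfolding k l by (simp add: algebra_simps)
  also have "\<dots> = of_int (2 * k) / of_int (1 + 2 * l)"
    by (rule mult_divide_mult_cancel_right) simp
  finally show "u / v \<in> even_over_odd" unfolding even_over_odd_def by blast
next
  assume "u / v \<in> even_over_odd"
  then obtain k l :: int where kl: "u / v = of_int (2 * k) / of_int (1 + 2 * l)"
    unfolding even_over_odd_def by blast
  have l0: "of_int (1 + 2 * l) \<noteq> (0 :: real)" unfolding of_int_eq_0_iff by presburger
  \<comment> \<open>Chosen so that \<open>\<omega> * v\<close> is the odd multiple of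
    \<open>pi / 2\<close> given by the denominator; the numerator then determines
    \<open>\<omega> * u\<close>.\<close>
  define \<omega> where "\<omega> = of_int (1 + 2 * l) * pi / (2 * v)"
  have "\<omega> * v = of_int l * pi + pi / 2" using assms by (simp add: \<omega>_def field_simps)
  moreover have "\<omega> * u = of_int (1 + 2 * l) * pi / 2 * (u / v)" by (simp add: \<omega>_def)
  then have "\<omega> * u = of_int k * pi" unfolding kl using l0 by simp
  ultimately show "\<exists>\<omega>. sin (\<omega> * u) = 0 \<and> cos (\<omega> * v) = 0"
    unfolding sin_zero_iff_int2 cos_zero_iff_int2 by blast
qed

lemma cos_cos_common_zero_iff:
  assumes "u > 0" "v > 0"
  shows "(\<exists>\<omega>. cos (\<omega> * u) = 0 \<and> cos (\<omega> * v) = 0) \<longleftrightarrow> u / v \<in> odd_over_odd"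
proof
  assume "\<exists>\<omega>. cos (\<omega> * u) = 0 \<and> cos (\<omega> * v) = 0"
  then obtain \<omega> and k l :: int where k: "\<omega> * u = of_int k * pi + pi / 2" and l: "\<omega> * v = of_int l * pi + pi / 2"
    unfolding cos_zero_iff_int2 by blast
  have l0: "of_int (1 + 2 * l) \<noteq> (0 :: real)" unfolding of_int_eq_0_iff by presburger
  have "cos (\<omega> * v) = 0" unfolding cos_zero_iff_int2 using l by blast
  then have "\<omega> \<noteq> 0" by auto
  then have "u / v = (\<omega> * u) / (\<omega> * v)" by simp
  also have "\<dots> = of_int (1 + 2 * k) * (pi / 2) / (of_int (1 + 2 * l) * (pi / 2))"
    unfolding k l by (simp add: algebra_simps)
  also have "\<dots> = of_int (1 + 2 * k) / of_int (1 + 2 * l)"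
    by (rule mult_divide_mult_cancel_right) simp
  finally show "u / v \<in> odd_over_odd" unfolding odd_over_odd_def by blast
next
  assume "u / v \<in> odd_over_odd"
  then obtain k l :: int where kl: "u / v = of_int (1 + 2 * k) / of_int (1 + 2 * l)"
    unfolding odd_over_odd_def by blast
  have l0: "of_int (1 + 2 * l) \<noteq> (0 :: real)" unfolding of_int_eq_0_iff by presburger
  define \<omega> where "\<omega> = of_int (1 + 2 * l) * pi / (2 * v)"
  have \<omega>v: "\<omega> * v = of_int l * pi + pi / 2" using assms by (simp add: \<omega>_def field_simps)
  have "\<omega> * u = of_int (1 + 2 * l) * pi / 2 * (u / v)" by (simp add: \<omega>_def)
  moreover have "m * pi / 2 * (x / m) = x * pi / 2" if "m \<noteq> 0" for m x :: real
    using that by simp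
  ultimately have "\<omega> * u = of_int (1 + 2 * k) * pi / 2" unfolding kl using l0 by metis
  then have "\<omega> * u = of_int k * pi + pi / 2" by (simp add: algebra_simps)
  then show "\<exists>\<omega>. cos (\<omega> * u) = 0 \<and> cos (\<omega> * v) = 0"
    using \<omega>v unfolding cos_zero_iff_int2 by blast
qed

lemma sin_zero_odd_multiple:
  fixes x :: real
  assumes "sin x = 0"
  shows "sin (real (2 * n + 1) * x) = 0"
proof -
  obtain k :: int where "x = of_int k * pi" using assms unfolding sin_zero_iff_int2 by blast
  then have "real (2 * n + 1) * x = of_int (int (2 * n + 1) * k) * pi" by simp
  then show ?thesis unfolding sin_zero_iff_int2 by blast
qed

text \<open>An odd multiple of an odd multiple of \<open>pi / 2\<close> is again one, which yields
  infinitely many resonant frequencies from a single one.\<close>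

lemma cos_zero_odd_multiple:
  fixes x :: real
  assumes "cos x = 0"
  shows "cos (real (2 * n + 1) * x) = 0"
proof -
  obtain k :: int where "x = of_int k * pi + pi / 2" using assms unfolding cos_zero_iff_int2 by blast
  then have "real (2 * n + 1) * x = of_int (int (2 * n + 1) * k + int n) * pi + pi / 2"
    by (simp add: algebra_simps)
  then show ?thesis unfolding cos_zero_iff_int2 by blast
qed

context string_space
begin

lemma resonant_odd_multiple:
  assumes "resonant \<omega>"
  shows "resonant (real (2 * n + 1) * \<omega>)"
proof -
  have "Sn (real (2 * n + 1) * \<omega>) k b = 0" if "Sn \<omega> k b = 0" for k
    using sin_zero_odd_multiple[OF that, of n] by (simp only: mult.assoc)
  moreover have "Cs (real (2 * n + 1) * \<omega>) k b = 0" if "Cs \<omega> k b = 0" for k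
    using cos_zero_odd_multiple[OF that, of n] by (simp only: mult.assoc)
  ultimately show ?thesis using assms unfolding resonant_def by blast
qed

text \<open>Every alternative in \<open>resonant\<close> contains a cosine, and
  \<open>cos 0 = 1\<close>.\<close>

lemma resonant_nonzero: "resonant \<omega> \<Longrightarrow> \<omega> \<noteq> 0"
  by (auto simp: resonant_def)

lemma resonant_iff_arithmetic:
  "(\<exists>\<omega>. resonant \<omega>) \<longleftrightarrow> wave_speed_inv SI / wave_speed_inv SII \<in> even_over_odd \<or>
    wave_speed_inv SI / wave_speed_inv SIII \<in> even_over_odd \<or>
    wave_speed_inv SII / wave_speed_inv SIII \<in> odd_over_odd"
proof -
  define u where "u k = wave_speed_inv k * (b - a)" for k
  have u: "u k > 0" for k using wave_speed_inv_pos ab by (simp add: u_def)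
  have ratio: "wave_speed_inv k / wave_speed_inv l = u k / u l" for k l
    using ab by (simp add: u_def)
  have arg: "\<omega> * wave_speed_inv k * (b - a) = \<omega> * u k" for \<omega> k
    by (simp add: u_def)
  show ?thesis
    unfolding resonant_def arg ratio sin_cos_common_zero_iff[OF u u, symmetric]
      cos_cos_common_zero_iff[OF u u, symmetric] by blast
qed

end

section \<open>Equivalence of all conditions with the existence of a resonant frequency\<close>

theorem theorem4p8:
  fixes a b \<beta> :: real
    and \<rho> \<tau> :: "string_id \<Rightarrow> real"
    and T :: "real \<Rightarrow> (real \<Rightarrow> complex^6) \<Rightarrow> (real \<Rightarrow> complex^6)"
    and \<Psi> :: "real \<Rightarrow> string_id \<Rightarrow> real \<Rightarrow> complex^2^2"
  assumes "a < b"
    and "\<beta> > 0"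
    and "\<And>k. \<rho> k > 0"
    and "\<And>k. \<tau> k > 0"
    and "contraction_semigroup a b \<rho> \<tau> T"
    and "generated_by_A a b \<beta> \<rho> \<tau> T"
    and "\<And>\<omega> k. fundamental_solution a b (\<rho> k) (\<tau> k) \<omega> (\<Psi> \<omega> k)"
  defines "c \<equiv> (\<lambda>k. sqrt (\<rho> k / \<tau> k))"
  shows "(\<not> semi_uniformly_stable a b \<beta> \<rho> \<tau> T \<longleftrightarrow>
           (\<exists>\<omega>::real.
              cmod (\<Psi> \<omega> SI b $ 1 $ 2 * \<Psi> \<omega> SII b $ 1 $ 1) +
              cmod (\<Psi> \<omega> SI b $ 1 $ 2 * \<Psi> \<omega> SIII b $ 1 $ 1) +
              cmod (\<Psi> \<omega> SII b $ 1 $ 1 * \<Psi> \<omega> SIII b $ 1 $ 1) = 0)) \<and>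
         (\<not> semi_uniformly_stable a b \<beta> \<rho> \<tau> T \<longleftrightarrow>
           (c SI / c SII \<in> even_over_odd \<or>
            c SI / c SIII \<in> even_over_odd \<or>
            c SII / c SIII \<in> odd_over_odd)) \<and>
         (\<not> semi_uniformly_stable a b \<beta> \<rho> \<tau> T \<longleftrightarrow>
           infinite {\<mu>. eigenvalue_A a b \<beta> \<rho> \<tau> \<mu> \<and> Re \<mu> = 0})"
proof -
  interpret string_semigroup a b \<rho> \<tau> \<beta> T
    using assms(1,3-6) by unfold_locales auto
  have \<Psi>: "\<Psi> \<omega> k b $ 1 $ 1 = of_real (Cs \<omega> k b)"
    "\<Psi> \<omega> k b $ 1 $ 2 = \<i> / of_real (impedance k) * of_real (Sn \<omega> k b)" for \<omega> k
    using fundamental_solution_first_row[OF ab rho_pos tau_pos assms(7)]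
    unfolding wave_speed_inv_def impedance_def by auto
  \<comment> \<open>A sum of nonnegative terms vanishes iff all three products do, that is, iff two
    of the three entries are zero.\<close>
  have resonant_iff: "resonant \<omega> \<longleftrightarrow> cmod (\<Psi> \<omega> SI b $ 1 $ 2 * \<Psi> \<omega> SII b $ 1 $ 1) +
      cmod (\<Psi> \<omega> SI b $ 1 $ 2 * \<Psi> \<omega> SIII b $ 1 $ 1) +
      cmod (\<Psi> \<omega> SII b $ 1 $ 1 * \<Psi> \<omega> SIII b $ 1 $ 1) = 0" for \<omega>
    using impedance_pos[of SI] unfolding \<Psi> resonant_def
    by (auto simp: add_nonneg_eq_0_iff)
  have eigenvalue_iff: "eigenvalue_A a b \<beta> \<rho> \<tau> (\<i> * of_real \<omega>) \<longleftrightarrow> resonant \<omega>" for \<omega>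
    using resonant_if_eigenvalue[OF assms(2)] eigenvalue_if_resonant by blast
  have resonant_if_unstable: "\<exists>\<omega>. resonant \<omega>" if unstable: "\<not> semi_uniformly_stable a b \<beta> \<rho> \<tau> T"
  proof -
    obtain w \<omega> where w: "graph w (\<lambda>\<zeta>. (\<i> * of_real \<omega>) *s w \<zeta>)" "N w = 1"
      using eigenvector_if_not_stable[OF unstable] by blast
    then have "\<not> eq_L2 a b w (\<lambda>\<zeta>. 0)"
      using N_eq_0_iff[of w] by (simp add: graph_def)
    then have "eigenvalue_A a b \<beta> \<rho> \<tau> (\<i> * of_real \<omega>)"
      using w(1) unfolding eigenvalue_A_def graph_iff by blast
    then show ?thesis using eigenvalue_iff by blast
  qed
  \<comment> \<open>An eigenvector has an orbit of constant norm, which a decay function tending to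
    0 would force to be 0.\<close>
  have unstable_if_resonant: "\<not> semi_uniformly_stable a b \<beta> \<rho> \<tau> T" if res: "resonant \<omega>" for \<omega>
  proof
    assume "semi_uniformly_stable a b \<beta> \<rho> \<tau> T"
    then obtain f where f: "(f \<longlongrightarrow> 0) at_top"
      "\<And>x t. x \<in> DA \<Longrightarrow> t \<ge> 0 \<Longrightarrow> N (T t x) \<le> f t * graph_norm_A a b \<rho> \<tau> x"
      unfolding semi_uniformly_stable_def by blast
    obtain w where w: "w \<in> DA" "\<not> eq_L2 a b w (\<lambda>\<zeta>. 0)" "eq_L2 a b (A w) (\<lambda>\<zeta>. (\<i> * of_real \<omega>) *s w \<zeta>)"
      using res eigenvalue_iff unfolding eigenvalue_A_def by blast
    then have wX: "w \<in> X" by (intro dom_A_X)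
    then have "graph w (\<lambda>\<zeta>. (\<i> * of_real \<omega>) *s w \<zeta>)"
      using w by (simp add: graph_iff L2_scale)
    then have "N w \<le> f t * graph_norm_A a b \<rho> \<tau> w" if "t \<ge> 0" for t
      using eigenvector_orbit[of w \<omega> t] f(2)[OF w(1) that] that by simp
    then have "\<forall>\<^sub>F t in at_top. N w \<le> f t * graph_norm_A a b \<rho> \<tau> w"
      by (rule eventually_mono[OF eventually_ge_at_top[of 0]])
    moreover have "((\<lambda>t. f t * graph_norm_A a b \<rho> \<tau> w) \<longlongrightarrow> 0 * graph_norm_A a b \<rho> \<tau> w) at_top"
      by (intro tendsto_intros f(1))
    ultimately have "N w \<le> 0"
      by (intro tendsto_lowerbound[of "\<lambda>t. f t * graph_norm_A a b \<rho> \<tau> w" 0 at_top "N w"]) auto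
    then have "N w = 0" by (simp add: order_antisym)
    then show False using N_eq_0_iff[OF wX] w(2) by blast
  qed
  have infinite_iff: "infinite {\<mu>. eigenvalue_A a b \<beta> \<rho> \<tau> \<mu> \<and> Re \<mu> = 0} \<longleftrightarrow> (\<exists>\<omega>. resonant \<omega>)"
  proof
    assume "infinite {\<mu>. eigenvalue_A a b \<beta> \<rho> \<tau> \<mu> \<and> Re \<mu> = 0}"
    then obtain \<mu> where \<mu>: "eigenvalue_A a b \<beta> \<rho> \<tau> \<mu>" "Re \<mu> = 0"
      using infinite_imp_nonempty by blast
    then have "\<mu> = \<i> * of_real (Im \<mu>)" by (simp add: complex_eq_iff)
    then show "\<exists>\<omega>. resonant \<omega>" using \<mu>(1) eigenvalue_iff by metis
  next
    assume "\<exists>\<omega>. resonant \<omega>"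
    then obtain \<omega> where \<omega>: "resonant \<omega>" by blast
    \<comment> \<open>The odd multiples of one resonant frequency; they are distinct because that
      frequency is nonzero.\<close>
    define g where "g n = \<i> * of_real (real (2 * n + 1) * \<omega>)" for n
    have "inj g"
    proof (rule injI)
      fix n m assume "g n = g m"
      then have "real (2 * n + 1) = real (2 * m + 1)"
        using resonant_nonzero[OF \<omega>] unfolding g_def mult_cancel_left of_real_eq_iff by simp
      then show "n = m" by simp
    qed
    then have "infinite (range g)" by (rule range_inj_infinite)
    moreover have "eigenvalue_A a b \<beta> \<rho> \<tau> (g n)" "Re (g n) = 0" for n
      unfolding g_def eigenvalue_iff using resonant_odd_multiple[OF \<omega>] by simp_all
    then have "range g \<subseteq> {\<mu>. eigenvalue_A a b \<beta> \<rho> \<tau> \<mu> \<and> Re \<mu> = 0}"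
      by auto
    ultimately show "infinite {\<mu>. eigenvalue_A a b \<beta> \<rho> \<tau> \<mu> \<and> Re \<mu> = 0}"
      using finite_subset by blast
  qed
  have "\<not> semi_uniformly_stable a b \<beta> \<rho> \<tau> T \<longleftrightarrow> (\<exists>\<omega>. resonant \<omega>)"
    using resonant_if_unstable unstable_if_resonant by blast
  then show ?thesis
    using resonant_iff_arithmetic unfolding resonant_iff infinite_iff c_def wave_speed_inv_def by blast
qed

end
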